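(* Assume that the (bounded) service allocation $\phi=(\phi_1,\dots,\phi_N):\mathbb{Z}_+^N\to\mathbb{R}_+^N$ is partially decreasing and has uniform limits at infinity. Then the set $$\mathcal{S}(\phi)=\bigcup_\sigma\left\{\lambda\in(0,\infty)^N:\ \lambda^\sigma\in S_N(\phi^\sigma)\right\},$$ where the union is over all permutations $\sigma$ of $\{1,\dots,N\}$, is open, and the queue length process $X=(X_1,\dots,X_N)$ with arrival rates $\lambda=(\lambda_1,\dots,\lambda_N)\in(0,\infty)^N$ and service allocation $\phi$ is stable for all $\lambda\in\mathcal{S}(\phi)$, and unstable for all $\lambda\in(0,\infty)^N$ outside the closure of $\mathcal{S}(\phi)$.
   Context: $\mathbb{Z}_+=\{0,1,2,\dots\}$, $\mathbb{R}_+=[0,\infty)$, $e_i$ is the $i$-th unit vector, and $\le$ on $\mathbb{Z}_+^N$ is the coordinatewise order. Queue length process: given arrival rates $\lambda_i>0$ and a bounded function $\phi=(\phi_1,\dots,\phi_N):\mathbb{Z}_+^N\to\mathbb{R}_+^N$ (the service allocation), $X$ is the continuous-time Markov process on $\mathbb{Z}_+^N$ with transitions $x\mapsto x+e_i$ at rate $\lambda_i$ and $x\mapsto x-e_i$ at rate $\phi_i(x)1(x_i>0)$, $i=1,\dots,N$. $\phi$ is partially decreasing if for all $i$, $\phi_i(x)\ge\phi_i(y)$ for all $x\le y$ in $\mathbb{Z}_+^N$ such that $x_i=y_i$. A function $f:\mathbb{Z}_+^N\to\mathbb{R}$ has uniform limits at infinity if (a) there is a constant $f^0$ with $\sup_{x\in\mathbb{Z}_+^N:\,x_1,\dots,x_N>r}|f(x)-f^0|\to0$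 as $r\to\infty$; and (b) for any $n=1,\dots,N-1$ and any permutation $\sigma$ of $\{1,\dots,N\}$ there is a function $f^{n,\sigma}:\mathbb{Z}_+^n\to\mathbb{R}$ such that $\sup_{x\in\mathbb{Z}_+^N:\,x_{\sigma(n+1)},\dots,x_{\sigma(N)}>r}|f(x)-f^{n,\sigma}(x_{\sigma(1)},\dots,x_{\sigma(n)})|\to0$ as $r\to\infty$. The allocation $\phi$ has uniform limits at infinity if each $\phi_i$ does. For any bounded allocation $\phi$, the lower partial limits are, for $0\le n\le N$ and $1\le i\le N$, $$\ell^n\phi_i(x_1,\dots,x_n)=\lim_{r\to\infty}\ \inf_{x_{n+1},\dots,x_N>r}\phi_i(x_1,\dots,x_N)$$ (so $\ell^0\phi_i$ is a constant and $\ell^N\phi_i=\phi_i$). For $n\ge1$ and $\lambda_1,\dots,\lambda_n>0$, $Y^n$ is the continuous-time Markov process on $\mathbb{Z}_+^n$ with transitions $x\mapsto x+e_i$ at rate $\lambda_i$ and $x\mapsto x-e_i$ at rate $\ell^n\phi_i(x)1(x_i>0)$, $i=1,\dots,n$. If $Y^n$ has a unique stationary distribution $\pi^n$, then $$L^n_i(\lambda_1,\dots,\lambda_n;\phi)=\sum_{x\in\mathbb{Z}_+^n}\ell^n\phi_i(x)\,\pi^n(x),$$ and otherwise $L^n_i(\lambda_1,\dots,\lambda_n;\phi)=0$. For $n=0$, $L^0_i=\ell^0\phi_i$. Put $$S_N(\phi)=\left\{\lambda\in(0,\infty)^N:\ \lambda_i<L_i^{i-1}(\lambda_1,\dots,\lambda_{i-1};\phi)\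 \text{ for all } i=1,\dots,N\right\}.$$ For a permutation $\sigma$ of $\{1,\dots,N\}$, $\lambda^\sigma_i=\lambda_{\sigma(i)}$ and $\phi^\sigma_i(x)=\phi_{\sigma(i)}(x_{\sigma^{-1}(1)},\dots,x_{\sigma^{-1}(N)})$ (the system with queues relabeled according to $\sigma$). A stochastic process $U$ with values in a countable space $S$ is stable if for every $\epsilon>0$ there is a finite set $K\subset S$ such that $\Pr(U(t)\notin K)\le\epsilon$ for all $t\ge0$; otherwise it is unstable. The assertions on stability and instability of $X$ hold regardless of the initial state. *)

theory Defs
  imports "HOL-Probability.Probability" "HOL-Combinatorics.Permutations"
begin

(* Vectors with N coordinates, indexed by 1,...,N, are extensional functions on {1..N}; this makes
   all dimensions n \<le> N available at once. *)

definition states :: "nat \<Rightarrow> (nat \<Rightarrow> nat) set" where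
  "states n = ({1..n} \<rightarrow>\<^sub>E UNIV)"

definition pos_vectors :: "nat \<Rightarrow> (nat \<Rightarrow> real) set" where
  "pos_vectors n = ({1..n} \<rightarrow>\<^sub>E {0<..})"


(* Continuous-time Markov processes on a countable set S. The value q x y is used only for
   x \<noteq> y in S, and is the rate of the transition from x to y. The diagonal entries of the
   generator make its rows sum to zero. For bounded total rates exactly one transition function
   (on S) has the prescribed derivative at 0, namely exp(tQ). *)

definition generator :: "'s set \<Rightarrow> ('s \<Rightarrow> 's \<Rightarrow> real) \<Rightarrow> 's \<Rightarrow> 's \<Rightarrow> real" where
  "generator S q x y = (if x = y then - (\<Sum>\<^sub>\<infinity>z\<in>S - {x}. q x z) else q x y)"

definition transition_function ::
    "'s set \<Rightarrow> ('s \<Rightarrow> 's \<Rightarrow> real) \<Rightarrow> (real \<Rightarrow> 's \<Rightarrow> 's pmf) \<Rightarrow> bool" where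
  "transition_function S q p \<longleftrightarrow>
     (\<forall>t\<ge>0. \<forall>x\<in>S. set_pmf (p t x) \<subseteq> S) \<and>
     (\<forall>x\<in>S. p 0 x = return_pmf x) \<and>
     (\<forall>s\<ge>0. \<forall>t\<ge>0. \<forall>x\<in>S. p (s + t) x = bind_pmf (p s x) (p t)) \<and>
     (\<forall>x\<in>S. \<forall>y\<in>S. ((\<lambda>t. pmf (p t x) y) has_real_derivative generator S q x y) (at 0 within {0..}))"

definition markov_process ::
    "'w measure \<Rightarrow> 's set \<Rightarrow> ('s \<Rightarrow> 's \<Rightarrow> real) \<Rightarrow> (real \<Rightarrow> 'w \<Rightarrow> 's) \<Rightarrow> bool" where
  "markov_process M S q X \<longleftrightarrow>
     prob_space M \<and>
     (\<forall>t\<ge>0. X t \<in> M \<rightarrow>\<^sub>M count_space S) \<and>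
     (\<exists>p. transition_function S q p \<and>
       (\<forall>s\<ge>0. \<forall>t\<ge>0. \<forall>x\<in>S. \<forall>y\<in>S. \<forall>J z. finite J \<longrightarrow> J \<subseteq> {0..<s} \<longrightarrow>
          0 < \<P>(\<omega> in M. X s \<omega> = x \<and> (\<forall>r\<in>J. X r \<omega> = z r)) \<longrightarrow>
          \<P>(\<omega> in M. X (s + t) \<omega> = y \<bar> X s \<omega> = x \<and> (\<forall>r\<in>J. X r \<omega> = z r)) = pmf (p t x) y))"

definition stationary_distribution :: "'s set \<Rightarrow> ('s \<Rightarrow> 's \<Rightarrow> real) \<Rightarrow> 's pmf \<Rightarrow> bool" where
  "stationary_distribution S q \<pi> \<longleftrightarrow>
     set_pmf \<pi> \<subseteq> S \<and> (\<exists>p. transition_function S q p \<and> (\<forall>t\<ge>0. bind_pmf \<pi> (p t) = \<pi>))"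

definition stable_process :: "'w measure \<Rightarrow> 's set \<Rightarrow> (real \<Rightarrow> 'w \<Rightarrow> 's) \<Rightarrow> bool" where
  "stable_process M S U \<longleftrightarrow>
     (\<forall>\<epsilon>>0. \<exists>K. finite K \<and> K \<subseteq> S \<and> (\<forall>t\<ge>0. \<P>(\<omega> in M. U t \<omega> \<notin> K) \<le> \<epsilon>))"


definition queue_rate ::
    "nat \<Rightarrow> (nat \<Rightarrow> real) \<Rightarrow> (nat \<Rightarrow> (nat \<Rightarrow> nat) \<Rightarrow> real) \<Rightarrow> (nat \<Rightarrow> nat) \<Rightarrow> (nat \<Rightarrow> nat) \<Rightarrow> real" where
  "queue_rate n l \<phi> x y =
     (\<Sum>i\<in>{1..n}. (if y = x(i := x i + 1) then l i else 0) +
                  (if 0 < x i \<and> y = x(i := x i - 1) then \<phi> i x else 0))"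

definition bounded_allocation :: "nat \<Rightarrow> (nat \<Rightarrow> (nat \<Rightarrow> nat) \<Rightarrow> real) \<Rightarrow> bool" where
  "bounded_allocation N \<phi> \<longleftrightarrow>
     (\<forall>i\<in>{1..N}. \<forall>x\<in>states N. 0 \<le> \<phi> i x) \<and> (\<exists>B. \<forall>i\<in>{1..N}. \<forall>x\<in>states N. \<phi> i x \<le> B)"

definition partially_decreasing :: "nat \<Rightarrow> (nat \<Rightarrow> (nat \<Rightarrow> nat) \<Rightarrow> real) \<Rightarrow> bool" where
  "partially_decreasing N \<phi> \<longleftrightarrow>
     (\<forall>i\<in>{1..N}. \<forall>x\<in>states N. \<forall>y\<in>states N.
        (\<forall>j\<in>{1..N}. x j \<le> y j) \<and> x i = y i \<longrightarrow> \<phi> i y \<le> \<phi> i x)"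

(* The suprema are taken in the extended reals, since a real-valued SUP over an unbounded set would
   be unspecified. *)
definition uniform_limits_at_infinity :: "nat \<Rightarrow> ((nat \<Rightarrow> nat) \<Rightarrow> real) \<Rightarrow> bool" where
  "uniform_limits_at_infinity N f \<longleftrightarrow>
     (\<exists>c. (\<lambda>r::nat. SUP x\<in>{x\<in>states N. \<forall>j\<in>{1..N}. r < x j}. ereal \<bar>f x - c\<bar>)
            \<longlonglongrightarrow> 0) \<and>
     (\<forall>n \<sigma>. 1 \<le> n \<and> n < N \<and> \<sigma> permutes {1..N} \<longrightarrow>
        (\<exists>g. (\<lambda>r::nat. SUP x\<in>{x\<in>states N. \<forall>j\<in>{n+1..N}. r < x (\<sigma> j)}.
                ereal \<bar>f x - g (\<lambda>j\<in>{1..n}. x (\<sigma> j))\<bar>) \<longlonglongrightarrow> 0))"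

definition lower_partial_limit ::
    "nat \<Rightarrow> nat \<Rightarrow> (nat \<Rightarrow> (nat \<Rightarrow> nat) \<Rightarrow> real) \<Rightarrow> nat \<Rightarrow> (nat \<Rightarrow> nat) \<Rightarrow> real" where
  "lower_partial_limit N n \<phi> i x =
     lim (\<lambda>r::nat. INF y\<in>{y\<in>states N. restrict y {1..n} = x \<and> (\<forall>j\<in>{n+1..N}. r < y j)}. \<phi> i y)"

(* Only the coordinates 1,...,n of l are used. For n = 0 the state space consists of the
   empty vector, which is the function that is undefined everywhere. *)
definition limit_rate ::
    "nat \<Rightarrow> nat \<Rightarrow> (nat \<Rightarrow> real) \<Rightarrow> (nat \<Rightarrow> (nat \<Rightarrow> nat) \<Rightarrow> real) \<Rightarrow> nat \<Rightarrow> real" where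
  "limit_rate N n l \<phi> i =
     (if n = 0 then lower_partial_limit N 0 \<phi> i (\<lambda>_. undefined)
      else let Y = stationary_distribution (states n) (queue_rate n l (lower_partial_limit N n \<phi>))
           in if \<exists>!\<pi>. Y \<pi>
              then \<Sum>\<^sub>\<infinity>x\<in>states n. lower_partial_limit N n \<phi> i x * pmf (THE \<pi>. Y \<pi>) x
              else 0)"

definition ordered_region :: "nat \<Rightarrow> (nat \<Rightarrow> (nat \<Rightarrow> nat) \<Rightarrow> real) \<Rightarrow> (nat \<Rightarrow> real) set" where
  "ordered_region N \<phi> = {l \<in> pos_vectors N. \<forall>i\<in>{1..N}. l i < limit_rate N (i - 1) l \<phi> i}"

definition permute_vector :: "nat \<Rightarrow> (nat \<Rightarrow> nat) \<Rightarrow> (nat \<Rightarrow> 'a) \<Rightarrow> nat \<Rightarrow> 'a" where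
  "permute_vector N \<sigma> v = (\<lambda>i\<in>{1..N}. v (\<sigma> i))"

definition permute_allocation ::
    "nat \<Rightarrow> (nat \<Rightarrow> nat) \<Rightarrow> (nat \<Rightarrow> (nat \<Rightarrow> nat) \<Rightarrow> real) \<Rightarrow> nat \<Rightarrow> (nat \<Rightarrow> nat) \<Rightarrow> real" where
  "permute_allocation N \<sigma> \<phi> i x = \<phi> (\<sigma> i) (permute_vector N (inv \<sigma>) x)"

definition stability_region :: "nat \<Rightarrow> (nat \<Rightarrow> (nat \<Rightarrow> nat) \<Rightarrow> real) \<Rightarrow> (nat \<Rightarrow> real) set" where
  "stability_region N \<phi> =
     (\<Union>\<sigma>\<in>{\<sigma>. \<sigma> permutes {1..N}}.
        {l \<in> pos_vectors N. permute_vector N \<sigma> l \<in> ordered_region N (permute_allocation N \<sigma> \<phi>)})"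

end

theory Submission
  imports Defs "HOL-Complex_Analysis.Great_Picard"
begin

text \<open>
  All assertions are reduced to one about the bounded generator \<open>Q\<close>: the process is stable, from any
  initial state, if and only if some probability distribution \<open>\<mu>\<close> satisfies \<open>\<mu> Q = 0\<close>. Since \<open>\<phi>\<close> is
  partially decreasing, \<open>I + h Q\<close> preserves increasing functions for small \<open>h\<close>; comparing iterates
  of such operators, started from empty queues, replaces pathwise couplings.

  Sufficiency adds one queue at a time. If \<open>Y\<^sup>n\<close> has an invariant distribution but \<open>Y\<^sup>n\<^sup>+\<^sup>1\<close> has none, then
  the time averages of \<open>Y\<^sup>n\<^sup>+\<^sup>1\<close> from the empty state leave every finite set; as the first \<open>n\<close> queues
  are dominated by \<open>Y\<^sup>n\<close> and hence tight, it is the last queue that escapes. Then the first \<open>n\<close> queues behave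
  asymptotically like \<open>Y\<^sup>n\<close>, and the mean drift of the last queue becomes negative, which is absurd
  for a nonnegative quantity.

  For necessity, let \<open>Y\<^sup>n\<close> have an invariant distribution and let every other queue satisfy
  \<open>\<lambda>\<^sub>i > L\<^sup>n\<^sub>i\<close>. The empty state is the worst one for the drift of queue \<open>i\<close>, because its limiting
  service rate decreases in the first \<open>n\<close> queues. So for some \<open>T\<close> the drift over \<open>T\<close> steps is uniformly
  positive far out, and a truncation of \<open>\<Sum>\<^sub>i exp (- \<theta> x\<^sub>i)\<close> is strictly decreased there, which no invariant
  distribution allows, since its support is closed under arrivals. If \<open>\<lambda>\<close> is stable and \<open>\<lambda>' < \<lambda>\<close> lies
  outside the region, take a maximal ordering of queues that satisfies the conditions for \<open>\<lambda>'\<close>, and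
  raise the rates of the remaining queues to \<open>\<lambda>\<close>: the result is both unstable and dominated by a stable system.

  The region is open because it is closed under decreasing \<open>\<lambda>\<close> and the invariant distributions for
  \<open>\<lambda> + \<delta>\<close> converge to the one for \<open>\<lambda>\<close> as \<open>\<delta> \<rightarrow> 0\<close>.
\<close>

section \<open>Expectations under probability mass functions\<close>

text \<open>What replaces them is that arrival rates are positive: the sets that matter, a support
  or the states where one of two invariant distributions is larger, are closed under arrivals, and
  two nonempty sets of this kind always meet. This gives uniqueness, and most convergence statements
  then follow one pattern: tightness, an invariant subsequential limit, uniqueness.

  Invariance is tested against bounded functions because this passes to weak limits. It does not
  mention time, so \<open>stp\<close> may be used with any step \<open>h\<close> such that
  \<open>h * R \<le> 1\<close>, and two systems are compared with a common step. Continuous time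
  enters only when the generator is linked with transition functions. Their definition gives a
  derivative at 0 for each pair of states, without uniformity in the states, so explicit quadratic
  error bounds are first extracted from the semigroup property.\<close>

abbreviation expect :: "'a pmf \<Rightarrow> ('a \<Rightarrow> real) \<Rightarrow> real" where
  "expect p g \<equiv> measure_pmf.expectation p g"

lemma integrable_bdd:
  fixes g :: "'a \<Rightarrow> real"
  assumes "\<And>x. x \<in> set_pmf p \<Longrightarrow> \<bar>g x\<bar> \<le> c"
  shows "integrable (measure_pmf p) g"
  by (rule measure_pmf.integrable_const_bound[where B = c]) (auto simp: AE_measure_pmf_iff assms)

lemma expect_mono:
  assumes "\<And>x. x \<in> set_pmf p \<Longrightarrow> \<bar>g x\<bar> \<le> c" "\<And>x. x \<in> set_pmf p \<Longrightarrow> \<bar>h x\<bar> \<le> d"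
    and "\<And>x. x \<in> set_pmf p \<Longrightarrow> g x \<le> h x"
  shows "expect p g \<le> expect p h"
  using assms by (intro integral_mono_AE integrable_bdd) (auto simp: AE_measure_pmf_iff)

lemma expect_cong:
  assumes "\<And>x. x \<in> set_pmf p \<Longrightarrow> g x = h x"
  shows "expect p g = expect p h"
  using assms by (intro integral_cong_AE) (auto simp: AE_measure_pmf_iff)

lemma expect_abs_le:
  assumes "\<And>x. x \<in> set_pmf p \<Longrightarrow> \<bar>g x\<bar> \<le> c"
  shows "\<bar>expect p g\<bar> \<le> c"
proof -
  have "expect p g \<le> expect p (\<lambda>_. c)" "expect p (\<lambda>_. - c) \<le> expect p g"
    using assms by (intro expect_mono[where c = c and d = "\<bar>c\<bar>"] expect_mono[where d = c and c = "\<bar>c\<bar>"];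
        force simp: abs_le_iff)+
  then show ?thesis by (simp add: abs_le_iff)
qed

lemma expect_bind:
  fixes g :: "'b \<Rightarrow> real"
  assumes "\<And>y. y \<in> set_pmf (bind_pmf p f) \<Longrightarrow> \<bar>g y\<bar> \<le> c"
  shows "expect (bind_pmf p f) g = expect p (\<lambda>x. expect (f x) g)"
proof -
  \<comment> \<open>The bound on \<open>g\<close> holds only on the support, while
    \<open>integral_bind\<close> asks for it everywhere; hence the cut-off to 0.\<close>
  define g' where "g' y = (if y \<in> set_pmf (bind_pmf p f) then g y else 0)" for y
  have c: "0 \<le> c" using assms set_pmf_not_empty[of "bind_pmf p f"] by force
  have "expect (bind_pmf p f) g = expect (bind_pmf p f) g'"
    by (rule expect_cong) (simp add: g'_def)
  also have "\<dots> = expect p (\<lambda>x. expect (f x) g')"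
    unfolding measure_pmf_bind
    by (rule integral_bind[where K = "count_space UNIV" and B = c and B' = 1])
       (auto simp: assms g'_def c measure_pmf.emeasure_space_1[simplified] measure_pmf_in_subprob_algebra
         intro: measurable_compose[OF _ measurable_measure_pmf])
  also have "\<dots> = expect p (\<lambda>x. expect (f x) g)"
    by (intro expect_cong) (auto simp: g'_def)
  finally show ?thesis .
qed

lemma expect_finite_approx:
  assumes "finite F" and "\<And>x. x \<in> set_pmf p \<Longrightarrow> \<bar>g x\<bar> \<le> c"
  shows "\<bar>expect p g - (\<Sum>x\<in>F. pmf p x * g x)\<bar> \<le> c * measure_pmf.prob p (- F)"
proof -
  have 1: "(\<Sum>x\<in>F. pmf p x * g x) = expect p (\<lambda>x. indicator F x * g x)"
    by (subst integral_measure_pmf_real[OF assms(1)])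
      (auto simp: indicator_def intro!: sum.cong split: if_splits)
  have c: "0 \<le> c" using assms(2) set_pmf_not_empty[of p] by force
  have i1: "integrable (measure_pmf p) g" using assms(2) by (rule integrable_bdd)
  have i2: "integrable (measure_pmf p) (\<lambda>x. indicator F x * g x)"
    using assms(2) c by (intro integrable_bdd[where c = c]) (auto simp: indicator_def)
  have i3: "integrable (measure_pmf p) (\<lambda>x. c * indicator (- F) x)"
    using c by (intro integrable_bdd[where c = c]) (auto simp: indicator_def)
  have "\<bar>expect p g - (\<Sum>x\<in>F. pmf p x * g x)\<bar> = \<bar>expect p (\<lambda>x. g x - indicator F x * g x)\<bar>"
    unfolding 1 using i1 i2 by simp
  also have "\<dots> \<le> expect p (\<lambda>x. \<bar>g x - indicator F x * g x\<bar>)"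
    by (rule integral_abs_bound)
  also have "\<dots> \<le> expect p (\<lambda>x. c * indicator (- F) x)"
    using assms(2) by (intro integral_mono_AE integrable_abs Bochner_Integration.integrable_diff i1 i2 i3)
      (auto simp: AE_measure_pmf_iff indicator_def)
  also have "\<dots> = c * measure_pmf.prob p (- F)" by simp
  finally show ?thesis .
qed

lemma expect_ge_finite:
  assumes "finite F" "\<And>x. x \<in> set_pmf p \<Longrightarrow> \<bar>g x\<bar> \<le> c" "\<And>x. x \<in> set_pmf p \<Longrightarrow> 0 \<le> g x"
  shows "(\<Sum>x\<in>F. pmf p x * g x) \<le> expect p g"
proof -
  have 1: "(\<Sum>x\<in>F. pmf p x * g x) = expect p (\<lambda>x. indicator F x * g x)"
    by (subst integral_measure_pmf_real[OF assms(1)])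
      (auto simp: indicator_def intro!: sum.cong split: if_splits)
  have c: "0 \<le> c" using assms(2) set_pmf_not_empty[of p] by force
  show ?thesis unfolding 1
    using assms(2,3) c by (intro expect_mono[where c = c and d = c]) (auto simp: indicator_def)
qed

lemma pmf_eqI_expect:
  assumes "\<And>g :: 'a \<Rightarrow> real. (\<And>x. \<bar>g x\<bar> \<le> 1) \<Longrightarrow> expect p g = expect q g"
  shows "p = q"
proof (rule pmf_eqI)
  fix x
  have "expect p (indicator {x}) = expect q (indicator {x} :: _ \<Rightarrow> real)"
    by (rule assms) (auto simp: indicator_def)
  then show "pmf p x = pmf q x" by (simp add: measure_pmf_single)
qed

text \<open>Here \<open>A\<close> is the total mass and \<open>\<nu>\<close> the normalization. The
  mass may fall short of 1: pointwise limits of distributions can lose mass to infinity.\<close>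

lemma pmf_from_weights:
  fixes a :: "'a \<Rightarrow> real"
  assumes nn: "\<And>x. 0 \<le> a x" and fin: "\<And>F. finite F \<Longrightarrow> sum a F \<le> 1" and pos: "0 < a x0"
  obtains \<nu> A where "0 < A" "A \<le> 1" "\<And>x. a x = A * pmf \<nu> x"
proof -
  have summ: "a summable_on UNIV"
    by (rule nonneg_bdd_above_summable_on) (auto intro!: bdd_aboveI[of _ 1] simp: nn fin)
  define A where "A = infsum a UNIV"
  have A1: "A \<le> 1" unfolding A_def
    by (rule infsum_le_finite_sums[OF summ]) (auto simp: fin)
  have "sum a {x0} \<le> A" unfolding A_def by (rule finite_sum_le_infsum[OF summ]) (auto simp: nn)
  then have A0: "0 < A" using pos by simp
  have abss: "Infinite_Set_Sum.abs_summable_on a UNIV"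
    using summ nn abs_summable_equivalent summable_on_iff_abs_summable_on_real by blast
  then have abss2: "Infinite_Set_Sum.abs_summable_on (\<lambda>x. a x / A) UNIV"
    unfolding divide_inverse by (intro abs_summable_on_cmult_left) simp
  have "(\<integral>\<^sup>+x. ennreal (a x / A) \<partial>count_space UNIV) = ennreal (infsetsum (\<lambda>x. a x / A) UNIV)"
    using A0 nn by (intro nn_integral_conv_infsetsum abss2) auto
  also have "infsetsum (\<lambda>x. a x / A) UNIV = infsetsum a UNIV / A"
    by (rule infsetsum_cdiv) (rule abss)
  also have "infsetsum a UNIV = A" unfolding A_def by (rule infsetsum_infsum[OF abss])
  finally have nni: "(\<integral>\<^sup>+x. ennreal (a x / A) \<partial>count_space UNIV) = 1" using A0 by simp
  have "pmf (embed_pmf (\<lambda>x. a x / A)) x = a x / A" for x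
    using nni A0 nn by (intro pmf_embed_pmf) auto
  then show ?thesis using A0 A1 by (intro that[of A "embed_pmf (\<lambda>x. a x / A)"]) auto
qed

text \<open>Prokhorov's theorem on a countable set. A diagonal argument gives pointwise limits of
  the masses, tightness keeps mass from being lost, and a finite set carrying nearly all mass
  reduces expectations of bounded functions to finite sums.\<close>

lemma tight_pmf_subsequence:
  fixes \<mu> :: "nat \<Rightarrow> 'a pmf"
  assumes S: "countable S" "\<And>k. set_pmf (\<mu> k) \<subseteq> S"
    and tight: "\<And>\<epsilon>. 0 < \<epsilon> \<Longrightarrow> \<exists>F. finite F \<and> (\<forall>k. measure_pmf.prob (\<mu> k) (- F) \<le> \<epsilon>)"
  obtains r \<nu> where "strict_mono r" "set_pmf \<nu> \<subseteq> S"
    "\<And>g c. (\<And>x. x \<in> S \<Longrightarrow> \<bar>g x\<bar> \<le> c) \<Longrightarrow> (\<lambda>k. expect (\<mu> (r k)) g) \<longlonglongrightarrow> expect \<nu> g"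
proof -
  obtain r where r: "strict_mono r" and "\<And>x. x \<in> S \<Longrightarrow> \<exists>l. (\<lambda>n. pmf (\<mu> (r n)) x) \<longlonglongrightarrow> l"
    by (rule function_convergent_subsequence[of S "\<lambda>k x. pmf (\<mu> k) x" 1])
      (auto simp: S pmf_le_1)
  moreover have "\<exists>l. (\<lambda>n. pmf (\<mu> (r n)) x) \<longlonglongrightarrow> l" if "x \<notin> S" for x
  proof -
    have "pmf (\<mu> (r n)) x = 0" for n using that S(2) by (meson set_pmf_iff subsetD)
    then show ?thesis by auto
  qed
  ultimately have "\<forall>x. \<exists>l. (\<lambda>n. pmf (\<mu> (r n)) x) \<longlonglongrightarrow> l" by blast
  then obtain a where a: "\<And>x. (\<lambda>n. pmf (\<mu> (r n)) x) \<longlonglongrightarrow> a x" by metis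
  have a0: "0 \<le> a x" for x by (rule LIMSEQ_le_const[OF a]) auto
  have sums: "(\<lambda>n. \<Sum>x\<in>F. pmf (\<mu> (r n)) x) \<longlonglongrightarrow> sum a F" for F by (intro tendsto_sum a)
  have a1: "sum a F \<le> 1" if "finite F" for F
    by (rule LIMSEQ_le_const2[OF sums])
      (auto simp: that measure_pmf.prob_le_1 simp flip: measure_measure_pmf_finite)
  have low: "1 - \<epsilon> \<le> sum a F" if F: "finite F" "\<And>k. measure_pmf.prob (\<mu> k) (- F) \<le> \<epsilon>" for F \<epsilon>
  proof (rule LIMSEQ_le_const[OF sums], intro exI allI impI)
    fix n
    have "measure_pmf.prob (\<mu> (r n)) (- F) = 1 - measure_pmf.prob (\<mu> (r n)) F"
      using measure_pmf.prob_compl[of F "\<mu> (r n)"] by (simp add: Compl_eq_Diff_UNIV)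
    then show "1 - \<epsilon> \<le> (\<Sum>x\<in>F. pmf (\<mu> (r n)) x)"
      using F(2)[of "r n"] by (simp add: measure_measure_pmf_finite[OF F(1)])
  qed
  obtain F0 where F0: "finite F0" "\<And>k. measure_pmf.prob (\<mu> k) (- F0) \<le> 1/2"
    using tight[of "1/2"] by auto
  from low[OF F0] have "0 < sum a F0" by simp
  then obtain x0 where "0 < a x0"
    by (metis a0 less_eq_real_def linorder_not_less sum_nonpos)
  from pmf_from_weights[of a, OF a0 a1 this] obtain \<nu> A
    where A: "0 < A" "A \<le> 1" and \<nu>: "\<And>x. a x = A * pmf \<nu> x" by blast
  \<comment> \<open>Tightness passes to the limit: a suitable finite set retains mass at least
    \<open>1 - \<epsilon>\<close>, so the normalization changes nothing.\<close>
  have "A \<ge> 1"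
  proof (rule field_le_epsilon)
    fix \<epsilon> :: real assume "0 < \<epsilon>"
    then obtain F where F: "finite F" "\<And>k. measure_pmf.prob (\<mu> k) (- F) \<le> \<epsilon>"
      using tight by blast
    have "1 - \<epsilon> \<le> sum a F" by (rule low[OF F])
    also have "\<dots> = A * measure_pmf.prob \<nu> F"
      unfolding \<nu> measure_measure_pmf_finite[OF F(1)] by (simp add: sum_distrib_left)
    also have "\<dots> \<le> A" using A by (simp add: mult_left_le)
    finally show "1 \<le> A + \<epsilon>" by simp
  qed
  with A \<nu> have \<nu>: "\<And>x. a x = pmf \<nu> x" by simp
  have sub: "set_pmf \<nu> \<subseteq> S"
  proof
    fix x assume "x \<in> set_pmf \<nu>"
    then have "a x \<noteq> 0" by (simp add: \<nu> set_pmf_iff)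
    moreover have "a x = 0" if "x \<notin> S"
    proof -
      have "pmf (\<mu> (r n)) x = 0" for n using that S(2) by (meson set_pmf_iff subsetD)
      with a[of x] show ?thesis by (simp add: LIMSEQ_const_iff)
    qed
    ultimately show "x \<in> S" by blast
  qed
  have conv: "(\<lambda>k. expect (\<mu> (r k)) g) \<longlonglongrightarrow> expect \<nu> g" if g: "\<And>x. x \<in> S \<Longrightarrow> \<bar>g x\<bar> \<le> c" for g c
  proof (rule LIMSEQ_I)
    fix e :: real assume e: "0 < e"
    define c' where "c' = \<bar>c\<bar> + 1"
    have c': "0 < c'" "\<And>x. x \<in> S \<Longrightarrow> \<bar>g x\<bar> \<le> c'" using g by (force simp: c'_def)+
    obtain F where F: "finite F" "\<And>k. measure_pmf.prob (\<mu> k) (- F) \<le> e / (3 * c')"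
      using tight[of "e / (3 * c')"] e c' by auto
    have lowF: "1 - e / (3 * c') \<le> measure_pmf.prob \<nu> F"
      using low[OF F] unfolding \<nu> measure_measure_pmf_finite[OF F(1)] .
    have nuF: "measure_pmf.prob \<nu> (- F) \<le> e / (3 * c')"
      using lowF measure_pmf.prob_compl[of F \<nu>] by (simp add: Compl_eq_Diff_UNIV)
    have "(\<lambda>n. \<Sum>x\<in>F. pmf (\<mu> (r n)) x * g x) \<longlonglongrightarrow> (\<Sum>x\<in>F. pmf \<nu> x * g x)"
      using a unfolding \<nu> by (intro tendsto_intros)
    from LIMSEQ_D[OF this, of "e/3"] e obtain n0 where n0:
      "\<And>n. n \<ge> n0 \<Longrightarrow> \<bar>(\<Sum>x\<in>F. pmf (\<mu> (r n)) x * g x) - (\<Sum>x\<in>F. pmf \<nu> x * g x)\<bar> < e / 3" by auto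
    have est: "\<bar>expect p g - (\<Sum>x\<in>F. pmf p x * g x)\<bar> \<le> e / 3"
      if "set_pmf p \<subseteq> S" "measure_pmf.prob p (- F) \<le> e / (3 * c')" for p
    proof -
      have "\<bar>expect p g - (\<Sum>x\<in>F. pmf p x * g x)\<bar> \<le> c' * measure_pmf.prob p (- F)"
        using that c' by (intro expect_finite_approx F(1)) auto
      also have "\<dots> \<le> c' * (e / (3 * c'))" using that(2) c'(1) by (intro mult_left_mono) auto
      finally show ?thesis using c'(1) by simp
    qed
    show "\<exists>no. \<forall>n\<ge>no. norm (expect (\<mu> (r n)) g - expect \<nu> g) < e"
    proof (intro exI allI impI)
      fix n assume n: "n0 \<le> n"
      show "norm (expect (\<mu> (r n)) g - expect \<nu> g) < e"
        using n0[OF n] est[OF S(2) F(2), of "r n"] est[OF sub nuF] unfolding real_norm_def by linarith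
    qed
  qed
  show ?thesis by (rule that[OF r sub conv])
qed

section \<open>The generator acting on functions\<close>

text \<open>The product \<open>Q g\<close> written over the possible moves, with no sum over states.
  It makes sense for every \<open>g\<close>, also for the unbounded queue lengths, which serve as
  test functions later.\<close>

definition gen :: "nat \<Rightarrow> (nat \<Rightarrow> real) \<Rightarrow> (nat \<Rightarrow> (nat \<Rightarrow> nat) \<Rightarrow> real) \<Rightarrow>
    ((nat \<Rightarrow> nat) \<Rightarrow> real) \<Rightarrow> (nat \<Rightarrow> nat) \<Rightarrow> real" where
  "gen n l f g x = (\<Sum>i\<in>{1..n}. l i * (g (x(i := x i + 1)) - g x) +
     (if 0 < x i then f i x * (g (x(i := x i - 1)) - g x) else 0))"

definition stp :: "nat \<Rightarrow> (nat \<Rightarrow> real) \<Rightarrow> (nat \<Rightarrow> (nat \<Rightarrow> nat) \<Rightarrow> real) \<Rightarrow> real \<Rightarrow>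
    ((nat \<Rightarrow> nat) \<Rightarrow> real) \<Rightarrow> (nat \<Rightarrow> nat) \<Rightarrow> real" where
  "stp n l f h g x = g x + h * gen n l f g x"

definition state_mono :: "nat \<Rightarrow> ((nat \<Rightarrow> nat) \<Rightarrow> real) \<Rightarrow> bool" where
  "state_mono n g \<longleftrightarrow> (\<forall>x\<in>states n. \<forall>y\<in>states n. (\<forall>j\<in>{1..n}. x j \<le> y j) \<longrightarrow> g x \<le> g y)"

text \<open>The equation \<open>\<mu> Q = 0\<close> in weak form. All bounded test functions are
  allowed, rather than only point indicators, so that weak limits of approximately invariant
  distributions are invariant at once.\<close>

definition invariant :: "nat \<Rightarrow> (nat \<Rightarrow> real) \<Rightarrow> (nat \<Rightarrow> (nat \<Rightarrow> nat) \<Rightarrow> real) \<Rightarrow>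
    (nat \<Rightarrow> nat) pmf \<Rightarrow> bool" where
  "invariant n l f \<mu> \<longleftrightarrow> set_pmf \<mu> \<subseteq> states n \<and>
     (\<forall>g. (\<forall>x. \<bar>g x\<bar> \<le> 1) \<longrightarrow> expect \<mu> (gen n l f g) = 0)"

abbreviation zero_state :: "nat \<Rightarrow> nat \<Rightarrow> nat" where
  "zero_state n \<equiv> (\<lambda>i\<in>{1..n}. 0)"

text \<open>For \<open>x i = 0\<close> the truncated subtraction returns \<open>x\<close> itself,
  which belongs to the set anyway. Moves of rate 0 are included, so the set does not depend on the
  rates.\<close>

definition nbrs :: "nat \<Rightarrow> (nat \<Rightarrow> nat) \<Rightarrow> (nat \<Rightarrow> nat) set" where
  "nbrs n x = insert x ((\<lambda>i. x(i := x i + 1)) ` {1..n} \<union> (\<lambda>i. x(i := x i - 1)) ` {1..n})"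

lemma state_upd: "x \<in> states n \<Longrightarrow> i \<in> {1..n} \<Longrightarrow> x(i := v) \<in> states n"
  by (auto simp: states_def PiE_iff extensional_def)

lemma zero_state_in: "zero_state n \<in> states n"
  by (auto simp: states_def)

lemma countable_states: "countable (states n)"
  unfolding states_def by (rule countable_PiE) auto

lemma states_eqI:
  "x \<in> states n \<Longrightarrow> y \<in> states n \<Longrightarrow> (\<And>i. i \<in> {1..n} \<Longrightarrow> x i = y i) \<Longrightarrow> x = y"
  unfolding states_def by (rule PiE_ext)

lemma restrict_states: "n \<le> m \<Longrightarrow> x \<in> states m \<Longrightarrow> restrict x {1..n} \<in> states n"
  by (auto simp: states_def)

lemma restrict_state_self: "x \<in> states n \<Longrightarrow> restrict x {1..n} = x"
  by (simp add: states_def PiE_def extensional_restrict)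

lemma nbrs_states: "x \<in> states n \<Longrightarrow> nbrs n x \<subseteq> states n"
  by (auto simp: nbrs_def intro: state_upd)

lemma finite_nbrs: "finite (nbrs n x)"
  by (simp add: nbrs_def)

lemma gen_cong_nbrs: "(\<And>y. y \<in> nbrs n x \<Longrightarrow> g y = g' y) \<Longrightarrow> gen n l f g x = gen n l f g' x"
  unfolding gen_def by (intro sum.cong) (auto simp: nbrs_def)

lemma gen_cong: "x \<in> states n \<Longrightarrow> (\<And>y. y \<in> states n \<Longrightarrow> g y = g' y) \<Longrightarrow> gen n l f g x = gen n l f g' x"
  using nbrs_states by (intro gen_cong_nbrs) auto

lemma gen_add: "gen n l f (\<lambda>x. g x + g' x) x = gen n l f g x + gen n l f g' x"
  unfolding gen_def by (subst sum.distrib[symmetric], intro sum.cong) (auto simp: algebra_simps)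

lemma gen_cmult: "gen n l f (\<lambda>x. c * g x) x = c * gen n l f g x"
  unfolding gen_def by (subst sum_distrib_left, intro sum.cong) (auto simp: algebra_simps)

lemma gen_const: "gen n l f (\<lambda>x. c) x = 0"
  unfolding gen_def by (intro sum.neutral) auto

lemma gen_sum: "gen n l f (\<lambda>x. \<Sum>k\<in>K. g k x) x = (\<Sum>k\<in>K. gen n l f (g k) x)"
  by (induction K rule: infinite_finite_induct) (simp_all add: gen_const gen_add)

lemma stp_add: "stp n l f h (\<lambda>x. g x + g' x) x = stp n l f h g x + stp n l f h g' x"
  unfolding stp_def gen_add by (simp add: algebra_simps)

lemma stp_cmult: "stp n l f h (\<lambda>x. c * g x) x = c * stp n l f h g x"
  unfolding stp_def gen_cmult by (simp add: algebra_simps)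

lemma stp_const: "stp n l f h (\<lambda>x. c) x = c"
  unfolding stp_def gen_const by simp

lemma stp_sum: "stp n l f h (\<lambda>x. \<Sum>k\<in>K. g k x) x = (\<Sum>k\<in>K. stp n l f h (g k) x)"
  unfolding stp_def gen_sum by (simp add: sum.distrib sum_distrib_left)

lemma stp_iter_add:
  "(stp n l f h ^^ k) (\<lambda>x. g x + g' x) = (\<lambda>x. (stp n l f h ^^ k) g x + (stp n l f h ^^ k) g' x)"
proof (induction k)
  case (Suc k) show ?case unfolding funpow.simps o_def Suc by (rule ext) (rule stp_add)
qed simp

lemma stp_iter_cmult:
  "(stp n l f h ^^ k) (\<lambda>x. c * g x) = (\<lambda>x. c * (stp n l f h ^^ k) g x)"
proof (induction k)
  case (Suc k) show ?case unfolding funpow.simps o_def Suc by (rule ext) (rule stp_cmult)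
qed simp

lemma stp_iter_const: "(stp n l f h ^^ k) (\<lambda>x. c) = (\<lambda>x. c)"
proof (induction k)
  case (Suc k) show ?case unfolding funpow.simps o_def Suc by (rule ext) (rule stp_const)
qed simp

text \<open>Discrete Dynkin formula. The extra step is taken innermost, where \<open>stp\<close>
  turns \<open>g\<close> into \<open>g\<close> plus \<open>h\<close> times its generator, and the
  outer iterate is linear.\<close>

lemma stp_iter_telescope:
  "(stp n l f h ^^ k) g x - g x = h * (\<Sum>j<k. (stp n l f h ^^ j) (gen n l f g) x)"
proof (induction k)
  case (Suc k)
  have "(stp n l f h ^^ Suc k) g = (stp n l f h ^^ k) (stp n l f h g)"
    by (simp add: funpow_swap1)
  also have "stp n l f h g = (\<lambda>x. g x + h * gen n l f g x)" by (rule ext) (simp add: stp_def)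
  finally have "(stp n l f h ^^ Suc k) g x =
      (stp n l f h ^^ k) g x + h * (stp n l f h ^^ k) (gen n l f g) x"
    by (simp add: stp_iter_add stp_iter_cmult)
  with Suc show ?case by (simp add: algebra_simps)
qed simp

section \<open>One queueing system: the Euler step as a Markov kernel, its iterates and time
  averages\<close>

locale queue_system =
  fixes n :: nat and l :: "nat \<Rightarrow> real" and f :: "nat \<Rightarrow> (nat \<Rightarrow> nat) \<Rightarrow> real" and B :: real
  assumes l_pos: "\<And>i. i \<in> {1..n} \<Longrightarrow> 0 < l i"
    and f_nonneg: "\<And>i x. i \<in> {1..n} \<Longrightarrow> x \<in> states n \<Longrightarrow> 0 \<le> f i x"
    and f_le: "\<And>i x. i \<in> {1..n} \<Longrightarrow> x \<in> states n \<Longrightarrow> f i x \<le> B"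
    and B_nonneg: "0 \<le> B"
begin

definition R :: real where "R = (\<Sum>i\<in>{1..n}. l i + B)"

lemma R_nonneg: "0 \<le> R"
  unfolding R_def using l_pos B_nonneg by (intro sum_nonneg) (simp add: less_imp_le)

lemma stp_convex:
  assumes "x \<in> states n"
  shows "stp n l f h g x = (1 - h * R) * g x + h * (\<Sum>i\<in>{1..n}. l i * g (x(i := x i + 1)) +
      (if 0 < x i then f i x * g (x(i := x i - 1)) + (B - f i x) * g x else B * g x))"
proof -
  have eq: "(\<Sum>i\<in>{1..n}. l i * g (x(i := x i + 1)) +
      (if 0 < x i then f i x * g (x(i := x i - 1)) + (B - f i x) * g x else B * g x)) = gen n l f g x + R * g x"
    unfolding gen_def R_def sum_distrib_right sum.distrib[symmetric]
    by (intro sum.cong) (auto simp: algebra_simps)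
  show ?thesis unfolding stp_def by (subst eq) (simp add: algebra_simps)
qed

lemma gen_bound:
  assumes "x \<in> states n" "\<And>y. y \<in> states n \<Longrightarrow> \<bar>g y\<bar> \<le> c"
  shows "\<bar>gen n l f g x\<bar> \<le> 2 * c * R"
proof -
  have c0: "0 \<le> c" using assms by force
  have d: "\<bar>g y - g x\<bar> \<le> 2 * c" if "y \<in> states n" for y
    using assms(2)[OF that] assms(2)[OF assms(1)] by linarith
  have "\<bar>gen n l f g x\<bar> \<le> (\<Sum>i\<in>{1..n}. 2 * c * (l i + B))"
    unfolding gen_def
  proof (intro sum_abs[THEN order_trans] sum_mono)
    fix i assume i: "i \<in> {1..n}"
    have "\<bar>l i * (g (x(i := x i + 1)) - g x)\<bar> \<le> l i * (2 * c)"
      unfolding abs_mult using l_pos[OF i] d[OF state_upd[OF assms(1) i]]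
      by (auto intro!: mult_mono)
    moreover have "\<bar>f i x * (g (x(i := x i - 1)) - g x)\<bar> \<le> B * (2 * c)"
      unfolding abs_mult using f_nonneg[OF i assms(1)] f_le[OF i assms(1)] d[OF state_upd[OF assms(1) i]]
      by (intro mult_mono) auto
    ultimately show "\<bar>l i * (g (x(i := x i + 1)) - g x) +
        (if 0 < x i then f i x * (g (x(i := x i - 1)) - g x) else 0)\<bar> \<le> 2 * c * (l i + B)"
      using B_nonneg c0 by (auto simp: algebra_simps abs_le_iff)
  qed
  then show ?thesis by (simp add: R_def sum_distrib_left)
qed

lemma stp_mono_nbrs:
  assumes h: "0 \<le> h" "h * R \<le> 1" and x: "x \<in> states n"
    and le: "\<And>y. y \<in> nbrs n x \<Longrightarrow> g y \<le> g' y"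
  shows "stp n l f h g x \<le> stp n l f h g' x"
proof -
  have lex: "g x \<le> g' x" by (rule le) (simp add: nbrs_def)
  show ?thesis
    unfolding stp_convex[OF x]
  proof (rule add_mono[OF mult_left_mono[OF lex] mult_left_mono[OF sum_mono[OF add_mono]]])
    fix i assume i: "i \<in> {1..n}"
    have le': "g (x(i := x i + 1)) \<le> g' (x(i := x i + 1))" "g (x(i := x i - 1)) \<le> g' (x(i := x i - 1))"
      using i by (intro le; force simp: nbrs_def)+
    show "l i * g (x(i := x i + 1)) \<le> l i * g' (x(i := x i + 1))"
      using l_pos[OF i] le' lex by (intro mult_left_mono) auto
    show "(if 0 < x i then f i x * g (x(i := x i - 1)) + (B - f i x) * g x else B * g x) \<le>
       (if 0 < x i then f i x * g' (x(i := x i - 1)) + (B - f i x) * g' x else B * g' x)"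
      using f_nonneg[OF i x] f_le[OF i x] le' lex B_nonneg
      by (auto intro!: add_mono mult_left_mono)
  qed (use h in auto)
qed

lemma stp_mono:
  assumes h: "0 \<le> h" "h * R \<le> 1" and x: "x \<in> states n"
    and le: "\<And>y. y \<in> states n \<Longrightarrow> g y \<le> g' y"
  shows "stp n l f h g x \<le> stp n l f h g' x"
  using nbrs_states[OF x] by (intro stp_mono_nbrs h x le) auto

text \<open>Finite propagation speed: \<open>k\<close> steps from \<open>x\<close> see only states
  within \<open>k\<close> moves, so an inequality on \<open>D 0\<close> suffices if \<open>D\<close>
  shrinks by one neighbourhood per step. It is needed because the asymptotic estimates hold only far
  out.\<close>

lemma stp_iter_mono_local:
  assumes h: "0 \<le> h" "h * R \<le> 1"
    and D: "\<And>k. D k \<subseteq> states n" "\<And>k y. y \<in> D (Suc k) \<Longrightarrow> nbrs n y \<subseteq> D k"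
    and le: "\<And>y. y \<in> D 0 \<Longrightarrow> g y \<le> g' y" and x: "x \<in> D k"
  shows "(stp n l f h ^^ k) g x \<le> (stp n l f h ^^ k) g' x"
  using x
proof (induction k arbitrary: x)
  case (Suc k)
  then have "x \<in> states n" "nbrs n x \<subseteq> D k" using D by blast+
  then show ?case unfolding funpow.simps o_def using Suc.IH by (intro stp_mono_nbrs h) blast+
qed (auto simp: le)

lemma stp_iter_mono:
  assumes h: "0 \<le> h" "h * R \<le> 1" and x: "x \<in> states n"
    and le: "\<And>y. y \<in> states n \<Longrightarrow> g y \<le> g' y"
  shows "(stp n l f h ^^ k) g x \<le> (stp n l f h ^^ k) g' x"
  using x
proof (induction k arbitrary: x)
  case (Suc k) then show ?case by (auto intro!: stp_mono h)
qed (auto simp: le)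

lemma stp_iter_bound:
  assumes h: "0 \<le> h" "h * R \<le> 1" and x: "x \<in> states n"
    and b: "\<And>y. y \<in> states n \<Longrightarrow> \<bar>g y\<bar> \<le> c"
  shows "\<bar>(stp n l f h ^^ k) g x\<bar> \<le> c"
proof -
  have "(stp n l f h ^^ k) g x \<le> (stp n l f h ^^ k) (\<lambda>_. c) x"
    using b by (intro stp_iter_mono h x) (simp add: abs_le_iff)
  moreover have "(stp n l f h ^^ k) (\<lambda>_. - c) x \<le> (stp n l f h ^^ k) g x"
    using b by (intro stp_iter_mono h x) (force simp add: abs_le_iff)
  ultimately show ?thesis by (simp add: stp_iter_const abs_le_iff)
qed

text \<open>A positive, linear, local functional that fixes constants is an expectation; the weights
  are its values at point indicators. The support is finite, so the identity holds for unbounded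
  \<open>g\<close> too.\<close>

lemma stp_kernel:
  assumes h: "0 \<le> h" "h * R \<le> 1" and x: "x \<in> states n"
  obtains p where "set_pmf p \<subseteq> nbrs n x" "\<And>g. expect p g = stp n l f h g x"
proof -
  define a where "a y = stp n l f h (indicator {y}) x" for y
  have sumF: "sum a F = stp n l f h (indicator F) x" if "finite F" for F
  proof -
    have "indicator F = (\<lambda>z. \<Sum>y\<in>F. indicator {y} z :: real)"
      using that by (intro ext) (simp add: indicator_def)
    then show ?thesis unfolding a_def stp_sum[symmetric] by simp
  qed
  have a0: "0 \<le> a y" for y
    using stp_mono[OF h x, of "\<lambda>_. 0" "indicator {y}"] by (simp add: a_def stp_const)
  have le1: "sum a F \<le> 1" if "finite F" for F
    using stp_mono[OF h x, of "indicator F" "\<lambda>_. 1"] by (simp add: sumF[OF that] stp_const)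
  have eq1: "sum a (nbrs n x) = 1"
  proof -
    have "stp n l f h (indicator (nbrs n x)) x = stp n l f h (\<lambda>_. 1) x"
      unfolding stp_def using gen_cong_nbrs[of n x "indicator (nbrs n x)" "\<lambda>_. 1" l f]
      by (simp add: nbrs_def)
    then show ?thesis by (simp add: sumF[OF finite_nbrs] stp_const)
  qed
  then obtain y0 where "0 < a y0"
    by (metis a0 less_eq_real_def linorder_not_less sum_nonpos zero_less_one)
  from pmf_from_weights[of a, OF a0 le1 this] obtain p A
    where A: "0 < A" "A \<le> 1" and p: "\<And>y. a y = A * pmf p y" by blast
  have AP: "A * measure_pmf.prob p (nbrs n x) = 1"
    using eq1 unfolding p measure_measure_pmf_finite[OF finite_nbrs] by (simp add: sum_distrib_left)
  have "A * measure_pmf.prob p (nbrs n x) \<le> A * 1" using A by (intro mult_left_mono) auto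
  with AP A have A1: "A = 1" by simp
  with AP have P1: "measure_pmf.prob p (nbrs n x) = 1" by simp
  then have sub: "set_pmf p \<subseteq> nbrs n x" 
    by (metis measure_pmf.prob_eq_1 AE_measure_pmf_iff subsetI sets_measure_pmf UNIV_I)
  show ?thesis
  proof (rule that[OF sub])
    fix g
    have "expect p g = (\<Sum>y\<in>nbrs n x. g y * a y)"
      using sub by (subst integral_measure_pmf_real[OF finite_nbrs]) (auto simp: p A1)
    also have "\<dots> = stp n l f h (\<lambda>z. \<Sum>y\<in>nbrs n x. g y * indicator {y} z) x"
      unfolding stp_sum a_def stp_cmult ..
    also have "\<dots> = stp n l f h g x"
    proof -
      have *: "(\<Sum>y\<in>nbrs n x. g y * indicator {y} z) = g z" if "z \<in> nbrs n x" for z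
      proof -
        have "(\<Sum>y\<in>nbrs n x. g y * indicator {y} z) = (\<Sum>y\<in>nbrs n x. if y = z then g y else 0)"
          by (intro sum.cong) (auto simp: indicator_def)
        then show ?thesis using that finite_nbrs by simp
      qed
      then have "x \<in> nbrs n x \<Longrightarrow> ?thesis" unfolding stp_def 
        using gen_cong_nbrs[of n x "\<lambda>z. \<Sum>y\<in>nbrs n x. g y * indicator {y} z" g l f] by simp
      then show ?thesis by (simp add: nbrs_def)
    qed
    finally show "expect p g = stp n l f h g x" .
  qed
qed

lemma stp_chain:
  assumes h: "0 \<le> h" "h * R \<le> 1" and x: "x \<in> states n"
  obtains D where "\<And>k. set_pmf (D k) \<subseteq> states n"
    "\<And>k g c. (\<And>y. y \<in> states n \<Longrightarrow> \<bar>g y\<bar> \<le> c) \<Longrightarrow> expect (D k) g = (stp n l f h ^^ k) g x"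
proof -
  have "\<exists>D. set_pmf D \<subseteq> states n \<and>
      (\<forall>g c. (\<forall>y\<in>states n. \<bar>g y\<bar> \<le> c) \<longrightarrow> expect D g = (stp n l f h ^^ k) g x)" for k
  proof (induction k)
    case 0
    show ?case using x by (intro exI[of _ "return_pmf x"]) (auto simp: integral_return)
  next
    case (Suc k)
    then obtain D where D: "set_pmf D \<subseteq> states n"
      "\<And>g c. (\<forall>y\<in>states n. \<bar>g y\<bar> \<le> c) \<Longrightarrow> expect D g = (stp n l f h ^^ k) g x" by blast
    have "\<forall>z\<in>states n. \<exists>p. set_pmf p \<subseteq> nbrs n z \<and> (\<forall>g. expect p g = stp n l f h g z)"
      using stp_kernel[OF h] by blast
    then obtain \<kappa> where \<kappa>: "\<And>z. z \<in> states n \<Longrightarrow> set_pmf (\<kappa> z) \<subseteq> nbrs n z"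
      "\<And>z g. z \<in> states n \<Longrightarrow> expect (\<kappa> z) g = stp n l f h g z" by metis
    have sub: "set_pmf (bind_pmf D \<kappa>) \<subseteq> states n"
      using D(1) \<kappa>(1) nbrs_states by (force simp: set_bind_pmf)
    show ?case
    proof (intro exI[of _ "bind_pmf D \<kappa>"] conjI sub allI impI)
      fix g :: "_ \<Rightarrow> real" and c assume g: "\<forall>y\<in>states n. \<bar>g y\<bar> \<le> c"
      have "expect (bind_pmf D \<kappa>) g = expect D (\<lambda>z. expect (\<kappa> z) g)"
        using sub g by (intro expect_bind[where c = c]) auto
      also have "\<dots> = expect D (stp n l f h g)"
        using D(1) \<kappa>(2) by (intro expect_cong) auto
      also have "\<dots> = (stp n l f h ^^ k) (stp n l f h g) x"
        using stp_iter_bound[OF h, of _ g c 1] g by (intro D(2)[of _ c]) auto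
      finally show "expect (bind_pmf D \<kappa>) g = (stp n l f h ^^ Suc k) g x"
        by (simp add: funpow_swap1)
    qed
  qed
  then obtain D where "\<And>k. set_pmf (D k) \<subseteq> states n" and
    "\<And>k g c. (\<forall>y\<in>states n. \<bar>g y\<bar> \<le> c) \<Longrightarrow> expect (D k) g = (stp n l f h ^^ k) g x" by metis
  then show ?thesis using that[of D] by blast
qed

text \<open>The law of the chain at a uniformly random time below \<open>Suc k\<close>. Averaging,
  unlike the law at a fixed time, makes the defect of invariance vanish by telescoping.\<close>

lemma stp_cesaro:
  assumes h: "0 \<le> h" "h * R \<le> 1" and x: "x \<in> states n"
  obtains A where "\<And>k. set_pmf (A k) \<subseteq> states n"
    "\<And>k g c. (\<And>y. y \<in> states n \<Longrightarrow> \<bar>g y\<bar> \<le> c) \<Longrightarrow>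
       expect (A k) g = (\<Sum>j<Suc k. (stp n l f h ^^ j) g x) / real (Suc k)"
proof -
  obtain D where D: "\<And>k. set_pmf (D k) \<subseteq> states n"
    "\<And>k g c. (\<And>y. y \<in> states n \<Longrightarrow> \<bar>g y\<bar> \<le> c) \<Longrightarrow> expect (D k) g = (stp n l f h ^^ k) g x"
    by (rule stp_chain[OF h x]) blast
  define A where "A k = bind_pmf (pmf_of_set {..<Suc k}) D" for k
  have sub: "set_pmf (A k) \<subseteq> states n" for k using D(1) by (auto simp: A_def set_bind_pmf)
  show ?thesis
  proof (rule that[OF sub])
    fix k g c assume g: "\<And>y. y \<in> states n \<Longrightarrow> \<bar>g y\<bar> \<le> (c::real)"
    have "expect (A k) g = expect (pmf_of_set {..<Suc k}) (\<lambda>j. expect (D j) g)"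
      unfolding A_def using sub[of k] g by (intro expect_bind[where c = c]) (auto simp: A_def)
    also have "\<dots> = (\<Sum>j<Suc k. expect (D j) g) / real (Suc k)"
      by (subst integral_pmf_of_set) (auto simp: lessThan_empty_iff)
    finally show "expect (A k) g = (\<Sum>j<Suc k. (stp n l f h ^^ j) g x) / real (Suc k)"
      using D(2)[of g c] g by simp
  qed
qed

text \<open>The sum telescopes to at most \<open>2 * c / h\<close>, whatever \<open>k\<close> is;
  dividing by \<open>Suc k\<close> sends it to 0.\<close>

lemma cesaro_gen:
  assumes h: "0 < h" "h * R \<le> 1" and x: "x \<in> states n"
    and g: "\<And>y. y \<in> states n \<Longrightarrow> \<bar>g y\<bar> \<le> c"
  shows "(\<lambda>k. (\<Sum>j<Suc k. (stp n l f h ^^ j) (gen n l f g) x) / real (Suc k)) \<longlonglongrightarrow> 0"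
proof (rule Lim_null_comparison)
  show "(\<lambda>k. (2 * c / h) * inverse (real (Suc k))) \<longlonglongrightarrow> 0"
    by (intro tendsto_mult_right_zero LIMSEQ_inverse_real_of_nat)
  have *: "\<bar>\<Sum>j<Suc k. (stp n l f h ^^ j) (gen n l f g) x\<bar> \<le> 2 * c / h" for k
  proof -
    have "\<bar>h * (\<Sum>j<Suc k. (stp n l f h ^^ j) (gen n l f g) x)\<bar> \<le> 2 * c"
      unfolding stp_iter_telescope[symmetric]
      using stp_iter_bound[where g = g and k = "Suc k", OF _ h(2) x g] h(1) g[OF x] by linarith
    then have "h * \<bar>\<Sum>j<Suc k. (stp n l f h ^^ j) (gen n l f g) x\<bar> \<le> 2 * c"
      using h(1) by (simp only: abs_mult abs_of_pos)
    then show ?thesis using h(1) by (simp only: pos_le_divide_eq mult.commute)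
  qed
  then show "\<forall>\<^sub>F k in sequentially. norm ((\<Sum>j<Suc k. (stp n l f h ^^ j) (gen n l f g) x) / real (Suc k))
      \<le> (2 * c / h) * inverse (real (Suc k))"
  proof (intro always_eventually allI)
    fix k
    have "norm ((\<Sum>j<Suc k. (stp n l f h ^^ j) (gen n l f g) x) / real (Suc k)) =
        \<bar>\<Sum>j<Suc k. (stp n l f h ^^ j) (gen n l f g) x\<bar> * inverse (real (Suc k))"
      unfolding real_norm_def divide_inverse abs_mult by simp
    also have "\<dots> \<le> (2 * c / h) * inverse (real (Suc k))"
      using * by (intro mult_right_mono) simp_all
    finally show "norm ((\<Sum>j<Suc k. (stp n l f h ^^ j) (gen n l f g) x) / real (Suc k))
      \<le> (2 * c / h) * inverse (real (Suc k))" .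
  qed
qed

lemma invariant_gen:
  assumes "invariant n l f \<mu>" "\<And>x. x \<in> states n \<Longrightarrow> \<bar>g x\<bar> \<le> c"
  shows "expect \<mu> (gen n l f g) = 0"
proof -
  define c' where "c' = \<bar>c\<bar> + 1"
  have c': "0 < c'" "\<And>x. x \<in> states n \<Longrightarrow> \<bar>g x\<bar> \<le> c'" using assms(2) by (force simp: c'_def)+
  define g' where "g' x = (if x \<in> states n then inverse c' * g x else 0)" for x
  have "\<bar>g' x\<bar> \<le> 1" for x using c' by (auto simp: g'_def abs_mult field_simps)
  with assms(1) have "expect \<mu> (gen n l f g') = 0" by (auto simp: invariant_def)
  also have "expect \<mu> (gen n l f g') = expect \<mu> (\<lambda>x. inverse c' * gen n l f g x)"
  proof (rule expect_cong)
    fix x assume "x \<in> set_pmf \<mu>"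
    then have x: "x \<in> states n" using assms(1) by (auto simp: invariant_def)
    show "gen n l f g' x = inverse c' * gen n l f g x"
      unfolding gen_cmult[symmetric] by (rule gen_cong[OF x]) (simp add: g'_def)
  qed
  finally show ?thesis using c'(1) by simp
qed

lemma invariant_stp_iter:
  assumes "invariant n l f \<mu>" and h: "0 \<le> h" "h * R \<le> 1"
    and g: "\<And>x. x \<in> states n \<Longrightarrow> \<bar>g x\<bar> \<le> c"
  shows "expect \<mu> ((stp n l f h ^^ k) g) = expect \<mu> g"
proof (induction k)
  case (Suc k)
  have sub: "set_pmf \<mu> \<subseteq> states n" using assms(1) by (simp add: invariant_def)
  let ?g = "(stp n l f h ^^ k) g"
  have b: "\<bar>?g y\<bar> \<le> c" if "y \<in> states n" for y using stp_iter_bound[OF h that g] .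
  have "expect \<mu> (stp n l f h ?g) = expect \<mu> (\<lambda>x. ?g x + h * gen n l f ?g x)"
    by (intro expect_cong) (simp add: stp_def)
  also have "\<dots> = expect \<mu> ?g + h * expect \<mu> (gen n l f ?g)"
  proof -
    have "integrable \<mu> ?g" using sub b by (intro integrable_bdd[where c = c]) auto
    moreover have "integrable \<mu> (gen n l f ?g)"
      using sub gen_bound[where g = ?g, OF _ b] by (intro integrable_bdd[where c = "2 * c * R"]) auto
    ultimately show ?thesis by simp
  qed
  also have "\<dots> = expect \<mu> ?g" using invariant_gen[OF assms(1) b] by simp
  finally show ?case using Suc by simp
qed simp

end

section \<open>Comparison of generators, and tightness from domination\<close>

lemma stp_iter_Suc: "(stp n l f h ^^ Suc k) g = stp n l f h ((stp n l f h ^^ k) g)"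
  by simp

text \<open>For increasing \<open>g\<close>, arrivals raise it and departures lower it, so smaller
  arrival rates and larger service rates decrease the generator. Moves of queues beyond
  \<open>n\<close> do not change the restriction and drop out, which lets systems of different size
  be compared.\<close>

lemma gen_compare:
  assumes le: "n \<le> m" and x: "x \<in> states m" and g: "state_mono n g"
    and dom: "\<And>i. i \<in> {1..n} \<Longrightarrow> l' i \<le> l i" "\<And>i. i \<in> {1..n} \<Longrightarrow> f i (restrict x {1..n}) \<le> f' i x"
  shows "gen m l' f' (\<lambda>x. g (restrict x {1..n})) x \<le> gen n l f g (restrict x {1..n})"
proof -
  let ?x = "restrict x {1..n}"
  have x': "?x \<in> states n" by (rule restrict_states[OF le x])
  have upd: "restrict (x(i := v)) {1..n} = (if i \<in> {1..n} then ?x(i := v) else ?x)" for i v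
    by (auto simp: fun_eq_iff restrict_def)
  have "gen m l' f' (\<lambda>x. g (restrict x {1..n})) x = (\<Sum>i\<in>{1..n}. l' i * (g (restrict (x(i := x i + 1)) {1..n}) - g ?x) +
     (if 0 < x i then f' i x * (g (restrict (x(i := x i - 1)) {1..n}) - g ?x) else 0))"
    unfolding gen_def using le by (intro sum.mono_neutral_right) (auto simp: upd)
  also have "\<dots> \<le> gen n l f g ?x"
    unfolding gen_def
  proof (rule sum_mono)
    fix i assume i: "i \<in> {1..n}"
    have "g ?x \<le> g (?x(i := x i + 1))"
      using g x' state_upd[OF x' i] i unfolding state_mono_def by simp
    then have 1: "l' i * (g (?x(i := x i + 1)) - g ?x) \<le> l i * (g (?x(i := x i + 1)) - g ?x)"
      using dom(1)[OF i] by (intro mult_right_mono) auto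
    have "g (?x(i := x i - 1)) \<le> g ?x"
      using g x' state_upd[OF x' i] i unfolding state_mono_def by simp
    then have 2: "f' i x * (g (?x(i := x i - 1)) - g ?x) \<le> f i ?x * (g (?x(i := x i - 1)) - g ?x)"
      using dom(2)[OF i] by (intro mult_right_mono_neg) auto
    show "l' i * (g (restrict (x(i := x i + 1)) {1..n}) - g ?x) +
        (if 0 < x i then f' i x * (g (restrict (x(i := x i - 1)) {1..n}) - g ?x) else 0)
      \<le> l i * (g (?x(i := ?x i + 1)) - g ?x) + (if 0 < ?x i then f i ?x * (g (?x(i := ?x i - 1)) - g ?x) else 0)"
      using 1 2 i unfolding upd by (cases "x i = 0") simp_all
  qed
  finally show ?thesis .
qed

text \<open>Turns closure under single arrivals into closure under the coordinatewise order, by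
  induction on the total distance.\<close>

lemma states_up_induct:
  assumes x: "x \<in> states n" "P x" and step: "\<And>z i. z \<in> states n \<Longrightarrow> P z \<Longrightarrow> i \<in> {1..n} \<Longrightarrow> P (z(i := z i + 1))"
    and y: "y \<in> states n" "\<And>i. i \<in> {1..n} \<Longrightarrow> x i \<le> y i"
  shows "P y"
  using x y(2)
proof (induction "\<Sum>i\<in>{1..n}. y i - x i" arbitrary: x)
  case 0
  then have "\<And>i. i \<in> {1..n} \<Longrightarrow> x i = y i" by force
  then have "x = y" by (intro states_eqI[OF 0(2) y(1)]) auto
  then show ?case using 0 by simp
next
  case (Suc k)
  have "\<exists>i\<in>{1..n}. x i < y i"
  proof (rule ccontr)
    assume "\<not> ?thesis"
    then have "(\<Sum>i\<in>{1..n}. y i - x i) = 0" by (intro sum.neutral) auto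
    then show False using Suc.hyps(2) by simp
  qed
  then obtain i where i: "i \<in> {1..n}" "x i < y i" by blast
  let ?x = "x(i := x i + 1)"
  have *: "(\<Sum>j\<in>{1..n} - {i}. y j - ?x j) = (\<Sum>j\<in>{1..n} - {i}. y j - x j)"
    by (intro sum.cong) auto
  have "(\<Sum>j\<in>{1..n}. y j - x j) = (y i - x i) + (\<Sum>j\<in>{1..n} - {i}. y j - x j)"
    "(\<Sum>j\<in>{1..n}. y j - ?x j) = (y i - ?x i) + (\<Sum>j\<in>{1..n} - {i}. y j - ?x j)"
    by (rule sum.remove; use i in simp)+
  then have "k = (\<Sum>j\<in>{1..n}. y j - ?x j)" using Suc.hyps(2) * i by simp
  moreover have "?x \<in> states n" using Suc.prems(1) i(1) by (rule state_upd)
  moreover have "P ?x" using Suc.prems(1,2) i(1) by (rule step)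
  moreover have "?x j \<le> y j" if "j \<in> {1..n}" for j using Suc.prems(3)[OF that] i by auto
  ultimately show ?case by (rule Suc.hyps(1))
qed

lemma pmf_box_tight:
  assumes "set_pmf \<mu> \<subseteq> states n" "0 < \<epsilon>"
  obtains r where "measure_pmf.prob \<mu> (- {x \<in> states n. \<forall>i\<in>{1..n}. x i \<le> r}) \<le> \<epsilon>"
proof -
  let ?b = "\<lambda>r. {x \<in> states n. \<forall>i\<in>{1..n}. x i \<le> r}"
  have "(\<lambda>r. measure_pmf.prob \<mu> (?b r)) \<longlonglongrightarrow> measure_pmf.prob \<mu> (\<Union>r. ?b r)"
    by (intro measure_pmf.finite_Lim_measure_incseq) (auto simp: incseq_def intro: order_trans)
  also have "(\<Union>r. ?b r) = states n"
  proof -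
    have "x \<in> (\<Union>r. ?b r)" if "x \<in> states n" for x
      using that by (auto intro!: exI[of _ "\<Sum>i\<in>{1..n}. x i"] member_le_sum)
    then show ?thesis by auto
  qed
  also have "measure_pmf.prob \<mu> (states n) = 1"
    using assms(1) by (simp add: measure_pmf.prob_eq_1 AE_measure_pmf_iff subset_eq)
  finally have "eventually (\<lambda>r. 1 - \<epsilon> < measure_pmf.prob \<mu> (?b r)) sequentially"
    using assms(2) by (intro order_tendstoD) auto
  then obtain r where "1 - \<epsilon> < measure_pmf.prob \<mu> (?b r)"
    by (meson eventually_sequentially order_refl)
  moreover have "measure_pmf.prob \<mu> (- ?b r) = 1 - measure_pmf.prob \<mu> (?b r)"
    using measure_pmf.prob_compl[of "?b r" \<mu>] by (simp add: Compl_eq_Diff_UNIV)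
  ultimately show ?thesis by (intro that[of r]) simp
qed

lemma finite_box: "finite {x \<in> states n. \<forall>i\<in>{1..n}. x i \<le> r}"
proof (rule finite_subset)
  show "{x \<in> states n. \<forall>i\<in>{1..n}. x i \<le> r} \<subseteq> ({1..n} \<rightarrow>\<^sub>E {..r})"
    by (auto simp: states_def PiE_iff extensional_def)
  show "finite ({1..n} \<rightarrow>\<^sub>E {..r})" by (intro finite_PiE) auto
qed

text \<open>Among states, the complement of a box is an up-set, so its indicator is increasing: one
  box whose complement is small under \<open>\<mu>\<close> serves all dominated
  distributions.\<close>

lemma tight_of_dominated:
  assumes "set_pmf \<mu> \<subseteq> states n"
    and dom: "\<And>k g. state_mono n g \<Longrightarrow> (\<And>x. \<bar>g x\<bar> \<le> 1) \<Longrightarrow> expect (p k) g \<le> expect \<mu> g"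
    and "0 < \<epsilon>"
  shows "\<exists>F. finite F \<and> (\<forall>k. measure_pmf.prob (p k) (- F) \<le> \<epsilon>)"
proof -
  obtain r where r: "measure_pmf.prob \<mu> (- {x \<in> states n. \<forall>i\<in>{1..n}. x i \<le> r}) \<le> \<epsilon>"
    by (rule pmf_box_tight[OF assms(1,3)])
  let ?b = "{x \<in> states n. \<forall>i\<in>{1..n}. x i \<le> r}"
  have "state_mono n (indicator (- ?b))"
    by (auto simp: state_mono_def indicator_def dest: order_trans)
  then have "expect (p k) (indicator (- ?b)) \<le> expect \<mu> (indicator (- ?b))" for k
    by (rule dom) (auto simp: indicator_def)
  then show ?thesis using r finite_box[of n r] by (intro exI[of _ ?b]) (auto intro: order_trans)
qed

lemma expect_count_space:
  "expect p g = (\<integral>x. pmf p x * g x \<partial>count_space UNIV)"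
  by (simp add: measure_pmf_eq_density integral_density)

lemma integrable_count_space:
  fixes g :: "'a \<Rightarrow> real"
  assumes "integrable (measure_pmf p) g"
  shows "integrable (count_space UNIV) (\<lambda>x. pmf p x * g x)"
  using assms by (simp add: measure_pmf_eq_density integrable_density)

lemma not_tendsto_subseq:
  fixes X :: "nat \<Rightarrow> real"
  assumes "\<not> X \<longlonglongrightarrow> L"
  obtains e r where "0 < e" "strict_mono r" "\<And>k::nat. e \<le> \<bar>X (r k) - L\<bar>"
proof -
  from assms obtain e where e: "0 < e" "\<And>n0. \<exists>n\<ge>n0. e \<le> \<bar>X n - L\<bar>"
    unfolding lim_sequentially dist_real_def by (meson linorder_not_less)
  define I where "I = {n. e \<le> \<bar>X n - L\<bar>}"
  have "infinite I" unfolding infinite_nat_iff_unbounded_le I_def using e(2) by blast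
  then show ?thesis
    using e(1) enumerate_in_set[of I] strict_mono_enumerate[of I]
    by (intro that[of e "enumerate I"]) (auto simp: I_def)
qed

section \<open>Maximum principle, supports and uniqueness of invariant distributions\<close>

context queue_system
begin

text \<open>Maximum principle: at a maximum every increment is nonpositive and carries a nonnegative
  rate. If the sum vanishes, so does each term, and as \<open>l i\<close> is positive, the state
  after an arrival is a maximum too. Departures yield no such conclusion, since their rate may be
  0.\<close>

lemma gen_at_max:
  assumes x: "x \<in> states n" and le: "\<And>y. y \<in> states n \<Longrightarrow> g y \<le> g x"
  shows "gen n l f g x \<le> 0"
    and "gen n l f g x = 0 \<Longrightarrow> i \<in> {1..n} \<Longrightarrow> g (x(i := x i + 1)) = g x"
proof -
  let ?t = "\<lambda>i. l i * (g (x(i := x i + 1)) - g x) + (if 0 < x i then f i x * (g (x(i := x i - 1)) - g x) else 0)"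
  have d: "g (x(i := v)) - g x \<le> 0" if "i \<in> {1..n}" for i v using le[OF state_upd[OF x that]] by simp
  have t1: "l i * (g (x(i := x i + 1)) - g x) \<le> 0" if "i \<in> {1..n}" for i
    using d[OF that] l_pos[OF that] by (intro mult_nonneg_nonpos) auto
  have t2: "f i x * (g (x(i := x i - 1)) - g x) \<le> 0" if "i \<in> {1..n}" for i
    using d[OF that] f_nonneg[OF that x] by (intro mult_nonneg_nonpos) auto
  have t: "?t i \<le> 0" if "i \<in> {1..n}" for i using t1[OF that] t2[OF that] by auto
  then show "gen n l f g x \<le> 0" unfolding gen_def by (rule sum_nonpos)
  assume 0: "gen n l f g x = 0" and i: "i \<in> {1..n}"
  have "(\<Sum>i\<in>{1..n}. - ?t i) = 0" using 0 unfolding gen_def sum_negf by (simp only: minus_zero)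
  then have "\<forall>i\<in>{1..n}. - ?t i = 0" using t by (subst (asm) sum_nonneg_eq_0_iff) (simp_all only: finite_atLeastAtMost neg_0_le_iff_le)
  then have "?t i = 0" using i by (simp only: neg_equal_0_iff_equal)
  then have "l i * (g (x(i := x i + 1)) - g x) + (if 0 < x i then f i x * (g (x(i := x i - 1)) - g x) else 0) = 0" .
  moreover have "(if 0 < x i then f i x * (g (x(i := x i - 1)) - g x) else 0) \<le> 0" using t2[OF i] by (cases "0 < x i") simp_all
  ultimately have "l i * (g (x(i := x i + 1)) - g x) = 0" using t1[OF i] by linarith
  then show "g (x(i := x i + 1)) = g x" using l_pos[OF i] by simp
qed

text \<open>The indicator of the support is maximal on the support, so its generator is nonpositive
  there. The mean being 0, the generator is 0 at every point of the support, and the maximum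
  principle applies.\<close>

lemma invariant_support_Suc:
  assumes inv: "invariant n l f \<mu>" and x: "x \<in> set_pmf \<mu>" and i: "i \<in> {1..n}"
  shows "x(i := x i + 1) \<in> set_pmf \<mu>"
proof -
  have sub: "set_pmf \<mu> \<subseteq> states n" using inv by (simp add: invariant_def)
  let ?g = "indicator (set_pmf \<mu>) :: _ \<Rightarrow> real"
  have g1: "\<bar>?g y\<bar> \<le> 1" for y by (auto simp: indicator_def)
  have le0: "gen n l f ?g y \<le> 0" if "y \<in> set_pmf \<mu>" for y
    using that sub by (intro gen_at_max) (auto simp: indicator_def)
  have "expect \<mu> (\<lambda>y. - gen n l f ?g y) = 0"
    using invariant_gen[OF inv g1] by simp
  moreover have "integrable \<mu> (\<lambda>y. - gen n l f ?g y)"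
    using gen_bound[where g = ?g, OF _ g1] sub by (intro integrable_bdd[where c = "2 * 1 * R"]) auto
  ultimately have "AE y in \<mu>. - gen n l f ?g y = 0"
    using le0 by (subst (asm) integral_nonneg_eq_0_iff_AE) (auto simp: AE_measure_pmf_iff)
  then have "gen n l f ?g x = 0" using x by (auto simp: AE_measure_pmf_iff)
  then have "?g (x(i := x i + 1)) = ?g x"
    by (rule gen_at_max(2)[OF _ _ _ i, rotated 2]) (use x sub in \<open>auto simp: indicator_def\<close>)
  then show ?thesis using x by (auto simp: indicator_def split: if_splits)
qed

lemma invariant_support_up:
  assumes "invariant n l f \<mu>" "x \<in> set_pmf \<mu>" "y \<in> states n" "\<And>i. i \<in> {1..n} \<Longrightarrow> x i \<le> y i"
  shows "y \<in> set_pmf \<mu>"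
proof (rule states_up_induct[where P = "\<lambda>z. z \<in> set_pmf \<mu>", OF _ assms(2) _ assms(3,4)])
  show "x \<in> states n" using assms(1,2) by (auto simp: invariant_def)
qed (auto intro: invariant_support_Suc[OF assms(1), simplified])

text \<open>Test the signed measure \<open>\<nu> - \<mu>\<close> with the indicator \<open>g\<close>
  of the set where it is negative. By the maximum principle for \<open>g\<close> on that set, and
  for \<open>- g\<close> where the measure is positive, every term of the sum is nonnegative, while
  the sum is 0. So the generator annihilates \<open>g\<close> at \<open>x\<close>, and an arrival
  stays in the set.\<close>

lemma invariant_unique_aux:
  assumes \<mu>: "invariant n l f \<mu>" and \<nu>: "invariant n l f \<nu>"
    and x: "pmf \<nu> x < pmf \<mu> x" and i: "i \<in> {1..n}"
  shows "pmf \<nu> (x(i := x i + 1)) < pmf \<mu> (x(i := x i + 1))"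
proof -
  have sub: "set_pmf \<mu> \<subseteq> states n" "set_pmf \<nu> \<subseteq> states n" using \<mu> \<nu> by (simp_all add: invariant_def)
  define g :: "_ \<Rightarrow> real" where "g = indicator {x. pmf \<nu> x < pmf \<mu> x}"
  have g1: "\<bar>g y\<bar> \<le> 1" for y by (auto simp: g_def indicator_def)
  have int: "integrable \<mu> (gen n l f g)" "integrable \<nu> (gen n l f g)"
    using gen_bound[where g = g, OF _ g1] sub by (auto intro!: integrable_bdd[where c = "2 * 1 * R"])
  let ?F = "\<lambda>x. pmf \<nu> x * gen n l f g x - pmf \<mu> x * gen n l f g x"
  have "(\<integral>x. ?F x \<partial>count_space UNIV) = expect \<nu> (gen n l f g) - expect \<mu> (gen n l f g)"
    unfolding expect_count_space
    by (rule Bochner_Integration.integral_diff) (intro integrable_count_space int)+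
  also have "\<dots> = 0" using invariant_gen[OF \<mu> g1] invariant_gen[OF \<nu> g1] by simp
  finally have int0: "(\<integral>x. ?F x \<partial>count_space UNIV) = 0" .
  have nn: "0 \<le> ?F y" for y
  proof (cases "y \<in> states n")
    case False
    then have "pmf \<nu> y = 0" "pmf \<mu> y = 0" using sub by (auto simp: set_pmf_iff)
    then show ?thesis by simp
  next
    case y: True
    consider "pmf \<nu> y < pmf \<mu> y" | "pmf \<nu> y = pmf \<mu> y" | "pmf \<mu> y < pmf \<nu> y" by linarith
    then show ?thesis
    proof cases
      case 1
      then have "gen n l f g y \<le> 0" by (intro gen_at_max y) (auto simp: g_def indicator_def)
      then have "(pmf \<nu> y - pmf \<mu> y) * gen n l f g y \<ge> 0" using 1 by (intro mult_nonpos_nonpos) auto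
      then show ?thesis by (simp add: algebra_simps)
    next
      case 3
      then have "gen n l f (\<lambda>y. - 1 * g y) y \<le> 0" by (intro gen_at_max y) (auto simp: g_def indicator_def)
      then have "0 \<le> gen n l f g y" unfolding gen_cmult by simp
      then have "(pmf \<nu> y - pmf \<mu> y) * gen n l f g y \<ge> 0" using 3 by (intro mult_nonneg_nonneg) auto
      then show ?thesis by (simp add: algebra_simps)
    qed simp
  qed
  have "integrable (count_space UNIV) ?F"
    by (intro Bochner_Integration.integrable_diff integrable_count_space int)
  then have "AE x in count_space UNIV. ?F x = 0"
    using int0 nn by (subst (asm) integral_nonneg_eq_0_iff_AE) auto
  then have "?F x = 0" by (simp add: AE_count_space)
  then have "(pmf \<nu> x - pmf \<mu> x) * gen n l f g x = 0" by (simp add: algebra_simps)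
  then have gx: "gen n l f g x = 0" using x by simp
  have "x \<in> states n" using x sub(1) by (metis pmf_nonneg linorder_not_less set_pmf_iff subsetD)
  then have "g (x(i := x i + 1)) = g x"
    by (rule gen_at_max(2)[OF _ _ gx i]) (use x in \<open>auto simp: g_def indicator_def\<close>)
  then show ?thesis using x by (auto simp: g_def indicator_def split: if_splits)
qed

text \<open>The strict inequalities between \<open>pmf \<mu>\<close> and \<open>pmf \<nu>\<close> in
  either direction persist under arrivals, hence both would hold at the coordinatewise maximum of a
  state of each kind.\<close>

lemma invariant_unique:
  assumes \<mu>: "invariant n l f \<mu>" and \<nu>: "invariant n l f \<nu>"
  shows "\<mu> = \<nu>"
proof (rule ccontr)
  assume "\<mu> \<noteq> \<nu>"
  then obtain x y where x: "pmf \<mu> x < pmf \<nu> x" and y: "pmf \<nu> y < pmf \<mu> y"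
    by (metis pmf_neq_exists_less)
  have st: "x \<in> states n" "y \<in> states n"
    using x y \<mu> \<nu> unfolding invariant_def by (metis pmf_nonneg linorder_not_less set_pmf_iff subsetD)+
  define z where "z = (\<lambda>i\<in>{1..n}. max (x i) (y i))"
  have z: "z \<in> states n" by (auto simp: z_def states_def)
  have "pmf \<mu> z < pmf \<nu> z"
    by (rule states_up_induct[where P = "\<lambda>z. pmf \<mu> z < pmf \<nu> z", OF st(1) x _ z])
      (auto simp: z_def intro: invariant_unique_aux[OF \<nu> \<mu>, simplified])
  moreover have "pmf \<nu> z < pmf \<mu> z"
    by (rule states_up_induct[where P = "\<lambda>z. pmf \<nu> z < pmf \<mu> z", OF st(2) y _ z])
      (auto simp: z_def intro: invariant_unique_aux[OF \<mu> \<nu>, simplified])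
  ultimately show False by simp
qed

lemma limit_invariant:
  assumes "set_pmf \<nu> \<subseteq> states n"
    and "\<And>g c. (\<And>x. x \<in> states n \<Longrightarrow> \<bar>g x\<bar> \<le> c) \<Longrightarrow> (\<lambda>k. expect (p k) g) \<longlonglongrightarrow> expect \<nu> g"
    and "\<And>g :: _ \<Rightarrow> real. (\<And>x. \<bar>g x\<bar> \<le> 1) \<Longrightarrow> (\<lambda>k. expect (p k) (gen n l f g)) \<longlonglongrightarrow> 0"
  shows "invariant n l f \<nu>"
  unfolding invariant_def
proof (intro conjI assms(1) allI impI)
  fix g :: "(nat \<Rightarrow> nat) \<Rightarrow> real" assume g: "\<forall>x. \<bar>g x\<bar> \<le> 1"
  have "(\<lambda>k. expect (p k) (gen n l f g)) \<longlonglongrightarrow> expect \<nu> (gen n l f g)"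
    using g by (intro assms(2)[of _ "2 * 1 * R"] gen_bound) auto
  from LIMSEQ_unique[OF this assms(3)] show "expect \<nu> (gen n l f g) = 0" using g by simp
qed

end

section \<open>Monotone systems: preservation of order, comparison, and time averages from the empty
  state\<close>

locale monotone_system = queue_system +
  assumes f_anti: "\<And>i x y. i \<in> {1..n} \<Longrightarrow> x \<in> states n \<Longrightarrow> y \<in> states n \<Longrightarrow>
    (\<And>j. j \<in> {1..n} \<Longrightarrow> x j \<le> y j) \<Longrightarrow> x i = y i \<Longrightarrow> f i y \<le> f i x"
begin

text \<open>Termwise in the form \<open>stp_convex\<close>. If \<open>x i = y i\<close>, then
  \<open>f i y \<le> f i x\<close>, and passing to \<open>y\<close> shifts weight from the departure
  to the larger value of staying. If \<open>x i < y i\<close>, nothing is known about the two rates,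
  but \<open>y\<close> still dominates \<open>x\<close> after a departure.\<close>

lemma stp_state_mono:
  assumes h: "0 \<le> h" "h * R \<le> 1" and g: "state_mono n g"
  shows "state_mono n (stp n l f h g)"
  unfolding state_mono_def
proof (intro ballI impI)
  fix x y assume x: "x \<in> states n" and y: "y \<in> states n" and le: "\<forall>j\<in>{1..n}. x j \<le> y j"
  have mono: "g u \<le> g v" if "u \<in> states n" "v \<in> states n" "\<And>j. j \<in> {1..n} \<Longrightarrow> u j \<le> v j" for u v
    using g that by (auto simp: state_mono_def)
  let ?T = "\<lambda>i x. l i * g (x(i := x i + 1)) +
      (if 0 < x i then f i x * g (x(i := x i - 1)) + (B - f i x) * g x else B * g x)"
  have T: "?T i x \<le> ?T i y" if i: "i \<in> {1..n}" for i
  proof (rule add_mono)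
    have lei: "x i \<le> y i" using le i by simp
    have "g (x(i := x i + 1)) \<le> g (y(i := y i + 1))"
      using le i by (intro mono state_upd x y) auto
    then show "l i * g (x(i := x i + 1)) \<le> l i * g (y(i := y i + 1))"
      using l_pos[OF i] by (intro mult_left_mono) auto
    note fx = f_nonneg[OF i x] f_le[OF i x] and fy = f_nonneg[OF i y] f_le[OF i y]
    have gx: "g (x(i := x i - 1)) \<le> g x" by (intro mono state_upd x i) auto
    have gy: "g (y(i := y i - 1)) \<le> g y" by (intro mono state_upd y i) auto
    have gxy: "g x \<le> g y" using le by (intro mono x y) auto
    show "(if 0 < x i then f i x * g (x(i := x i - 1)) + (B - f i x) * g x else B * g x)
        \<le> (if 0 < y i then f i y * g (y(i := y i - 1)) + (B - f i y) * g y else B * g y)"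
    proof (cases "x i = y i")
      case True
      have "f i y \<le> f i x" using le True by (intro f_anti i x y) auto
      then have "(f i x - f i y) * (g (x(i := x i - 1)) - g x) \<le> 0"
        using gx by (intro mult_nonneg_nonpos) auto
      then have 1: "f i x * g (x(i := x i - 1)) + (B - f i x) * g x \<le> f i y * g (x(i := x i - 1)) + (B - f i y) * g x"
        by (simp add: algebra_simps)
      have "g (x(i := x i - 1)) \<le> g (y(i := y i - 1))"
        using le True by (intro mono state_upd x y i) auto
      then have 2: "f i y * g (x(i := x i - 1)) + (B - f i y) * g x \<le> f i y * g (y(i := y i - 1)) + (B - f i y) * g y"
        using fy gxy by (intro add_mono mult_left_mono) auto
      have 3: "B * g x \<le> B * g y" using gxy B_nonneg by (intro mult_left_mono) auto
      show ?thesis using 1 2 3 True by auto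
    next
      case False
      then have lt: "x i < y i" using lei by simp
      have "f i x * (g (x(i := x i - 1)) - g x) \<le> 0" using fx gx by (intro mult_nonneg_nonpos) auto
      then have 1: "(if 0 < x i then f i x * g (x(i := x i - 1)) + (B - f i x) * g x else B * g x) \<le> B * g x"
        by (auto simp: algebra_simps)
      have "g x \<le> g (y(i := y i - 1))" using le lt by (intro mono state_upd x y i) auto
      then have 2: "B * g x \<le> B * g (y(i := y i - 1))" using B_nonneg by (intro mult_left_mono) auto
      have "0 \<le> (B - f i y) * (g y - g (y(i := y i - 1)))" using fy gy by (intro mult_nonneg_nonneg) auto
      then show ?thesis using 1 2 lt by (auto simp: algebra_simps)
    qed
  qed
  have gxy: "g x \<le> g y" using le by (intro mono x y) auto
  show "stp n l f h g x \<le> stp n l f h g y"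
    unfolding stp_convex[OF x] stp_convex[OF y]
    by (intro add_mono[OF mult_left_mono[OF gxy] mult_left_mono[OF sum_mono[OF T]]]) (use h in auto)
qed

lemma stp_iter_state_mono:
  assumes h: "0 \<le> h" "h * R \<le> 1" and g: "state_mono n g"
  shows "state_mono n ((stp n l f h ^^ k) g)"
  by (induction k) (auto intro: stp_state_mono h g)

end

text \<open>The induction hypothesis replaces the inner iterate by that of the dominating system,
  which is increasing because that system is monotone; \<open>gen_compare\<close> then handles the
  outermost step.\<close>

lemma stp_iter_compare:
  assumes "monotone_system n l f B" "queue_system m l' f' B'"
    and le: "n \<le> m" and g: "state_mono n g" and h: "0 \<le> h" "h * queue_system.R n l B \<le> 1" "h * queue_system.R m l' B' \<le> 1"
    and dom: "\<And>i. i \<in> {1..n} \<Longrightarrow> l' i \<le> l i"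
      "\<And>i x. i \<in> {1..n} \<Longrightarrow> x \<in> states m \<Longrightarrow> f i (restrict x {1..n}) \<le> f' i x"
    and x: "x \<in> states m"
  shows "(stp m l' f' h ^^ k) (\<lambda>x. g (restrict x {1..n})) x \<le> (stp n l f h ^^ k) g (restrict x {1..n})"
  using x
proof (induction k arbitrary: x)
  case (Suc k)
  interpret a: monotone_system n l f B by fact
  interpret b: queue_system m l' f' B' by fact
  let ?u = "(stp n l f h ^^ k) g"
  have "(stp m l' f' h ^^ Suc k) (\<lambda>x. g (restrict x {1..n})) x
      \<le> stp m l' f' h (\<lambda>x. ?u (restrict x {1..n})) x"
    unfolding stp_iter_Suc by (intro b.stp_mono h Suc)
  also have "\<dots> \<le> stp n l f h ?u (restrict x {1..n})"
    unfolding stp_def[of m l' f' h "\<lambda>x. ?u (restrict x {1..n})"] stp_def[of n l f h ?u] using h Suc.prems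
    by (intro add_mono order_refl mult_left_mono gen_compare le a.stp_iter_state_mono g dom)
  finally show ?case by (simp only: stp_iter_Suc)
qed simp

text \<open>The restricted empty state is the least state, so an increasing iterate is there at most
  its mean under \<open>\<mu>\<close>, and that mean does not change with \<open>k\<close>.\<close>

lemma invariant_dominates_iter:
  assumes "monotone_system n l f B" "queue_system m l' f' B'"
    and le: "n \<le> m" and g: "state_mono n g" "\<And>x. x \<in> states n \<Longrightarrow> \<bar>g x\<bar> \<le> c"
    and h: "0 \<le> h" "h * queue_system.R n l B \<le> 1" "h * queue_system.R m l' B' \<le> 1"
    and dom: "\<And>i. i \<in> {1..n} \<Longrightarrow> l' i \<le> l i"
      "\<And>i x. i \<in> {1..n} \<Longrightarrow> x \<in> states m \<Longrightarrow> f i (restrict x {1..n}) \<le> f' i x"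
    and inv: "invariant n l f \<mu>"
  shows "(stp m l' f' h ^^ k) (\<lambda>x. g (restrict x {1..n})) (zero_state m) \<le> expect \<mu> g"
proof -
  interpret a: monotone_system n l f B by fact
  have sub: "set_pmf \<mu> \<subseteq> states n" using inv by (simp add: invariant_def)
  let ?u = "(stp n l f h ^^ k) g"
  have "(stp m l' f' h ^^ k) (\<lambda>x. g (restrict x {1..n})) (zero_state m) \<le> ?u (restrict (zero_state m) {1..n})"
    by (rule stp_iter_compare[OF assms(1,2) le g(1) h]) (use dom zero_state_in in blast)+
  also have "\<dots> = expect \<mu> (\<lambda>_. ?u (restrict (zero_state m) {1..n}))" by simp
  also have "\<dots> \<le> expect \<mu> ?u"
  proof (rule expect_mono[where d = c and c = "\<bar>?u (restrict (zero_state m) {1..n})\<bar>"])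
    fix x assume "x \<in> set_pmf \<mu>"
    then have x: "x \<in> states n" using sub by auto
    show "\<bar>?u x\<bar> \<le> c" by (intro a.stp_iter_bound h x g)
    have z: "restrict (zero_state m) {1..n} \<in> states n" by (rule restrict_states[OF le zero_state_in])
    show "?u (restrict (zero_state m) {1..n}) \<le> ?u x"
      using a.stp_iter_state_mono[OF h(1,2) g(1), of k] x z le by (simp add: state_mono_def)
  qed simp
  also have "\<dots> = expect \<mu> g" by (rule a.invariant_stp_iter[OF inv h(1,2) g(2)])
  finally show ?thesis .
qed

lemma cesaro_tight:
  assumes "monotone_system n l f B" "queue_system m l' f' B'" and le: "n \<le> m"
    and h: "0 \<le> h" "h * queue_system.R n l B \<le> 1" "h * queue_system.R m l' B' \<le> 1"
    and dom: "\<And>i. i \<in> {1..n} \<Longrightarrow> l' i \<le> l i"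
      "\<And>i x. i \<in> {1..n} \<Longrightarrow> x \<in> states m \<Longrightarrow> f i (restrict x {1..n}) \<le> f' i x"
    and inv: "invariant n l f \<mu>"
    and A: "\<And>k g c. (\<And>y. y \<in> states m \<Longrightarrow> \<bar>g y\<bar> \<le> c) \<Longrightarrow>
       expect (A k) g = (\<Sum>j<Suc k. (stp m l' f' h ^^ j) g (zero_state m)) / real (Suc k)"
    and "0 < \<epsilon>"
  shows "\<exists>F. finite F \<and> (\<forall>k. measure_pmf.prob (map_pmf (\<lambda>x. restrict x {1..n}) (A k)) (- F) \<le> \<epsilon>)"
proof (rule tight_of_dominated[OF _ _ \<open>0 < \<epsilon>\<close>])
  show "set_pmf \<mu> \<subseteq> states n" using inv by (simp add: invariant_def)
next
  fix k and g :: "(nat \<Rightarrow> nat) \<Rightarrow> real" assume g: "state_mono n g" "\<And>x. \<bar>g x\<bar> \<le> 1"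
  have "expect (map_pmf (\<lambda>x. restrict x {1..n}) (A k)) g = expect (A k) (\<lambda>x. g (restrict x {1..n}))"
    by simp
  also have "\<dots> = (\<Sum>j<Suc k. (stp m l' f' h ^^ j) (\<lambda>x. g (restrict x {1..n})) (zero_state m)) / real (Suc k)"
    by (rule A[where c = 1]) (rule g)
  also have "\<dots> \<le> (\<Sum>j<Suc k. expect \<mu> g) / real (Suc k)"
    by (intro divide_right_mono sum_mono invariant_dominates_iter[OF assms(1,2) le g(1) _ h dom inv, where c = 1])
      (auto simp: g)
  also have "\<dots> = expect \<mu> g" by simp
  finally show "expect (map_pmf (\<lambda>x. restrict x {1..n}) (A k)) g \<le> expect \<mu> g" .
qed

lemma map_restrict_self:
  assumes "set_pmf p \<subseteq> states n" shows "map_pmf (\<lambda>x. restrict x {1..n}) p = p"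
  using assms restrict_state_self by (intro map_pmf_idI) blast

context monotone_system
begin

text \<open>Ergodic theorem from the empty state. If a subsequence stayed away from the limit,
  tightness (domination by \<open>\<mu>\<close> itself) would give a further subsequence with an
  invariant limit, which by uniqueness is \<open>\<mu>\<close>.\<close>

lemma cesaro_invariant:
  assumes inv: "invariant n l f \<mu>" and h: "0 < h" "h * R \<le> 1"
    and g: "\<And>x. x \<in> states n \<Longrightarrow> \<bar>g x\<bar> \<le> c"
  shows "(\<lambda>k. (\<Sum>j<Suc k. (stp n l f h ^^ j) g (zero_state n)) / real (Suc k)) \<longlonglongrightarrow> expect \<mu> g"
proof (rule ccontr)
  have h0: "0 \<le> h" using h by simp
  obtain A where A: "\<And>k. set_pmf (A k) \<subseteq> states n"
    "\<And>k g c. (\<And>y. y \<in> states n \<Longrightarrow> \<bar>g y\<bar> \<le> c) \<Longrightarrow>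
       expect (A k) g = (\<Sum>j<Suc k. (stp n l f h ^^ j) g (zero_state n)) / real (Suc k)"
    by (rule stp_cesaro[OF h0 h(2) zero_state_in]) blast
  have tight: "\<exists>F. finite F \<and> (\<forall>k. measure_pmf.prob (A k) (- F) \<le> \<epsilon>)" if "0 < \<epsilon>" for \<epsilon>
  proof -
    have "\<exists>F. finite F \<and> (\<forall>k. measure_pmf.prob (map_pmf (\<lambda>x. restrict x {1..n}) (A k)) (- F) \<le> \<epsilon>)"
      by (rule cesaro_tight[OF monotone_system_axioms queue_system_axioms order_refl h0 h(2,2) order_refl _ inv _ that])
        (simp add: restrict_state_self[simplified], rule A(2))
    then show ?thesis unfolding map_restrict_self[OF A(1)] .
  qed
  assume "\<not> ?thesis"
  then obtain e r where e: "0 < e" and r: "strict_mono r"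
    and far: "\<And>k::nat. e \<le> \<bar>(\<Sum>j<Suc (r k). (stp n l f h ^^ j) g (zero_state n)) / real (Suc (r k)) - expect \<mu> g\<bar>"
    by (rule not_tendsto_subseq) blast
  have "\<exists>F. finite F \<and> (\<forall>k. measure_pmf.prob (A (r k)) (- F) \<le> \<epsilon>)" if "0 < \<epsilon>" for \<epsilon>
    using tight[OF that] by blast
  from tight_pmf_subsequence[OF countable_states A(1) this]
  obtain s \<nu> where s: "strict_mono s" "set_pmf \<nu> \<subseteq> states n"
    and conv: "\<And>g c. (\<And>x. x \<in> states n \<Longrightarrow> \<bar>g x\<bar> \<le> c) \<Longrightarrow> (\<lambda>k. expect (A (r (s k))) g) \<longlonglongrightarrow> expect \<nu> g"
    by blast
  have "invariant n l f \<nu>"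
  proof (rule limit_invariant[OF s(2) conv])
    fix g :: "(nat \<Rightarrow> nat) \<Rightarrow> real" assume g: "\<And>x. \<bar>g x\<bar> \<le> 1"
    have b: "\<bar>gen n l f g y\<bar> \<le> 2 * 1 * R" if "y \<in> states n" for y
      by (rule gen_bound[OF that]) (rule g)
    have "(\<lambda>k. expect (A k) (gen n l f g)) \<longlonglongrightarrow> 0"
      by (subst A(2)[OF b], assumption, rule cesaro_gen[OF h zero_state_in], rule g)
    from LIMSEQ_subseq_LIMSEQ[OF this strict_mono_o[OF r s(1)]]
    show "(\<lambda>k. expect (A (r (s k))) (gen n l f g)) \<longlonglongrightarrow> 0" by (simp add: o_def)
  qed
  then have "\<nu> = \<mu>" using inv by (rule invariant_unique)
  then have "(\<lambda>k. expect (A (r (s k))) g) \<longlonglongrightarrow> expect \<mu> g" using conv[OF g] by simp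
  then have "\<forall>\<^sub>F k in sequentially. \<bar>expect (A (r (s k))) g - expect \<mu> g\<bar> < e"
    using e by (auto simp: tendsto_iff dist_real_def)
  then obtain k where "\<bar>expect (A (r (s k))) g - expect \<mu> g\<bar> < e"
    by (auto simp: eventually_sequentially)
  then show False using far[of "s k"] A(2)[OF g] by simp
qed

end

lemma common_step:
  assumes "queue_system n l f B" "queue_system m l' f' B'"
  obtains h where "0 < h" "h * queue_system.R n l B \<le> 1" "h * queue_system.R m l' B' \<le> 1"
proof -
  interpret a: queue_system n l f B by fact
  interpret b: queue_system m l' f' B' by fact
  show ?thesis
    using a.R_nonneg b.R_nonneg by (intro that[of "1 / (a.R + b.R + 1)"]) (auto simp: divide_simps)
qed

text \<open>The time averages of the second system converge to its expectation under
  \<open>\<mu>'\<close>, and are bounded by that under \<open>\<mu>\<close> throughout.\<close>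

lemma invariant_mono:
  assumes "monotone_system n l f B" "monotone_system m l' f' B'" and le: "n \<le> m"
    and g: "state_mono n g" "\<And>x. x \<in> states n \<Longrightarrow> \<bar>g x\<bar> \<le> c"
    and dom: "\<And>i. i \<in> {1..n} \<Longrightarrow> l' i \<le> l i"
      "\<And>i x. i \<in> {1..n} \<Longrightarrow> x \<in> states m \<Longrightarrow> f i (restrict x {1..n}) \<le> f' i x"
    and inv: "invariant n l f \<mu>" "invariant m l' f' \<mu>'"
  shows "expect \<mu>' (\<lambda>x. g (restrict x {1..n})) \<le> expect \<mu> g"
proof -
  interpret a: monotone_system n l f B by fact
  interpret b: monotone_system m l' f' B' by fact
  obtain h where h: "0 < h" "h * a.R \<le> 1" "h * b.R \<le> 1"
    by (rule common_step[OF a.queue_system_axioms b.queue_system_axioms])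
  show ?thesis
  proof (rule LIMSEQ_le_const2)
    show "(\<lambda>k. (\<Sum>j<Suc k. (stp m l' f' h ^^ j) (\<lambda>x. g (restrict x {1..n})) (zero_state m)) / real (Suc k))
        \<longlonglongrightarrow> expect \<mu>' (\<lambda>x. g (restrict x {1..n}))"
      by (rule b.cesaro_invariant[OF inv(2) h(1,3), where c = c]) (rule g(2), rule restrict_states[OF le])
    have "(\<Sum>j<Suc k. (stp m l' f' h ^^ j) (\<lambda>x. g (restrict x {1..n})) (zero_state m)) / real (Suc k) \<le> 
        (\<Sum>j<Suc k. expect \<mu> g) / real (Suc k)" for k
      using h by (intro divide_right_mono sum_mono
        invariant_dominates_iter[OF assms(1) b.queue_system_axioms le g _ _ _ dom inv(1)]) auto
    then show "\<exists>N. \<forall>k\<ge>N. (\<Sum>j<Suc k. (stp m l' f' h ^^ j) (\<lambda>x. g (restrict x {1..n})) (zero_state m)) / real (Suc k)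
        \<le> expect \<mu> g" by auto
  qed
qed

text \<open>Tightness of the time averages of the second system is inherited from the dominating
  monotone one; a limit point is invariant.\<close>

lemma invariant_exists_dominated:
  assumes "monotone_system n l f B" "queue_system n l' f' B'"
    and dom: "\<And>i. i \<in> {1..n} \<Longrightarrow> l' i \<le> l i"
      "\<And>i x. i \<in> {1..n} \<Longrightarrow> x \<in> states n \<Longrightarrow> f i x \<le> f' i x"
    and inv: "invariant n l f \<mu>"
  obtains \<mu>' where "invariant n l' f' \<mu>'"
proof -
  interpret a: monotone_system n l f B by fact
  interpret b: queue_system n l' f' B' by fact
  obtain h where h: "0 < h" "h * a.R \<le> 1" "h * b.R \<le> 1"
    by (rule common_step[OF a.queue_system_axioms b.queue_system_axioms])
  have h0: "0 \<le> h" using h by simp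
  obtain A where A: "\<And>k. set_pmf (A k) \<subseteq> states n"
    "\<And>k g c. (\<And>y. y \<in> states n \<Longrightarrow> \<bar>g y\<bar> \<le> c) \<Longrightarrow>
       expect (A k) g = (\<Sum>j<Suc k. (stp n l' f' h ^^ j) g (zero_state n)) / real (Suc k)"
    by (rule b.stp_cesaro[OF h0 h(3) zero_state_in]) blast
  have tight: "\<exists>F. finite F \<and> (\<forall>k. measure_pmf.prob (A k) (- F) \<le> \<epsilon>)" if "0 < \<epsilon>" for \<epsilon>
  proof -
    have "\<exists>F. finite F \<and> (\<forall>k. measure_pmf.prob (map_pmf (\<lambda>x. restrict x {1..n}) (A k)) (- F) \<le> \<epsilon>)"
      by (rule cesaro_tight[OF assms(1,2) order_refl h0 h(2,3) dom(1) _ inv _ that])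
        (assumption, simp add: restrict_state_self[simplified] dom(2)[simplified], rule A(2))
    then show ?thesis unfolding map_restrict_self[OF A(1)] .
  qed
  from tight_pmf_subsequence[OF countable_states A(1) this]
  obtain s \<nu> where s: "strict_mono s" "set_pmf \<nu> \<subseteq> states n"
    and conv: "\<And>g c. (\<And>x. x \<in> states n \<Longrightarrow> \<bar>g x\<bar> \<le> c) \<Longrightarrow> (\<lambda>k. expect (A (s k)) g) \<longlonglongrightarrow> expect \<nu> g"
    by blast
  have "invariant n l' f' \<nu>"
  proof (rule b.limit_invariant[OF s(2) conv])
    fix g :: "(nat \<Rightarrow> nat) \<Rightarrow> real" assume g: "\<And>x. \<bar>g x\<bar> \<le> 1"
    have b: "\<bar>gen n l' f' g y\<bar> \<le> 2 * 1 * b.R" if "y \<in> states n" for y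
      by (rule b.gen_bound[OF that]) (rule g)
    have "(\<lambda>k. expect (A k) (gen n l' f' g)) \<longlonglongrightarrow> 0"
      by (subst A(2)[OF b], assumption, rule b.cesaro_gen[OF h(1,3) zero_state_in], rule g)
    from LIMSEQ_subseq_LIMSEQ[OF this s(1)]
    show "(\<lambda>k. expect (A (s k)) (gen n l' f' g)) \<longlonglongrightarrow> 0" by (simp add: o_def)
  qed
  then show ?thesis by (rule that)
qed

section \<open>Limits in which a queue, or part of the mass, escapes to infinity\<close>

lemma expect_diff_vanish:
  fixes v w :: "'a \<Rightarrow> real" and q :: "'a \<Rightarrow> nat"
  assumes S: "\<And>k. set_pmf (p k) \<subseteq> S"
    and bd: "\<And>x. x \<in> S \<Longrightarrow> \<bar>v x\<bar> \<le> c" "\<And>x. x \<in> S \<Longrightarrow> \<bar>w x\<bar> \<le> c"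
    and close: "\<And>\<delta>. 0 < \<delta> \<Longrightarrow> \<exists>r. \<forall>x\<in>S. r < q x \<longrightarrow> \<bar>v x - w x\<bar> \<le> \<delta>"
    and prob: "\<And>r. (\<lambda>k. measure_pmf.prob (p k) {x. q x \<le> r}) \<longlonglongrightarrow> 0"
  shows "(\<lambda>k. expect (p k) v - expect (p k) w) \<longlonglongrightarrow> 0"
proof (rule LIMSEQ_I)
  fix e :: real assume e: "0 < e"
  have c: "0 \<le> c" using S[of 0] bd(1) set_pmf_not_empty[of "p 0"] by force
  \<comment> \<open>Beyond \<open>r\<close> the integrand is at most \<open>e / 3\<close>; up to
    \<open>r\<close> the crude bound \<open>2 * c\<close> meets a vanishing probability. The
    \<open>+ 1\<close> in the denominator below admits \<open>c = 0\<close>.\<close>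
  obtain r where r: "\<And>x. x \<in> S \<Longrightarrow> r < q x \<Longrightarrow> \<bar>v x - w x\<bar> \<le> e / 3"
    using close[of "e / 3"] e by auto
  have "\<forall>\<^sub>F k in sequentially. measure_pmf.prob (p k) {x. q x \<le> r} < e / (3 * (2 * c + 1))"
    by (intro order_tendstoD(2)[OF prob]) (use e c in auto)
  then obtain k0 where k0: "\<And>k. k \<ge> k0 \<Longrightarrow> measure_pmf.prob (p k) {x. q x \<le> r} < e / (3 * (2 * c + 1))"
    by (auto simp: eventually_sequentially)
  show "\<exists>no. \<forall>k\<ge>no. norm (expect (p k) v - expect (p k) w - 0) < e"
  proof (intro exI allI impI)
    fix k assume k: "k0 \<le> k"
    have i: "integrable (p k) v" "integrable (p k) w"
      using S[of k] bd by (auto intro!: integrable_bdd[where c = c])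
    have i1: "integrable (p k) (\<lambda>x. indicator {x. q x \<le> r} x :: real)"
      by (rule integrable_bdd[where c = 1]) (auto simp: indicator_def)
    have "\<bar>expect (p k) v - expect (p k) w\<bar> = \<bar>expect (p k) (\<lambda>x. v x - w x)\<bar>"
      using i by simp
    also have "\<dots> \<le> expect (p k) (\<lambda>x. \<bar>v x - w x\<bar>)" by (rule integral_abs_bound)
    also have "\<dots> \<le> expect (p k) (\<lambda>x. e / 3 + 2 * c * indicator {x. q x \<le> r} x)"
    proof (intro integral_mono_AE integrable_abs Bochner_Integration.integrable_diff
        Bochner_Integration.integrable_add Bochner_Integration.integrable_mult_right i i1 measure_pmf.integrable_const)
      show "AE x in p k. \<bar>v x - w x\<bar> \<le> e / 3 + 2 * c * indicator {x. q x \<le> r} x"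
        unfolding AE_measure_pmf_iff
      proof
        fix x assume "x \<in> set_pmf (p k)"
        then have x: "x \<in> S" using S by auto
        show "\<bar>v x - w x\<bar> \<le> e / 3 + 2 * c * indicator {x. q x \<le> r} x"
          using r[OF x] bd[OF x] e by (cases "q x \<le> r") auto
      qed
    qed
    also have "\<dots> = e / 3 + 2 * c * measure_pmf.prob (p k) {x. q x \<le> r}"
      using i1 by simp
    also have "\<dots> \<le> e / 3 + 2 * c * (e / (3 * (2 * c + 1)))"
      using k0[OF k] c by (intro add_left_mono mult_left_mono) auto
    also have "\<dots> < e" using e c mult_nonneg_nonneg[of c "e * 6"] by (simp add: field_simps add_pos_nonneg)
    finally show "norm (expect (p k) v - expect (p k) w - 0) < e" by simp
  qed
qed

lemma nbrs_sym: "y \<in> nbrs n x \<Longrightarrow> x \<in> nbrs n y"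
proof -
  assume "y \<in> nbrs n x"
  then consider "y = x" | i where "i \<in> {1..n}" "y = x(i := x i + 1)" | i where "i \<in> {1..n}" "y = x(i := x i - 1)"
    by (auto simp: nbrs_def)
  then show ?thesis
  proof cases
    case 2
    then have "x = y(i := y i - 1)" by auto
    then show ?thesis using 2(1) by (auto simp: nbrs_def)
  next
    case 3
    then have "x = y \<or> x = y(i := y i + 1)" by (cases "x i = 0") auto
    then show ?thesis using 3(1) by (auto simp: nbrs_def)
  qed (simp add: nbrs_def)
qed

lemma gen_local: "x \<in> states n \<Longrightarrow> y \<notin> nbrs n x \<Longrightarrow> gen n l f (indicator {y}) x = 0"
  using gen_cong_nbrs[of n x "indicator {y}" "\<lambda>_. 0" l f] gen_const[of n l f 0 x]
  by (auto simp: indicator_def)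

lemma nbrs_le: "y \<in> nbrs n x \<Longrightarrow> y j \<le> x j + 1"
  by (auto simp: nbrs_def)

lemma nbrs_ge: "y \<in> nbrs n x \<Longrightarrow> x j \<le> y j + 1"
  by (auto simp: nbrs_def)

context queue_system
begin

text \<open>The cut-offs \<open>gr r\<close> to boxes are finite combinations of point indicators.
  The generator is local, so for large \<open>r\<close> it takes the same value on
  \<open>gr r\<close> and on \<open>g\<close> at any fixed state, and dominated convergence
  applies.\<close>

lemma invariant_from_points:
  assumes sub: "set_pmf \<nu> \<subseteq> states n"
    and pt: "\<And>y. y \<in> states n \<Longrightarrow> expect \<nu> (gen n l f (indicator {y})) = 0"
  shows "invariant n l f \<nu>"
  unfolding invariant_def
proof (intro conjI sub allI impI)
  fix g :: "(nat \<Rightarrow> nat) \<Rightarrow> real" assume g: "\<forall>x. \<bar>g x\<bar> \<le> 1"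
  define b where "b r = {x \<in> states n. \<forall>i\<in>{1..n}. x i \<le> r}" for r
  define gr where "gr r x = (\<Sum>y\<in>b r. g y * indicator {y} x)" for r x
  have fin: "finite (b r)" for r unfolding b_def by (rule finite_box)
  have gr_eq: "gr r x = (if x \<in> b r then g x else 0)" for r x
  proof -
    have "gr r x = (\<Sum>y\<in>b r. if y = x then g y else 0)"
      unfolding gr_def by (intro sum.cong) (auto simp: indicator_def)
    then show ?thesis by (simp add: fin)
  qed
  then have gr1: "\<bar>gr r x\<bar> \<le> 1" for r x using g by simp
  have zero: "expect \<nu> (gen n l f (gr r)) = 0" for r
  proof -
    have "integrable \<nu> (gen n l f (indicator {y}))" for y
      using gen_bound[where g = "indicator {y}" and c = 1] sub
      by (intro integrable_bdd[where c = "2 * 1 * R"]) (auto simp: indicator_def)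
    moreover have "gen n l f (gr r) = (\<lambda>x. \<Sum>y\<in>b r. g y * gen n l f (indicator {y}) x)"
      unfolding gr_def by (rule ext) (simp only: gen_sum gen_cmult)
    ultimately have "expect \<nu> (gen n l f (gr r)) = (\<Sum>y\<in>b r. g y * expect \<nu> (gen n l f (indicator {y})))"
      by simp
    then show ?thesis using pt by (simp add: b_def)
  qed
  have "(\<lambda>r. expect \<nu> (gen n l f (gr r))) \<longlonglongrightarrow> expect \<nu> (gen n l f g)"
  proof (rule integral_dominated_convergence[where w = "\<lambda>_. 2 * 1 * R"])
    show "AE x in \<nu>. (\<lambda>r. gen n l f (gr r) x) \<longlonglongrightarrow> gen n l f g x"
      unfolding AE_measure_pmf_iff
    proof
      fix x assume "x \<in> set_pmf \<nu>"
      then have x: "x \<in> states n" using sub by auto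
      define r0 where "r0 = (\<Sum>i\<in>{1..n}. x i) + 1"
      have "gen n l f (gr r) x = gen n l f g x" if "r \<ge> r0" for r
      proof (rule gen_cong_nbrs)
        fix y assume y: "y \<in> nbrs n x"
        have "y i \<le> r" if i: "i \<in> {1..n}" for i
        proof -
          have "x i \<le> (\<Sum>i\<in>{1..n}. x i)" using i by (intro member_le_sum) auto
          then show ?thesis using nbrs_le[OF y, of i] \<open>r \<ge> r0\<close> by (simp add: r0_def)
        qed
        then have "y \<in> b r" using y nbrs_states[OF x] by (auto simp: b_def)
        then show "gr r y = g y" by (simp add: gr_eq)
      qed
      then have "eventually (\<lambda>r. gen n l f (gr r) x = gen n l f g x) sequentially"
        unfolding eventually_sequentially by blast
      then show "(\<lambda>r. gen n l f (gr r) x) \<longlonglongrightarrow> gen n l f g x" by (rule tendsto_eventually)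
    qed
    show "AE x in \<nu>. norm (gen n l f (gr r) x) \<le> 2 * 1 * R" for r
      unfolding AE_measure_pmf_iff real_norm_def using gen_bound[where g = "gr r", OF _ gr1] sub by blast
  qed auto
  then show "expect \<nu> (gen n l f g) = 0" by (simp add: zero LIMSEQ_const_iff)
qed

text \<open>Without tightness the limit \<open>a\<close> may have mass below 1. The generator of a
  point indicator has finite support, as the neighbour relation is symmetric, so pointwise
  convergence carries its equation over to \<open>a\<close>, and to the normalization of
  \<open>a\<close> if any mass is left.\<close>

lemma invariant_of_vague_limit:
  assumes sub: "\<And>k. set_pmf (p k) \<subseteq> states n"
    and lim: "\<And>x. (\<lambda>k. pmf (p k) x) \<longlonglongrightarrow> a x" and pos: "0 < a x0"
    and gen0: "\<And>g :: _ \<Rightarrow> real. (\<And>x. \<bar>g x\<bar> \<le> 1) \<Longrightarrow> (\<lambda>k. expect (p k) (gen n l f g)) \<longlonglongrightarrow> 0"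
  obtains \<nu> where "invariant n l f \<nu>"
proof -
  have a0: "0 \<le> a x" for x by (rule LIMSEQ_le_const[OF lim]) auto
  have a1: "sum a F \<le> 1" if "finite F" for F
  proof (rule LIMSEQ_le_const2)
    show "(\<lambda>k. \<Sum>x\<in>F. pmf (p k) x) \<longlonglongrightarrow> sum a F" by (intro tendsto_sum lim)
  qed (auto simp: that measure_pmf.prob_le_1 simp flip: measure_measure_pmf_finite)
  obtain \<nu> A where A: "0 < A" "A \<le> 1" and \<nu>: "\<And>x. a x = A * pmf \<nu> x"
    using pmf_from_weights[of a, OF a0 a1 pos] by blast
  have sub\<nu>: "set_pmf \<nu> \<subseteq> states n"
  proof
    fix x assume "x \<in> set_pmf \<nu>"
    then have "a x \<noteq> 0" using A by (simp add: \<nu> set_pmf_iff)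
    moreover have "a x = 0" if "x \<notin> states n"
    proof -
      have "pmf (p k) x = 0" for k using that sub by (meson set_pmf_iff subsetD)
      with lim[of x] show ?thesis by (simp add: LIMSEQ_const_iff)
    qed
    ultimately show "x \<in> states n" by blast
  qed
  have "invariant n l f \<nu>"
  proof (rule invariant_from_points[OF sub\<nu>])
    fix y assume "y \<in> states n"
    let ?G = "gen n l f (indicator {y})"
    have fin: "expect q ?G = (\<Sum>x\<in>nbrs n y. ?G x * pmf q x)" if "set_pmf q \<subseteq> states n" for q
      using that gen_local nbrs_sym by (intro integral_measure_pmf_real finite_nbrs) blast
    have "(\<lambda>k. expect (p k) ?G) \<longlonglongrightarrow> (\<Sum>x\<in>nbrs n y. ?G x * a x)"
      unfolding fin[OF sub] by (intro tendsto_intros lim)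
    moreover have "(\<lambda>k. expect (p k) ?G) \<longlonglongrightarrow> 0"
      by (rule gen0) (auto simp: indicator_def)
    ultimately have "(\<Sum>x\<in>nbrs n y. ?G x * a x) = 0" by (rule LIMSEQ_unique)
    also have "(\<Sum>x\<in>nbrs n y. ?G x * a x) = A * expect \<nu> ?G"
      unfolding fin[OF sub\<nu>] \<nu> sum_distrib_left by (simp add: algebra_simps)
    finally show "expect \<nu> ?G = 0" using A by simp
  qed
  then show ?thesis by (rule that)
qed

end

text \<open>Arrival terms agree exactly, and moves of queues beyond \<open>n\<close> leave the
  restriction unchanged; only the service rates of the first \<open>n\<close> queues
  contribute.\<close>

lemma gen_restrict_diff:
  assumes le: "n \<le> m" and x: "x \<in> states m" and c: "\<And>y. y \<in> states n \<Longrightarrow> \<bar>g y\<bar> \<le> c"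
    and d: "\<And>i. i \<in> {1..n} \<Longrightarrow> \<bar>f' i x - f i (restrict x {1..n})\<bar> \<le> d"
  shows "\<bar>gen m l f' (\<lambda>x. g (restrict x {1..n})) x - gen n l f g (restrict x {1..n})\<bar> \<le> 2 * real n * c * d"
proof -
  let ?x = "restrict x {1..n}"
  have x': "?x \<in> states n" by (rule restrict_states[OF le x])
  have upd: "restrict (x(i := v)) {1..n} = (if i \<in> {1..n} then ?x(i := v) else ?x)" for i v
    by (auto simp: fun_eq_iff restrict_def)
  have c0: "0 \<le> c" using c[OF x'] by linarith
  have "gen m l f' (\<lambda>x. g (restrict x {1..n})) x = (\<Sum>i\<in>{1..n}. l i * (g (restrict (x(i := x i + 1)) {1..n}) - g ?x) +
     (if 0 < x i then f' i x * (g (restrict (x(i := x i - 1)) {1..n}) - g ?x) else 0))"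
    unfolding gen_def using le by (intro sum.mono_neutral_right) (auto simp: upd)
  then have "gen m l f' (\<lambda>x. g (restrict x {1..n})) x - gen n l f g ?x =
    (\<Sum>i\<in>{1..n}. (l i * (g (restrict (x(i := x i + 1)) {1..n}) - g ?x) +
       (if 0 < x i then f' i x * (g (restrict (x(i := x i - 1)) {1..n}) - g ?x) else 0)) -
      (l i * (g (?x(i := ?x i + 1)) - g ?x) +
       (if 0 < ?x i then f i ?x * (g (?x(i := ?x i - 1)) - g ?x) else 0)))"
    unfolding gen_def[of n l f g ?x] sum_subtractf by simp
  also have "\<dots> = (\<Sum>i\<in>{1..n}. if 0 < x i then (f' i x - f i ?x) * (g (?x(i := x i - 1)) - g ?x) else 0)"
  proof (rule sum.cong)
    fix i assume "i \<in> {1..n}"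
    then show "(l i * (g (restrict (x(i := x i + 1)) {1..n}) - g ?x) +
       (if 0 < x i then f' i x * (g (restrict (x(i := x i - 1)) {1..n}) - g ?x) else 0)) -
      (l i * (g (?x(i := ?x i + 1)) - g ?x) +
       (if 0 < ?x i then f i ?x * (g (?x(i := ?x i - 1)) - g ?x) else 0)) =
      (if 0 < x i then (f' i x - f i ?x) * (g (?x(i := x i - 1)) - g ?x) else 0)"
      unfolding upd by (cases "x i = 0") (simp_all add: left_diff_distrib)
  qed simp
  also have "\<bar>\<dots>\<bar> \<le> (\<Sum>i\<in>{1..n}. d * (2 * c))"
  proof (rule order_trans[OF sum_abs], rule sum_mono)
    fix i assume i: "i \<in> {1..n}"
    have "0 \<le> d" using d[OF i] by linarith
    moreover have "\<bar>g (?x(i := x i - 1)) - g ?x\<bar> \<le> 2 * c"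
      using c[OF state_upd[OF x' i, of "x i - 1"]] c[OF x'] by linarith
    ultimately have "\<bar>(f' i x - f i ?x) * (g (?x(i := x i - 1)) - g ?x)\<bar> \<le> d * (2 * c)"
      unfolding abs_mult using d[OF i] by (intro mult_mono) auto
    then show "\<bar>if 0 < x i then (f' i x - f i ?x) * (g (?x(i := x i - 1)) - g ?x) else 0\<bar> \<le> d * (2 * c)"
      using \<open>0 \<le> d\<close> c0 by auto
  qed
  finally show ?thesis by (simp add: algebra_simps)
qed

section \<open>Allocations with uniform limits\<close>

text \<open>All queues beyond \<open>n\<close> are put at the same level \<open>m\<close>; letting
  \<open>m\<close> grow realizes the partial limits along a sequence.\<close>

definition extend_state :: "nat \<Rightarrow> nat \<Rightarrow> nat \<Rightarrow> (nat \<Rightarrow> nat) \<Rightarrow> nat \<Rightarrow> nat" where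
  "extend_state N n m y = (\<lambda>j\<in>{1..N}. if j \<le> n then y j else m)"

lemma extend_state_in: "extend_state N n m y \<in> states N"
  by (auto simp: extend_state_def states_def)

lemma restrict_extend_state: "n \<le> N \<Longrightarrow> y \<in> states n \<Longrightarrow> restrict (extend_state N n m y) {1..n} = y"
  by (rule states_eqI) (auto simp: extend_state_def states_def)

text \<open>Here \<open>\<psi> n i\<close> is the uniform limit of \<open>\<phi> i\<close> as queues
  \<open>n + 1\<close> to \<open>N\<close> grow, kept abstract so that its bounds and monotonicity
  are derived from convergence alone. It is also required for \<open>i > n\<close>, where it is the
  limiting service rate of a queue that itself grows.\<close>

locale coupled_queues =
  fixes N :: nat and \<phi> :: "nat \<Rightarrow> (nat \<Rightarrow> nat) \<Rightarrow> real" and B :: real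
    and \<psi> :: "nat \<Rightarrow> nat \<Rightarrow> (nat \<Rightarrow> nat) \<Rightarrow> real"
  assumes phi_nonneg: "\<And>i x. i \<in> {1..N} \<Longrightarrow> x \<in> states N \<Longrightarrow> 0 \<le> \<phi> i x"
    and phi_le: "\<And>i x. i \<in> {1..N} \<Longrightarrow> x \<in> states N \<Longrightarrow> \<phi> i x \<le> B"
    and B_ge0: "0 \<le> B"
    and phi_anti: "partially_decreasing N \<phi>"
    and phi_close: "\<And>n i \<delta>. n \<le> N \<Longrightarrow> i \<in> {1..N} \<Longrightarrow> 0 < \<delta> \<Longrightarrow>
      \<exists>r. \<forall>x\<in>states N. (\<forall>j\<in>{n+1..N}. r < x j) \<longrightarrow> \<bar>\<phi> i x - \<psi> n i (restrict x {1..n})\<bar> \<le> \<delta>"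
begin

lemma phi_close_uniform:
  assumes "n \<le> N" "0 < \<delta>"
  obtains r where "\<And>x i. x \<in> states N \<Longrightarrow> (\<And>j. j \<in> {n+1..N} \<Longrightarrow> r < x j) \<Longrightarrow> i \<in> {1..N} \<Longrightarrow>
    \<bar>\<phi> i x - \<psi> n i (restrict x {1..n})\<bar> \<le> \<delta>"
proof -
  have "\<forall>i. \<exists>r. i \<in> {1..N} \<longrightarrow> (\<forall>x\<in>states N. (\<forall>j\<in>{n+1..N}. r < x j) \<longrightarrow> \<bar>\<phi> i x - \<psi> n i (restrict x {1..n})\<bar> \<le> \<delta>)"
    using phi_close[OF assms(1) _ assms(2)] by blast
  then obtain \<rho> where \<rho>: "\<And>i x. i \<in> {1..N} \<Longrightarrow> x \<in> states N \<Longrightarrow> (\<forall>j\<in>{n+1..N}. \<rho> i < x j) \<Longrightarrow>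
      \<bar>\<phi> i x - \<psi> n i (restrict x {1..n})\<bar> \<le> \<delta>" by metis
  show ?thesis
  proof (rule that[of "\<Sum>i\<in>{1..N}. \<rho> i"])
    fix x i assume x: "x \<in> states N" "\<And>j. j \<in> {n+1..N} \<Longrightarrow> (\<Sum>i\<in>{1..N}. \<rho> i) < x j" and i: "i \<in> {1..N}"
    have "\<rho> i \<le> (\<Sum>i\<in>{1..N}. \<rho> i)" using i by (intro member_le_sum) auto
    then show "\<bar>\<phi> i x - \<psi> n i (restrict x {1..n})\<bar> \<le> \<delta>"
      using x(2) by (intro \<rho> i x(1) ballI) (rule le_less_trans, blast+)
  qed
qed

lemma psi_lim:
  assumes "n \<le> N" "i \<in> {1..N}" "y \<in> states n"
  shows "(\<lambda>m. \<phi> i (extend_state N n m y)) \<longlonglongrightarrow> \<psi> n i y"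
proof (rule LIMSEQ_I)
  fix e :: real assume "0 < e"
  then have e2: "0 < e / 2" by simp
  obtain r where r: "\<And>x i. x \<in> states N \<Longrightarrow> (\<And>j. j \<in> {n+1..N} \<Longrightarrow> r < x j) \<Longrightarrow> i \<in> {1..N} \<Longrightarrow>
    \<bar>\<phi> i x - \<psi> n i (restrict x {1..n})\<bar> \<le> e / 2"
    by (rule phi_close_uniform[OF assms(1) e2]) blast
  show "\<exists>no. \<forall>m\<ge>no. norm (\<phi> i (extend_state N n m y) - \<psi> n i y) < e"
  proof (intro exI allI impI)
    fix m assume "r + 1 \<le> m"
    then have "\<bar>\<phi> i (extend_state N n m y) - \<psi> n i (restrict (extend_state N n m y) {1..n})\<bar> \<le> e / 2"
      by (intro r extend_state_in assms) (auto simp: extend_state_def)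
    then show "norm (\<phi> i (extend_state N n m y) - \<psi> n i y) < e"
      using \<open>0 < e\<close> assms by (simp add: restrict_extend_state[simplified])
  qed
qed

lemma psi_nonneg: "n \<le> N \<Longrightarrow> i \<in> {1..N} \<Longrightarrow> y \<in> states n \<Longrightarrow> 0 \<le> \<psi> n i y"
  by (rule LIMSEQ_le_const[OF psi_lim], assumption+, intro exI allI impI phi_nonneg extend_state_in)

lemma psi_le: "n \<le> N \<Longrightarrow> i \<in> {1..N} \<Longrightarrow> y \<in> states n \<Longrightarrow> \<psi> n i y \<le> B"
  by (rule LIMSEQ_le_const2[OF psi_lim], assumption+, intro exI allI impI phi_le extend_state_in)

lemma phi_antiD:
  "i \<in> {1..N} \<Longrightarrow> x \<in> states N \<Longrightarrow> y \<in> states N \<Longrightarrow> (\<And>j. j \<in> {1..N} \<Longrightarrow> x j \<le> y j) \<Longrightarrow> x i = y i \<Longrightarrow> \<phi> i y \<le> \<phi> i x"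
  using phi_anti by (auto simp: partially_decreasing_def)

text \<open>The equality \<open>x i = y i\<close> is asked for only if \<open>i \<le> n\<close>. A
  queue \<open>i > n\<close> is itself sent to infinity, so its limiting rate decreases in each of
  the first \<open>n\<close> coordinates.\<close>

lemma psi_anti:
  assumes "n \<le> N" "i \<in> {1..N}" "x \<in> states n" "y \<in> states n" "\<And>j. j \<in> {1..n} \<Longrightarrow> x j \<le> y j"
    "i \<in> {1..n} \<Longrightarrow> x i = y i"
  shows "\<psi> n i y \<le> \<psi> n i x"
proof (rule LIMSEQ_le[OF psi_lim psi_lim])
  show "\<exists>N'. \<forall>m\<ge>N'. \<phi> i (extend_state N n m y) \<le> \<phi> i (extend_state N n m x)"
    using assms by (intro exI allI impI phi_antiD extend_state_in) (auto simp: extend_state_def)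
qed (use assms in auto)

text \<open>Sending queues \<open>n + 1\<close> to \<open>m\<close> to infinity as well can only
  take service from queue \<open>i\<close>, which is kept. Hence the first \<open>n\<close> queues
  of a larger system are dominated by the system of \<open>n\<close> queues.\<close>

lemma psi_restrict_le:
  assumes "n \<le> m" "m \<le> N" "i \<in> {1..n}" "x \<in> states m"
  shows "\<psi> n i (restrict x {1..n}) \<le> \<psi> m i x"
proof (rule LIMSEQ_le[OF psi_lim psi_lim])
  \<comment> \<open>The two extended states can differ only in the coordinates \<open>n + 1\<close>
    to \<open>m\<close>, and there \<open>M\<close> is at least as large as
    \<open>x\<close>.\<close>
  have "\<phi> i (extend_state N n M (restrict x {1..n})) \<le> \<phi> i (extend_state N m M x)"
    if M: "M \<ge> (\<Sum>j\<in>{1..m}. x j)" for M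
  proof (intro phi_antiD extend_state_in)
    fix j assume j: "j \<in> {1..N}"
    have "x j \<le> M" if "j \<le> m"
      using j that M by (intro order_trans[OF member_le_sum[of j "{1..m}" x]]) auto
    then show "extend_state N m M x j \<le> extend_state N n M (restrict x {1..n}) j"
      using j assms by (auto simp: extend_state_def)
  qed (use assms in \<open>auto simp: extend_state_def\<close>)
  then show "\<exists>N'. \<forall>M\<ge>N'. \<phi> i (extend_state N n M (restrict x {1..n})) \<le> \<phi> i (extend_state N m M x)" by blast
qed (use assms restrict_states[OF assms(1,4)] in auto)

lemma psi_N: 
  assumes "i \<in> {1..N}" "x \<in> states N" shows "\<psi> N i x = \<phi> i x"
proof -
  have "\<bar>\<phi> i x - \<psi> N i x\<bar> \<le> \<delta>" if d: "0 < \<delta>" for \<delta>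
  proof -
    obtain r where r: "\<And>x i. x \<in> states N \<Longrightarrow> (\<And>j. j \<in> {N+1..N} \<Longrightarrow> r < x j) \<Longrightarrow> i \<in> {1..N} \<Longrightarrow>
      \<bar>\<phi> i x - \<psi> N i (restrict x {1..N})\<bar> \<le> \<delta>"
      by (rule phi_close_uniform[OF order_refl d]) blast
    have "\<bar>\<phi> i x - \<psi> N i (restrict x {1..N})\<bar> \<le> \<delta>" by (rule r[OF assms(2) _ assms(1)]) simp
    then show ?thesis by (simp only: restrict_state_self[OF assms(2)])
  qed
  then have "\<bar>\<phi> i x - \<psi> N i x\<bar> \<le> 0" using field_le_epsilon[of "\<bar>\<phi> i x - \<psi> N i x\<bar>" 0] by simp
  then show ?thesis by simp
qed

text \<open>The queues beyond \<open>Suc n\<close> go to infinity on their own, so of the threshold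
  \<open>r\<close> for all queues beyond \<open>n\<close> only the condition on queue
  \<open>Suc n\<close> survives.\<close>

lemma psi_close:
  assumes "n < N" "0 < \<delta>"
  obtains r where "\<And>x i. x \<in> states (Suc n) \<Longrightarrow> r < x (Suc n) \<Longrightarrow> i \<in> {1..N} \<Longrightarrow>
    \<bar>\<psi> (Suc n) i x - \<psi> n i (restrict x {1..n})\<bar> \<le> \<delta>"
proof -
  obtain r where r: "\<And>x i. x \<in> states N \<Longrightarrow> (\<And>j. j \<in> {n+1..N} \<Longrightarrow> r < x j) \<Longrightarrow> i \<in> {1..N} \<Longrightarrow>
    \<bar>\<phi> i x - \<psi> n i (restrict x {1..n})\<bar> \<le> \<delta>"
    using phi_close_uniform[of n \<delta>] assms by auto
  show ?thesis
  proof (rule that)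
    fix x i assume x: "x \<in> states (Suc n)" "r < x (Suc n)" and i: "i \<in> {1..N}"
    have "(\<lambda>m. \<bar>\<phi> i (extend_state N (Suc n) m x) - \<psi> n i (restrict x {1..n})\<bar>) \<longlonglongrightarrow>
        \<bar>\<psi> (Suc n) i x - \<psi> n i (restrict x {1..n})\<bar>"
      using assms i x by (intro tendsto_intros psi_lim) auto
    then show "\<bar>\<psi> (Suc n) i x - \<psi> n i (restrict x {1..n})\<bar> \<le> \<delta>"
    proof (rule LIMSEQ_le_const2, intro exI allI impI)
      fix m assume m: "Suc r \<le> m"
      have eq: "restrict (extend_state N (Suc n) m x) {1..n} = restrict x {1..n}"
        using assms by (auto simp: extend_state_def restrict_def fun_eq_iff)
      have "r < extend_state N (Suc n) m x j" if "j \<in> {n+1..N}" for j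
        using that m x assms by (cases "j = Suc n") (auto simp: extend_state_def)
      from r[OF extend_state_in this i]
      show "\<bar>\<phi> i (extend_state N (Suc n) m x) - \<psi> n i (restrict x {1..n})\<bar> \<le> \<delta>" unfolding eq .
    qed
  qed
qed

lemma monotone_psi:
  assumes "n \<le> N" "\<And>i. i \<in> {1..n} \<Longrightarrow> 0 < l i"
  shows "monotone_system n l (\<psi> n) B"
proof (unfold_locales, goal_cases)
  case (5 i x y)
  then show ?case using assms(1) by (intro psi_anti) auto
qed (use assms psi_nonneg psi_le B_ge0 in auto)

end

context coupled_queues
begin

section \<open>Adding one queue\<close>

text \<open>Limits of the averages are taken in two senses: weakly for the first \<open>n\<close>
  queues, where domination by \<open>\<mu>\<close> gives tightness, and pointwise for all
  \<open>Suc n\<close>. If a point keeps mass, normalizing the pointwise limit gives the required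
  distribution; otherwise \<open>drift\<close> is contradicted.\<close>

lemma invariant_exists_Suc:
  assumes n: "n < N" and l: "\<And>i. i \<in> {1..Suc n} \<Longrightarrow> 0 < l i"
    and inv: "invariant n l (\<psi> n) \<mu>" and drift: "l (Suc n) < expect \<mu> (\<psi> n (Suc n))"
  obtains \<nu> where "invariant (Suc n) l (\<psi> (Suc n)) \<nu>"
proof -
  let ?f = "\<psi> n" and ?f' = "\<psi> (Suc n)" and ?m = "Suc n"
  let ?res = "\<lambda>x :: nat \<Rightarrow> nat. restrict x {1..n}"
  interpret a: monotone_system n l ?f B using n l by (intro monotone_psi) auto
  interpret b: monotone_system ?m l ?f' B using n l by (intro monotone_psi) auto
  have sub: "set_pmf \<mu> \<subseteq> states n" using inv by (simp add: invariant_def)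
  obtain h where h: "0 < h" "h * a.R \<le> 1" "h * b.R \<le> 1"
    by (rule common_step[OF a.queue_system_axioms b.queue_system_axioms])
  have h0: "0 \<le> h" using h by simp
  obtain A where A: "\<And>k. set_pmf (A k) \<subseteq> states ?m"
    "\<And>k g c. (\<And>y. y \<in> states ?m \<Longrightarrow> \<bar>g y\<bar> \<le> c) \<Longrightarrow>
       expect (A k) g = (\<Sum>j<Suc k. (stp ?m l ?f' h ^^ j) g (zero_state ?m)) / real (Suc k)"
    by (rule b.stp_cesaro[OF h0 h(3) zero_state_in]) blast
  define D where "D k = map_pmf ?res (A k)" for k
  have Dsub: "set_pmf (D k) \<subseteq> states n" for k
    unfolding D_def using A(1) restrict_states[of n ?m] by fastforce
  have le_fm: "?f i (?res x) \<le> ?f' i x" if "i \<in> {1..n}" "x \<in> states ?m" for i x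
    using psi_restrict_le[of n ?m i x] n that by auto
  have tight: "\<exists>F. finite F \<and> (\<forall>k. measure_pmf.prob (D k) (- F) \<le> \<epsilon>)" if "0 < \<epsilon>" for \<epsilon>
    unfolding D_def
    by (rule cesaro_tight[OF a.monotone_system_axioms b.queue_system_axioms _ h0 h(2,3) order_refl le_fm inv A(2) that])
      simp_all
  have gen0: "(\<lambda>k. expect (A k) (gen ?m l ?f' g)) \<longlonglongrightarrow> 0" if g: "\<And>x. x \<in> states ?m \<Longrightarrow> \<bar>g x\<bar> \<le> 1" for g
  proof -
    have b: "\<bar>gen ?m l ?f' g y\<bar> \<le> 2 * 1 * b.R" if "y \<in> states ?m" for y
      by (rule b.gen_bound[OF that]) (rule g)
    show ?thesis by (subst A(2)[OF b], assumption, rule b.cesaro_gen[OF h(1,3) zero_state_in], rule g)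
  qed
  \<comment> \<open>The actual service rate of the last queue, boundary included: the generator maps
    its length to \<open>l ?m - u\<close>.\<close>
  define u where "u x = (if 0 < x ?m then ?f' ?m x else 0)" for x
  have u_bd: "\<bar>u x\<bar> \<le> B" if "x \<in> states ?m" for x
    using psi_nonneg[of ?m ?m x] psi_le[of ?m ?m x] n that B_ge0 by (auto simp: u_def)
  \<comment> \<open>Starting from an empty queue, the time-averaged drift of the last queue length is nonnegative.\<close>
  have u_le: "expect (A k) u \<le> l ?m" for k
  proof -
    define q where "q x = real (x ?m)" for x :: "nat \<Rightarrow> nat"
    have gen_q: "gen ?m l ?f' q x = l ?m - u x" for x
    proof -
      have "gen ?m l ?f' q x = (\<Sum>i\<in>{?m}. l i * (q (x(i := x i + 1)) - q x) +
        (if 0 < x i then ?f' i x * (q (x(i := x i - 1)) - q x) else 0))"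
        unfolding gen_def by (intro sum.mono_neutral_right) (auto simp: q_def)
      then show ?thesis by (auto simp: q_def u_def of_nat_diff)
    qed
    have bd: "\<bar>gen ?m l ?f' q x\<bar> \<le> l ?m + B" if "x \<in> states ?m" for x
      using u_bd[OF that] l[of ?m] B_ge0 unfolding gen_q by (auto simp: abs_le_iff)
    \<comment> \<open>\<open>q\<close> is unbounded, so its expectations are avoided: its iterates
      stay nonnegative, telescoping turns this into a statement on the generator of
      \<open>q\<close>, and that function is bounded.\<close>
    have "(stp ?m l ?f' h ^^ Suc k) (\<lambda>_. 0) (zero_state ?m) \<le> (stp ?m l ?f' h ^^ Suc k) q (zero_state ?m)"
      by (intro b.stp_iter_mono h0 h zero_state_in) (simp add: q_def)
    then have "0 \<le> h * (\<Sum>j<Suc k. (stp ?m l ?f' h ^^ j) (gen ?m l ?f' q) (zero_state ?m))"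
      unfolding stp_iter_const stp_iter_telescope[symmetric] by (simp add: q_def)
    then have nn: "0 \<le> (\<Sum>j<Suc k. (stp ?m l ?f' h ^^ j) (gen ?m l ?f' q) (zero_state ?m))"
      using h(1) by (simp only: zero_le_mult_iff) linarith
    have "0 \<le> expect (A k) (gen ?m l ?f' q)"
      by (subst A(2)[OF bd], assumption, rule divide_nonneg_nonneg[OF nn]) simp
    also have "expect (A k) (gen ?m l ?f' q) = l ?m - expect (A k) u"
    proof -
      have "integrable (A k) u" using A(1)[of k] u_bd by (intro integrable_bdd[where c = B]) auto
      then show ?thesis unfolding gen_q by simp
    qed
    finally show ?thesis by simp
  qed
  from tight_pmf_subsequence[OF countable_states Dsub tight]
  obtain r \<nu> where r: "strict_mono r" "set_pmf \<nu> \<subseteq> states n"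
    and conv0: "\<And>g c. (\<And>x. x \<in> states n \<Longrightarrow> \<bar>g x\<bar> \<le> c) \<Longrightarrow> (\<lambda>k. expect (D (r k)) g) \<longlonglongrightarrow> expect \<nu> g"
    by blast
  obtain s where s: "strict_mono s"
    and lim_states: "\<And>x. x \<in> states ?m \<Longrightarrow> \<exists>a. (\<lambda>k. pmf (A (r (s k))) x) \<longlonglongrightarrow> a"
    by (rule function_convergent_subsequence[of "states ?m" "\<lambda>k x. pmf (A (r k)) x" 1])
      (auto simp: countable_states pmf_le_1)
  have "\<exists>a. (\<lambda>k. pmf (A (r (s k))) x) \<longlonglongrightarrow> a" for x
  proof (cases "x \<in> states ?m")
    case False
    then have "pmf (A (r (s k))) x = 0" for k using A(1) by (meson set_pmf_iff subsetD)
    then show ?thesis by auto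
  qed (rule lim_states)
  then obtain a where a: "\<And>x. (\<lambda>k. pmf (A (r (s k))) x) \<longlonglongrightarrow> a x" by metis
  define A' where "A' k = A (r (s k))" for k
  have A'sub: "set_pmf (A' k) \<subseteq> states ?m" for k using A(1) by (simp add: A'_def)
  have conv: "(\<lambda>k. expect (A' k) (\<lambda>x. g (?res x))) \<longlonglongrightarrow> expect \<nu> g"
    if "\<And>x. x \<in> states n \<Longrightarrow> \<bar>g x\<bar> \<le> c" for g c
    using LIMSEQ_subseq_LIMSEQ[OF conv0[OF that] s] by (simp add: o_def D_def A'_def)
  have gen0': "(\<lambda>k. expect (A' k) (gen ?m l ?f' g)) \<longlonglongrightarrow> 0" if g: "\<And>x. x \<in> states ?m \<Longrightarrow> \<bar>g x\<bar> \<le> 1" for g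
    using LIMSEQ_subseq_LIMSEQ[OF gen0[OF g] strict_mono_o[OF r(1) s]] by (simp add: o_def A'_def)
  show ?thesis
  proof (cases "\<exists>x. 0 < a x")
    case True
    then obtain x0 where "0 < a x0" by blast
    from b.invariant_of_vague_limit[OF A'sub a[folded A'_def] this gen0'] show ?thesis
      using that by blast
  next
    case False
    have "0 \<le> a x" for x by (rule LIMSEQ_le_const[OF a]) auto
    then have "a x = 0" for x using False by (intro antisym) (auto simp: not_less)
    with a have a0: "(\<lambda>k. pmf (A' k) x) \<longlonglongrightarrow> 0" for x by (simp add: A'_def)
    \<comment> \<open>Tightness of the projections confines the first \<open>n\<close> queues to a
      finite \<open>F\<close>; with the last queue at most \<open>t\<close> only finitely many
      states remain, and each of them loses its mass.\<close>
    have escape: "(\<lambda>k. measure_pmf.prob (A' k) {x. x ?m \<le> t}) \<longlonglongrightarrow> 0" for t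
    proof (rule LIMSEQ_I)
      fix e :: real assume e: "0 < e"
      obtain F where F: "finite F" "\<And>k. measure_pmf.prob (D k) (- F) \<le> e / 2"
        using tight[of "e / 2"] e by auto
      define G where "G = {x \<in> states ?m. ?res x \<in> F \<and> x ?m \<le> t}"
      have "inj_on (\<lambda>x. (?res x, x ?m)) (states ?m)"
      proof (rule inj_onI)
        fix x y assume xy: "x \<in> states ?m" "y \<in> states ?m" and eq: "(?res x, x ?m) = (?res y, y ?m)"
        show "x = y"
        proof (rule states_eqI[OF xy])
          fix i assume i: "i \<in> {1..?m}"
          show "x i = y i"
          proof (cases "i = ?m")
            case False
            then have "i \<in> {1..n}" using i by auto
            then show ?thesis using eq by (metis prod.inject restrict_apply')
          qed (use eq in auto)
        qed
      qed
      then have "inj_on (\<lambda>x. (?res x, x ?m)) G" by (rule inj_on_subset) (auto simp: G_def)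
      moreover have "finite ((\<lambda>x. (?res x, x ?m)) ` G)"
        by (rule finite_subset[of _ "F \<times> {..t}"]) (auto simp: G_def F(1))
      ultimately have finG: "finite G" by (rule finite_imageD[rotated])
      have "(\<lambda>k. \<Sum>x\<in>G. pmf (A' k) x) \<longlonglongrightarrow> (\<Sum>x\<in>G. 0)" by (intro tendsto_sum a0)
      then have "\<forall>\<^sub>F k in sequentially. (\<Sum>x\<in>G. pmf (A' k) x) < e / 2"
        using e by (intro order_tendstoD) auto
      then obtain k0 where k0: "\<And>k. k0 \<le> k \<Longrightarrow> (\<Sum>x\<in>G. pmf (A' k) x) < e / 2"
        by (auto simp: eventually_sequentially)
      show "\<exists>no. \<forall>k\<ge>no. norm (measure_pmf.prob (A' k) {x. x ?m \<le> t} - 0) < e"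
      proof (intro exI allI impI)
        fix k assume k: "k0 \<le> k"
        have "measure_pmf.prob (A' k) {x. x ?m \<le> t} \<le> measure_pmf.prob (A' k) (?res -` (- F) \<union> G)"
          using A'sub[of k] by (intro measure_pmf.finite_measure_mono_AE) (auto simp: AE_measure_pmf_iff G_def)
        also have "\<dots> \<le> measure_pmf.prob (A' k) (?res -` (- F)) + measure_pmf.prob (A' k) G"
          by (rule measure_Un_le) auto
        also have "measure_pmf.prob (A' k) (?res -` (- F)) = measure_pmf.prob (D (r (s k))) (- F)"
          by (simp add: D_def A'_def)
        also have "measure_pmf.prob (A' k) G = (\<Sum>x\<in>G. pmf (A' k) x)"
          by (rule measure_measure_pmf_finite[OF finG])
        finally show "norm (measure_pmf.prob (A' k) {x. x ?m \<le> t} - 0) < e"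
          using F(2)[of "r (s k)"] k0[OF k] by simp
      qed
    qed
    \<comment> \<open>A test function of the first \<open>n\<close> queues feels the last queue only
      through the service rates, and these converge as it escapes.\<close>
    have "invariant n l ?f \<nu>"
    proof (rule a.limit_invariant[OF r(2)])
      show "(\<lambda>k. expect (map_pmf ?res (A' k)) g) \<longlonglongrightarrow> expect \<nu> g"
        if "\<And>x. x \<in> states n \<Longrightarrow> \<bar>g x\<bar> \<le> c" for g c using conv[OF that] by simp
    next
      fix g :: "(nat \<Rightarrow> nat) \<Rightarrow> real" assume g: "\<And>x. \<bar>g x\<bar> \<le> 1"
      let ?v = "gen ?m l ?f' (\<lambda>x. g (?res x))" and ?w = "\<lambda>x. gen n l ?f g (?res x)"
      have dv: "(\<lambda>k. expect (A' k) ?v - expect (A' k) ?w) \<longlonglongrightarrow> 0"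
      proof (rule expect_diff_vanish[OF A'sub _ _ _ escape])
        show "\<bar>?v x\<bar> \<le> 2 * a.R + 2 * b.R" if "x \<in> states ?m" for x
          using b.gen_bound[OF that, of "\<lambda>x. g (?res x)" 1] g a.R_nonneg by simp
        show "\<bar>?w x\<bar> \<le> 2 * a.R + 2 * b.R" if "x \<in> states ?m" for x
          using a.gen_bound[OF restrict_states[OF _ that], of g 1] g b.R_nonneg by simp
        fix \<delta> :: real assume d: "0 < \<delta>"
        \<comment> \<open>Compensates for the factor \<open>2 * n\<close> in
          \<open>gen_restrict_diff\<close>; the \<open>+ 1\<close> admits
          \<open>n = 0\<close>.\<close>
        define d where "d = \<delta> / (2 * real n + 1)"
        have d0: "0 < d" using d by (simp add: d_def)
        obtain t where t: "\<And>x i. x \<in> states ?m \<Longrightarrow> t < x ?m \<Longrightarrow> i \<in> {1..N} \<Longrightarrow> \<bar>?f' i x - ?f i (?res x)\<bar> \<le> d"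
          by (rule psi_close[OF n d0]) blast
        show "\<exists>t. \<forall>x\<in>states ?m. t < x ?m \<longrightarrow> \<bar>?v x - ?w x\<bar> \<le> \<delta>"
        proof (intro exI[of _ t] ballI impI)
          fix x assume x: "x \<in> states ?m" "t < x ?m"
          have "\<bar>?v x - ?w x\<bar> \<le> 2 * real n * 1 * d"
            using t[OF x] n by (intro gen_restrict_diff x g) auto
          also have "\<dots> \<le> \<delta>" using d by (simp add: d_def field_simps)
          finally show "\<bar>?v x - ?w x\<bar> \<le> \<delta>" .
        qed
      qed
      have "(\<lambda>k. expect (A' k) ?v) \<longlonglongrightarrow> 0" by (rule gen0') (rule g)
      from tendsto_diff[OF this dv] show "(\<lambda>k. expect (map_pmf ?res (A' k)) (gen n l ?f g)) \<longlonglongrightarrow> 0"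
        by simp
    qed
    then have "\<nu> = \<mu>" using inv by (rule a.invariant_unique)
    let ?w = "\<lambda>x. ?f ?m (?res x)"
    have f_bd: "\<bar>?f ?m x\<bar> \<le> B" if "x \<in> states n" for x
      using psi_nonneg[of n ?m x] psi_le[of n ?m x] n that by auto
    \<comment> \<open>\<open>u\<close> departs from the service rate only at an empty last queue,
      which any threshold excludes; so it too approaches \<open>?f ?m\<close>.\<close>
    have du: "(\<lambda>k. expect (A' k) u - expect (A' k) ?w) \<longlonglongrightarrow> 0"
    proof (rule expect_diff_vanish[OF A'sub u_bd _ _ escape])
      show "\<bar>?w x\<bar> \<le> B" if "x \<in> states ?m" for x
        using restrict_states[OF _ that, of n] by (intro f_bd) auto
      fix \<delta> :: real assume d: "0 < \<delta>"
      obtain t where t: "\<And>x i. x \<in> states ?m \<Longrightarrow> t < x ?m \<Longrightarrow> i \<in> {1..N} \<Longrightarrow> \<bar>?f' i x - ?f i (?res x)\<bar> \<le> \<delta>"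
        by (rule psi_close[OF n d]) blast
      show "\<exists>t. \<forall>x\<in>states ?m. t < x ?m \<longrightarrow> \<bar>u x - ?w x\<bar> \<le> \<delta>"
        using t n by (intro exI[of _ t]) (auto simp: u_def)
    qed
    have "(\<lambda>k. expect (A' k) ?w) \<longlonglongrightarrow> expect \<nu> (?f ?m)" by (rule conv) (rule f_bd)
    from tendsto_add[OF du this] have "(\<lambda>k. expect (A' k) u) \<longlonglongrightarrow> expect \<mu> (?f ?m)"
      by (simp add: \<open>\<nu> = \<mu>\<close>)
    then have "expect \<mu> (?f ?m) \<le> l ?m"
      by (rule LIMSEQ_le_const2) (use u_le in \<open>auto simp: A'_def\<close>)
    then show ?thesis using drift by simp
  qed
qed

end

lemma stp_iter_sum:
  "(stp n l f h ^^ k) (\<lambda>x. \<Sum>i\<in>I. g i x) x = (\<Sum>i\<in>I. (stp n l f h ^^ k) (g i) x)"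
proof (induction I rule: infinite_finite_induct)
  case (insert i I)
  then show ?case by (simp add: stp_iter_add)
qed (simp_all add: stp_iter_const)

text \<open>For \<open>u = - v\<close> negative this follows from \<open>exp v \<ge> 1 + v\<close>
  and the factorization of \<open>1 + v ^ 3\<close>.\<close>

lemma exp_le_quadratic:
  fixes u :: real
  assumes "\<bar>u\<bar> \<le> 1"
  shows "exp u \<le> 1 + u + u\<^sup>2"
proof (cases "0 \<le> u")
  case True then show ?thesis using assms exp_bound[of u] by simp
next
  case False
  define v where "v = - u"
  have v: "0 < v" using False by (simp add: v_def)
  have "(1 - v + v\<^sup>2) * (1 + v) = 1 + v ^ 3" by algebra
  moreover have "0 < v ^ 3" using v by (rule zero_less_power)
  ultimately have "1 \<le> (1 - v + v\<^sup>2) * (1 + v)" by linarith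
  then have "1 / (1 + v) \<le> 1 - v + v\<^sup>2" using v by (subst pos_divide_le_eq) auto
  moreover have "exp u \<le> 1 / (1 + v)"
  proof -
    have "exp u = inverse (exp v)" by (simp add: v_def exp_minus)
    also have "\<dots> \<le> inverse (1 + v)" using exp_ge_add_one_self[of v] v by (intro le_imp_inverse_le) auto
    finally show ?thesis by (simp add: inverse_eq_divide)
  qed
  ultimately show ?thesis by (simp add: v_def)
qed

context coupled_queues
begin

section \<open>Escape of the remaining queues\<close>

text \<open>In a single step the drift of queue \<open>i\<close> may be negative, since near the
  empty state of the first \<open>n\<close> queues its service rate may exceed the mean; only the
  average over \<open>T\<close> steps is positive. Queue lengths need not be integrable under
  \<open>\<nu>\<close>, so the drift is transferred to bounded exponentials.\<close>

lemma no_invariant: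
  assumes n: "n < N" and l: "\<And>i. i \<in> {1..N} \<Longrightarrow> 0 < l i"
    and inv: "invariant n l (\<psi> n) \<mu>"
    and drift: "\<And>i. i \<in> {n+1..N} \<Longrightarrow> expect \<mu> (\<psi> n i) < l i"
  shows "\<not> invariant N l \<phi> \<nu>"
proof
  assume inv\<nu>: "invariant N l \<phi> \<nu>"
  let ?f = "\<psi> n" and ?I = "{n+1..N}"
  let ?res = "\<lambda>x :: nat \<Rightarrow> nat. restrict x {1..n}"
  interpret a: monotone_system n l ?f B using n l by (intro monotone_psi) auto
  interpret b: queue_system N l \<phi> B using l phi_nonneg phi_le B_ge0 by unfold_locales auto
  have sub\<nu>: "set_pmf \<nu> \<subseteq> states N" using inv\<nu> by (simp add: invariant_def)
  obtain h where h: "0 < h" "h * a.R \<le> 1" "h * b.R \<le> 1"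
    by (rule common_step[OF a.queue_system_axioms b.queue_system_axioms])
  have h0: "0 \<le> h" using h by simp
  let ?S = "stp n l ?f h" and ?S' = "stp N l \<phi> h"
  have I: "finite ?I" "?I \<noteq> {}" "\<And>i. i \<in> ?I \<Longrightarrow> i \<in> {1..N}" using n by auto
  \<comment> \<open>A third of the smallest gap: one share pays for the time average from the empty
    state, one for replacing \<open>\<phi>\<close> by its limit, and one remains as drift.\<close>
  define \<epsilon> where "\<epsilon> = Min ((\<lambda>i. l i - expect \<mu> (?f i)) ` ?I) / 3"
  have \<epsilon>0: "0 < \<epsilon>" using I drift by (auto simp: \<epsilon>_def)
  have \<epsilon>: "expect \<mu> (?f i) + 3 * \<epsilon> \<le> l i" if "i \<in> ?I" for i
  proof -
    have "3 * \<epsilon> \<le> l i - expect \<mu> (?f i)" unfolding \<epsilon>_def using that I by simp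
    then show ?thesis by simp
  qed
  have f_bd: "\<bar>?f i x\<bar> \<le> B" if "i \<in> ?I" "x \<in> states n" for i x
    using psi_nonneg[of n i x] psi_le[of n i x] n that by auto
  have "\<forall>\<^sub>F k in sequentially. \<forall>i\<in>?I. (\<Sum>j<Suc k. (?S ^^ j) (?f i) (zero_state n)) / real (Suc k) < expect \<mu> (?f i) + \<epsilon>"
    using \<epsilon>0 by (intro eventually_ball_finite I(1) ballI order_tendstoD(2)[OF a.cesaro_invariant[OF inv h(1,2) f_bd]]) auto
  from eventually_happens'[OF sequentially_bot this]
  obtain K where K: "\<And>i. i \<in> ?I \<Longrightarrow> (\<Sum>j<Suc K. (?S ^^ j) (?f i) (zero_state n)) / real (Suc K) < expect \<mu> (?f i) + \<epsilon>"
    by blast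
  define T where "T = Suc K"
  have T0: "0 < real T" by (simp add: T_def)
  \<comment> \<open>\<open>d\<close> bounds the error of the service rates far out, and
    \<open>e\<close> below the resulting error of one step; \<open>d\<close> is chosen so that the
    total \<open>real T * e + d\<close> is \<open>\<epsilon>\<close>.\<close>
  define d where "d = \<epsilon> / (1 + 2 * real n * B * real T * h)"
  have den: "0 < 1 + 2 * real n * B * real T * h" using B_ge0 h0 by (simp add: add_pos_nonneg)
  have d0: "0 < d" using \<epsilon>0 den by (simp add: d_def)
  define e where "e = h * (2 * real n * B * d)"
  have e0: "0 \<le> e" using h0 B_ge0 d0 by (simp add: e_def)
  have Ted: "real T * e + d = \<epsilon>"
  proof -
    have "d * (1 + 2 * real n * B * real T * h) = \<epsilon>" using den by (simp add: d_def)
    then show ?thesis by (simp add: e_def algebra_simps)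
  qed
  obtain r where r: "\<And>x i. x \<in> states N \<Longrightarrow> (\<And>j. j \<in> {n+1..N} \<Longrightarrow> r < x j) \<Longrightarrow> i \<in> {1..N} \<Longrightarrow>
    \<bar>\<phi> i x - ?f i (?res x)\<bar> \<le> d"
    using phi_close_uniform[of n d] n d0 by auto
  \<comment> \<open>After \<open>k\<close> steps from \<open>D k\<close> each remaining queue still
    exceeds \<open>r\<close>, where the limiting rates are accurate.\<close>
  define D where "D k = {x \<in> states N. \<forall>j\<in>?I. r + k < x j}" for k
  have Dsub: "D k \<subseteq> states N" for k by (auto simp: D_def)
  have Dmono: "D k \<subseteq> D j" if "j \<le> k" for j k using that by (force simp: D_def)
  have Dnbrs: "nbrs N y \<subseteq> D k" if "y \<in> D (Suc k)" for k y
  proof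
    fix z assume z: "z \<in> nbrs N y"
    have "r + k < z j" if "j \<in> ?I" for j
      using nbrs_ge[OF z, of j] \<open>y \<in> D (Suc k)\<close> that by (force simp: D_def)
    then show "z \<in> D k" using z nbrs_states[of y N] \<open>y \<in> D (Suc k)\<close> by (auto simp: D_def)
  qed
  have close: "\<bar>\<phi> i x - ?f i (?res x)\<bar> \<le> d" if "x \<in> D k" "i \<in> {1..N}" for x i k
  proof (rule r)
    show "r < x j" if "j \<in> {n+1..N}" for j
      using \<open>x \<in> D k\<close> that unfolding D_def by (blast intro: add_lessD1)
  qed (use that in \<open>simp_all add: D_def\<close>)
  \<comment> \<open>Each step costs \<open>e\<close>, and earlier errors pass through
    \<open>?S'\<close> unchanged because it is monotone and fixes constants.\<close>
  have claim1: "(?S' ^^ k) (\<lambda>x. ?f i (?res x)) x \<le> (?S ^^ k) (?f i) (?res x) + real k * e"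
    if i: "i \<in> ?I" and "x \<in> D k" for i k x
    using that(2)
  proof (induction k arbitrary: x)
    case (Suc k)
    let ?W = "(?S ^^ k) (?f i)"
    have x: "x \<in> states N" using Suc.prems Dsub by auto
    have "(?S' ^^ Suc k) (\<lambda>x. ?f i (?res x)) x \<le> ?S' (\<lambda>y. ?W (?res y) + real k * e) x"
      unfolding stp_iter_Suc 
    proof (intro b.stp_mono_nbrs h0 h x)
      show "(?S' ^^ k) (\<lambda>x. ?f i (?res x)) y \<le> ?W (?res y) + real k * e" if "y \<in> nbrs N x" for y
        using Dnbrs[OF Suc.prems] that by (intro Suc.IH) blast
    qed
    also have "\<dots> = ?S' (\<lambda>y. ?W (?res y)) x + real k * e"
      unfolding stp_add stp_const ..
    also have "?S' (\<lambda>y. ?W (?res y)) x \<le> ?S ?W (?res x) + e"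
    proof -
      have "\<bar>gen N l \<phi> (\<lambda>y. ?W (?res y)) x - gen n l ?f ?W (?res x)\<bar> \<le> 2 * real n * B * d"
      proof (rule gen_restrict_diff[OF _ x])
        show "\<bar>?W y\<bar> \<le> B" if "y \<in> states n" for y
          by (rule a.stp_iter_bound[OF h0 h(2) that f_bd[OF i]])
        show "\<bar>\<phi> i x - ?f i (?res x)\<bar> \<le> d" if "i \<in> {1..n}" for i
          using close[OF Suc.prems, of i] that n by simp
      qed (use n in simp)
      then have "h * (gen N l \<phi> (\<lambda>y. ?W (?res y)) x - gen n l ?f ?W (?res x)) \<le> e"
        unfolding e_def using h0 by (intro mult_left_mono) auto
      then show ?thesis unfolding stp_def[of N l \<phi> h "\<lambda>y. ?W (?res y)"] stp_def[of n l ?f h ?W]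
        by (simp add: algebra_simps)
    qed
    finally show ?case unfolding stp_iter_Suc of_nat_Suc distrib_right by linarith
  qed simp
  have claim2: "(?S' ^^ k) (\<phi> i) x \<le> (?S ^^ k) (?f i) (zero_state n) + real k * e + d"
    if i: "i \<in> ?I" and x: "x \<in> D k" for i k x
  proof -
    have "(?S' ^^ k) (\<phi> i) x \<le> (?S' ^^ k) (\<lambda>y. ?f i (?res y) + d) x"
    proof (rule b.stp_iter_mono_local[where D = D, OF h0 h(3) Dsub Dnbrs _ x])
      show "\<phi> i y \<le> ?f i (?res y) + d" if "y \<in> D 0" for y
        using close[OF that I(3)[OF i]] by linarith
    qed
    also have "\<dots> = (?S' ^^ k) (\<lambda>y. ?f i (?res y)) x + d"
      by (simp add: stp_iter_add stp_iter_const)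
    also have "(?S' ^^ k) (\<lambda>y. ?f i (?res y)) x \<le> (?S ^^ k) (?f i) (?res x) + real k * e"
      by (rule claim1[OF i x])
    \<comment> \<open>As \<open>i > n\<close>, the rate \<open>?f i\<close> decreases in all
      \<open>n\<close> coordinates, and so do its iterates. The resulting bound no longer depends on
      \<open>x\<close>.\<close>
    also have "(?S ^^ k) (?f i) (?res x) \<le> (?S ^^ k) (?f i) (zero_state n)"
    proof -
      have "state_mono n (\<lambda>y. - 1 * ?f i y)"
        unfolding state_mono_def
      proof (intro ballI impI)
        fix y z assume "y \<in> states n" "z \<in> states n" "\<forall>j\<in>{1..n}. y j \<le> z j"
        then have "?f i z \<le> ?f i y" using n i by (intro psi_anti) auto
        then show "- 1 * ?f i y \<le> - 1 * ?f i z" by simp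
      qed
      from a.stp_iter_state_mono[OF h0 h(2) this, of k]
      have "state_mono n (\<lambda>y. - 1 * (?S ^^ k) (?f i) y)" unfolding stp_iter_cmult .
      moreover have "?res x \<in> states n" using x n Dsub restrict_states[of n N x] by auto
      moreover have "zero_state n j \<le> ?res x j" if "j \<in> {1..n}" for j using that by simp
      ultimately have "- 1 * (?S ^^ k) (?f i) (zero_state n) \<le> - 1 * (?S ^^ k) (?f i) (?res x)"
        using zero_state_in[of n] unfolding state_mono_def by blast
      then show ?thesis by simp
    qed
    finally show ?thesis by simp
  qed
  define q where "q i x = real (x i)" for i and x :: "nat \<Rightarrow> nat"
  have gen_q: "gen N l \<phi> (q i) x = l i - (if 0 < x i then \<phi> i x else 0)" if i: "i \<in> ?I" for i x
  proof -
    have "gen N l \<phi> (q i) x = (\<Sum>j\<in>{i}. l j * (q i (x(j := x j + 1)) - q i x) +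
        (if 0 < x j then \<phi> j x * (q i (x(j := x j - 1)) - q i x) else 0))"
      unfolding gen_def using i by (intro sum.mono_neutral_right) (auto simp: q_def)
    then show ?thesis by (auto simp: q_def of_nat_diff)
  qed
  \<comment> \<open>Dynkin's formula for the unbounded \<open>q i\<close>. Charging
    \<open>\<phi> i\<close> even to an empty queue only lowers the drift, and after the two shares
    of error a mean of \<open>\<epsilon>\<close> per step is left.\<close>
  have claim3: "q i x + h * real T * \<epsilon> \<le> (?S' ^^ T) (q i) x" if i: "i \<in> ?I" and x: "x \<in> D T" for i x
  proof -
    have xN: "x \<in> states N" using x Dsub by auto
    have *: "l i - (?S ^^ j) (?f i) (zero_state n) - \<epsilon> \<le> (?S' ^^ j) (gen N l \<phi> (q i)) x" if j: "j < T" for j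
    proof -
      have "(?S' ^^ j) (\<lambda>y. l i + - 1 * \<phi> i y) x \<le> (?S' ^^ j) (gen N l \<phi> (q i)) x"
        using phi_nonneg[OF I(3)[OF i]] by (intro b.stp_iter_mono h0 h xN) (simp add: gen_q[OF i])
      also have "(?S' ^^ j) (\<lambda>y. l i + - 1 * \<phi> i y) x = l i - (?S' ^^ j) (\<phi> i) x"
        unfolding stp_iter_add stp_iter_const stp_iter_cmult by simp
      finally have 1: "l i - (?S' ^^ j) (\<phi> i) x \<le> (?S' ^^ j) (gen N l \<phi> (q i)) x" .
      have "x \<in> D j" using x Dmono[of j T] j by auto
      from claim2[OF i this] have 2: "(?S' ^^ j) (\<phi> i) x \<le> (?S ^^ j) (?f i) (zero_state n) + real j * e + d" .
      have "real j * e \<le> real T * e" using j e0 by (intro mult_right_mono) auto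
      then show ?thesis using 1 2 Ted by linarith
    qed
    have "(\<Sum>j<T. (?S ^^ j) (?f i) (zero_state n)) \<le> real T * (expect \<mu> (?f i) + \<epsilon>)"
      using K[OF i] unfolding T_def[symmetric] using T0 by (simp add: field_simps)
    moreover have "real T * (expect \<mu> (?f i) + 3 * \<epsilon>) \<le> real T * l i"
      using \<epsilon>[OF i] T0 by (intro mult_left_mono) auto
    ultimately have "real T * \<epsilon> \<le> (\<Sum>j<T. l i - (?S ^^ j) (?f i) (zero_state n) - \<epsilon>)"
      by (simp add: sum_subtractf sum.distrib algebra_simps)
    also have "\<dots> \<le> (\<Sum>j<T. (?S' ^^ j) (gen N l \<phi> (q i)) x)" using * by (intro sum_mono) auto
    finally have "h * (real T * \<epsilon>) \<le> h * (\<Sum>j<T. (?S' ^^ j) (gen N l \<phi> (q i)) x)"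
      using h0 by (rule mult_left_mono)
    then show ?thesis unfolding stp_iter_telescope[symmetric] by (simp add: algebra_simps)
  qed
  \<comment> \<open>The first bound makes the quadratic error
    \<open>(\<theta> * real T)\<^sup>2\<close> at most half of the linear gain
    \<open>\<theta> * (h * real T * \<epsilon>)\<close>; the second keeps the exponent in the range
    of \<open>exp_le_quadratic\<close>. Below, \<open>\<eta>\<close> is half of the gain.\<close>
  define \<theta> where "\<theta> = min (h * \<epsilon> / (2 * real T)) (1 / real T)"
  have \<theta>: "0 < \<theta>" "\<theta> * real T \<le> 1" "\<theta> * real T \<le> h * \<epsilon> / 2"
  proof -
    show "0 < \<theta>" using T0 h(1) \<epsilon>0 by (simp add: \<theta>_def)
    have "\<theta> \<le> 1 / real T" "\<theta> \<le> h * \<epsilon> / (2 * real T)" by (simp_all add: \<theta>_def)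
    from this[THEN mult_right_mono, of "real T"] show "\<theta> * real T \<le> 1" "\<theta> * real T \<le> h * \<epsilon> / 2"
      using T0 by simp_all
  qed
  define \<eta> where "\<eta> = \<theta> * real T * (h * \<epsilon> / 2)"
  have \<eta>0: "0 < \<eta>" using \<theta> T0 h(1) \<epsilon>0 by (simp add: \<eta>_def)
  define G where "G i x = exp (- \<theta> * q i x)" for i and x :: "nat \<Rightarrow> nat"
  have claim4: "(?S' ^^ T) (G i) x \<le> (1 - \<eta>) * G i x" if i: "i \<in> ?I" and x: "x \<in> D T" for i x
  proof -
    have xN: "x \<in> states N" using x Dsub by auto
    \<comment> \<open>Coefficients of an affine function of \<open>q i\<close> above
      \<open>G i\<close>: the tangent at \<open>x\<close> plus the quadratic error, valid while
      \<open>q i\<close> moves by at most \<open>T\<close>, which \<open>E\<close> keeps track of.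
      It has to be affine because only the drift of \<open>q i\<close> is known.\<close>
    let ?a = "G i x * (1 + (\<theta> * real T)\<^sup>2 + \<theta> * q i x)" and ?b = "- G i x * \<theta>"
    define E where "E k = {y \<in> states N. \<bar>q i y - q i x\<bar> \<le> real T - real k}" for k
    have "(?S' ^^ T) (G i) x \<le> (?S' ^^ T) (\<lambda>y. ?a + ?b * q i y) x"
    proof (rule b.stp_iter_mono_local[OF h0 h(3), of E])
      show "nbrs N y \<subseteq> E k" if "y \<in> E (Suc k)" for k y
      proof
        fix z assume z: "z \<in> nbrs N y"
        have "\<bar>q i z - q i y\<bar> \<le> 1" using nbrs_ge[OF z, of i] nbrs_le[OF z, of i] by (simp add: q_def)
        then show "z \<in> E k" using that z nbrs_states[of y N] by (auto simp: E_def)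
      qed
      show "G i y \<le> ?a + ?b * q i y" if "y \<in> E 0" for y
      proof -
        let ?u = "- \<theta> * (q i y - q i x)"
        have abs: "\<bar>?u\<bar> \<le> \<theta> * real T"
          unfolding abs_mult using that \<theta>(1) by (auto simp: E_def intro!: mult_left_mono)
        then have "exp ?u \<le> 1 + ?u + ?u\<^sup>2" using \<theta>(2) by (intro exp_le_quadratic) linarith
        also have "?u\<^sup>2 \<le> (\<theta> * real T)\<^sup>2"
          using power_mono[OF abs, of 2] by simp
        finally have "G i x * exp ?u \<le> G i x * (1 + ?u + (\<theta> * real T)\<^sup>2)"
          by (intro mult_left_mono) (auto simp: G_def)
        moreover have "G i x * exp ?u = G i y" unfolding G_def exp_add[symmetric] by (simp add: algebra_simps)
        ultimately show ?thesis by (simp add: algebra_simps)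
      qed
      show "x \<in> E T" using xN by (simp add: E_def)
    qed (auto simp: E_def)
    also have "\<dots> = ?a + ?b * (?S' ^^ T) (q i) x"
      unfolding stp_iter_add stp_iter_const stp_iter_cmult ..
    also have "\<dots> \<le> ?a + ?b * (q i x + h * real T * \<epsilon>)"
      using claim3[OF i x] \<theta>(1) by (intro add_left_mono mult_left_mono_neg) (auto simp: G_def)
    also have "\<dots> = G i x * (1 + (\<theta> * real T)\<^sup>2 - 2 * \<eta>)" by (simp add: \<eta>_def algebra_simps)
    also have "\<dots> \<le> G i x * (1 - \<eta>)"
    proof -
      have "(\<theta> * real T)\<^sup>2 \<le> \<eta>" unfolding \<eta>_def power2_eq_square using \<theta> T0 by (intro mult_left_mono) auto
      then show ?thesis by (intro mult_left_mono) (auto simp: G_def)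
    qed
    finally show ?thesis by (simp add: mult.commute)
  qed
  define H where "H x = (\<Sum>i\<in>?I. G i x)" for x
  have H0: "0 < H x" for x unfolding H_def using I by (intro sum_pos) (auto simp: G_def)
  \<comment> \<open>\<open>H x < c\<close> forces each remaining queue above \<open>r + T\<close>,
    so \<open>T\<close> steps do not leave the region where the estimates hold.\<close>
  define c where "c = exp (- \<theta> * real (r + T))"
  have small: "x \<in> D T" if "H x < c" "x \<in> states N" for x
  proof -
    have "r + T < x i" if i: "i \<in> ?I" for i
    proof -
      have "G i x \<le> H x" unfolding H_def using i I by (intro member_le_sum) (auto simp: G_def)
      then have "G i x < c" using \<open>H x < c\<close> by simp
      then have "real (r + T) < real (x i)" using \<theta>(1) by (simp add: G_def c_def q_def)
      then show ?thesis by simp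
    qed
    then show ?thesis using that by (auto simp: D_def)
  qed
  \<comment> \<open>The cut-off makes the inequality global: where \<open>H x \<ge> c\<close>, the
    value \<open>c\<close> is the maximum of \<open>g\<close> and cannot grow.\<close>
  define g where "g x = min (H x) c" for x
  have g_bd: "\<bar>g x\<bar> \<le> c" for x using H0[of x] by (auto simp: g_def c_def)
  have dec: "(?S' ^^ T) g x \<le> (1 - \<eta>) * H x" if x: "x \<in> states N" and "H x < c" for x
  proof -
    have "(?S' ^^ T) g x \<le> (?S' ^^ T) H x" by (intro b.stp_iter_mono h0 h x) (simp add: g_def)
    also have "\<dots> = (\<Sum>i\<in>?I. (?S' ^^ T) (G i) x)" unfolding H_def stp_iter_sum ..
    also have "\<dots> \<le> (\<Sum>i\<in>?I. (1 - \<eta>) * G i x)" using small that by (intro sum_mono claim4) auto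
    finally show ?thesis by (simp add: H_def sum_distrib_left)
  qed
  have dec': "(?S' ^^ T) g x \<le> g x" if x: "x \<in> states N" for x
  proof (cases "H x < c")
    case True
    have "(1 - \<eta>) * H x \<le> H x" using \<eta>0 H0[of x] by (simp add: algebra_simps)
    then show ?thesis using dec[OF x True] True by (simp add: g_def)
  next
    case False
    have "(?S' ^^ T) g x \<le> (?S' ^^ T) (\<lambda>_. c) x" by (intro b.stp_iter_mono h0 h x) (simp add: g_def)
    then show ?thesis using False by (simp add: g_def stp_iter_const)
  qed
  have int: "integrable \<nu> g" "integrable \<nu> ((?S' ^^ T) g)"
    using sub\<nu> g_bd b.stp_iter_bound[OF h0 h(3) _ g_bd] by (auto intro!: integrable_bdd[where c = c])
  have "expect \<nu> (\<lambda>x. g x - (?S' ^^ T) g x) = 0"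
    using int b.invariant_stp_iter[OF inv\<nu> h0 h(3) g_bd] by simp
  then have "AE x in \<nu>. g x - (?S' ^^ T) g x = 0"
    using int dec' sub\<nu> by (subst (asm) integral_nonneg_eq_0_iff_AE) (auto simp: AE_measure_pmf_iff)
  then have eq: "g x = (?S' ^^ T) g x" if "x \<in> set_pmf \<nu>" for x using that by (auto simp: AE_measure_pmf_iff)
  obtain x0 where x0: "x0 \<in> set_pmf \<nu>" using set_pmf_not_empty[of \<nu>] by blast
  have "(\<lambda>t::nat. real N * exp (- \<theta>) ^ t) \<longlonglongrightarrow> 0"
    using \<theta>(1) by (intro tendsto_mult_right_zero LIMSEQ_power_zero) simp
  then have "(\<lambda>t::nat. real N * exp (- \<theta> * real t)) \<longlonglongrightarrow> 0"
    by (simp only: exp_of_nat2_mult)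
  then have "\<forall>\<^sub>F t::nat in sequentially. real N * exp (- \<theta> * real t) < c"
    by (rule order_tendstoD) (simp add: c_def)
  then obtain t :: nat where t: "real N * exp (- \<theta> * real t) < c"
    by (auto simp: eventually_sequentially)
  \<comment> \<open>Being closed under arrivals, the support contains a state with all queues at
    least \<open>t\<close>; there \<open>H x < c\<close>, and the decrease is strict.\<close>
  define x where "x = (\<lambda>i\<in>{1..N}. max (x0 i) t)"
  have x: "x \<in> states N" by (auto simp: x_def states_def)
  have "x \<in> set_pmf \<nu>" by (rule b.invariant_support_up[OF inv\<nu> x0 x]) (simp add: x_def)
  then have gx: "g x = (?S' ^^ T) g x" by (rule eq)
  have "H x \<le> (\<Sum>i\<in>?I. exp (- \<theta> * real t))"
    unfolding H_def using \<theta>(1) by (intro sum_mono) (auto simp: G_def q_def x_def)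
  also have "\<dots> \<le> real N * exp (- \<theta> * real t)" by (simp add: mult_right_mono)
  finally have Hx: "H x < c" using t by simp
  have "(1 - \<eta>) * H x < H x" using \<eta>0 H0[of x] by (simp add: algebra_simps)
  then show False using dec[OF x Hx] gx Hx by (simp add: g_def)
qed

end

section \<open>Uniformization\<close>

text \<open>The jump count of a Poisson clock; rate 0 has to be included because time 0 is.\<close>

definition pois :: "real \<Rightarrow> nat pmf" where
  "pois a = (if a = 0 then return_pmf 0 else poisson_pmf a)"

lemma pmf_pois: "0 \<le> a \<Longrightarrow> pmf (pois a) k = a ^ k / fact k * exp (- a)"
  by (cases "a = 0") (auto simp: pois_def power_0_left)

lemma pois_add:
  assumes a: "0 \<le> a" and b: "0 \<le> b"
  shows "bind_pmf (pois a) (\<lambda>j. map_pmf (\<lambda>k. j + k) (pois b)) = pois (a + b)"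
proof (rule pmf_eqI)
  fix m
  have map: "pmf (map_pmf (\<lambda>k. j + k) (pois b)) m = (if j \<le> m then pmf (pois b) (m - j) else 0)" for j
  proof (cases "j \<le> m")
    case True
    then have "m = j + (m - j)" by simp
    then have "pmf (map_pmf (\<lambda>k. j + k) (pois b)) m = pmf (map_pmf (\<lambda>k. j + k) (pois b)) (j + (m - j))" by simp
    also have "\<dots> = pmf (pois b) (m - j)" by (rule pmf_map_inj') (simp add: inj_def)
    finally show ?thesis using True by simp
  next
    case False
    then have "m \<notin> set_pmf (map_pmf (\<lambda>k. j + k) (pois b))" by auto
    then have "pmf (map_pmf (\<lambda>k. j + k) (pois b)) m = 0" by (simp only: set_pmf_iff not_not)
    with False show ?thesis by simp
  qed
  have "pmf (bind_pmf (pois a) (\<lambda>j. map_pmf (\<lambda>k. j + k) (pois b))) m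
      = (\<Sum>j\<le>m. (if j \<le> m then pmf (pois b) (m - j) else 0) * pmf (pois a) j)"
    unfolding pmf_bind map by (rule integral_measure_pmf_real) (auto split: if_splits)
  also have "\<dots> = (\<Sum>j\<le>m. of_nat (m choose j) * a ^ j * b ^ (m - j) * (exp (- (a + b)) / fact m))"
  proof (intro sum.cong refl)
    fix j assume "j \<in> {..m}"
    moreover have "exp (- (a + b)) = exp (- a) * exp (- b)" by (simp add: mult_exp_exp)
    ultimately show "(if j \<le> m then pmf (pois b) (m - j) else 0) * pmf (pois a) j =
        of_nat (m choose j) * a ^ j * b ^ (m - j) * (exp (- (a + b)) / fact m)"
      using a b by (simp only: pmf_pois binomial_fact atMost_iff if_True) (simp add: ac_simps)
  qed
  also have "\<dots> = pmf (pois (a + b)) m"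
    unfolding sum_distrib_right[symmetric] binomial_ring[symmetric] using a b by (simp add: pmf_pois)
  finally show "pmf (bind_pmf (pois a) (\<lambda>j. map_pmf (\<lambda>k. j + k) (pois b))) m = pmf (pois (a + b)) m" .
qed

fun kiter :: "('a \<Rightarrow> 'a pmf) \<Rightarrow> nat \<Rightarrow> 'a \<Rightarrow> 'a pmf" where
  "kiter \<kappa> 0 x = return_pmf x"
| "kiter \<kappa> (Suc k) x = bind_pmf (\<kappa> x) (kiter \<kappa> k)"

lemma kiter_add: "kiter \<kappa> (j + k) x = bind_pmf (kiter \<kappa> j x) (kiter \<kappa> k)"
proof (induction j arbitrary: x)
  case (Suc j)
  have "kiter \<kappa> (Suc j + k) x = bind_pmf (\<kappa> x) (\<lambda>z. kiter \<kappa> (j + k) z)" by simp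
  also have "\<dots> = bind_pmf (\<kappa> x) (\<lambda>z. bind_pmf (kiter \<kappa> j z) (kiter \<kappa> k))" by (simp only: Suc)
  finally show ?case by (simp add: bind_assoc_pmf)
qed (simp add: bind_return_pmf)

text \<open>The semigroup \<open>exp (t * \<Lambda> * (\<kappa> - I))\<close>, realized as the chain
  \<open>\<kappa>\<close> after a Poisson number of steps.\<close>

definition unif :: "('a \<Rightarrow> 'a pmf) \<Rightarrow> real \<Rightarrow> real \<Rightarrow> 'a \<Rightarrow> 'a pmf" where
  "unif \<kappa> \<Lambda> t x = bind_pmf (pois (\<Lambda> * t)) (\<lambda>k. kiter \<kappa> k x)"

lemma unif_add:
  assumes "0 \<le> \<Lambda>" "0 \<le> s" "0 \<le> t"
  shows "unif \<kappa> \<Lambda> (s + t) x = bind_pmf (unif \<kappa> \<Lambda> s x) (unif \<kappa> \<Lambda> t)"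
proof -
  have "bind_pmf (unif \<kappa> \<Lambda> s x) (unif \<kappa> \<Lambda> t) =
    bind_pmf (pois (\<Lambda> * s)) (\<lambda>j. bind_pmf (kiter \<kappa> j x) (\<lambda>z. bind_pmf (pois (\<Lambda> * t)) (\<lambda>k. kiter \<kappa> k z)))"
    unfolding unif_def[abs_def] bind_assoc_pmf ..
  also have "\<dots> = bind_pmf (pois (\<Lambda> * s)) (\<lambda>j. bind_pmf (pois (\<Lambda> * t)) (\<lambda>k. kiter \<kappa> (j + k) x))"
    by (subst bind_commute_pmf) (simp only: kiter_add)
  also have "\<dots> = bind_pmf (bind_pmf (pois (\<Lambda> * s)) (\<lambda>j. map_pmf (\<lambda>k. j + k) (pois (\<Lambda> * t)))) (\<lambda>k. kiter \<kappa> k x)"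
    by (simp add: bind_assoc_pmf bind_map_pmf)
  also have "\<dots> = unif \<kappa> \<Lambda> (s + t) x"
    using assms by (simp add: pois_add unif_def distrib_left)
  finally show ?thesis by simp
qed

lemma set_kiter:
  assumes "\<And>x. x \<in> S \<Longrightarrow> set_pmf (\<kappa> x) \<subseteq> S" "x \<in> S"
  shows "set_pmf (kiter \<kappa> k x) \<subseteq> S"
  using assms(2)
proof (induction k arbitrary: x)
  case (Suc k) then show ?case using assms(1) by (auto simp: set_bind_pmf)
qed simp

text \<open>Only the terms with no jump and with one jump are kept, and
  \<open>exp (- s) \<ge> 1 - s\<close>. Applied to \<open>1 - b\<close> as well, it bounds the
  expectation from both sides.\<close>

lemma unif_lower:
  fixes b :: "nat \<Rightarrow> real"
  assumes s: "0 \<le> s" and b: "\<And>k. 0 \<le> b k" "\<And>k. b k \<le> 1"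
  shows "b 0 + s * (b 1 - b 0) - s\<^sup>2 \<le> expect (pois s) b"
proof -
  have "b 0 + s * (b 1 - b 0) - s\<^sup>2 \<le> (1 - s) * (b 0 + s * b 1)"
  proof -
    have "s\<^sup>2 * b 1 \<le> s\<^sup>2 * 1" using b by (intro mult_left_mono) auto
    then show ?thesis by (simp add: algebra_simps power2_eq_square)
  qed
  also have "\<dots> \<le> exp (- s) * (b 0 + s * b 1)"
    using s b exp_ge_add_one_self[of "- s"] by (intro mult_right_mono) auto
  also have "\<dots> = (\<Sum>k\<in>{0,1}. pmf (pois s) k * b k)" using s by (simp add: pmf_pois algebra_simps)
  also have "\<dots> \<le> expect (pois s) b" using b by (intro expect_ge_finite[where c = 1]) auto
  finally show ?thesis .
qed

lemma unif_bounds: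
  fixes b :: "nat \<Rightarrow> real"
  assumes s: "0 \<le> s" and b: "\<And>k. 0 \<le> b k" "\<And>k. b k \<le> 1"
  shows "\<bar>expect (pois s) b - (b 0 + s * (b 1 - b 0))\<bar> \<le> s\<^sup>2"
proof -
  have int: "integrable (pois s) b" using b by (intro integrable_bdd[where c = 1]) auto
  have "expect (pois s) (\<lambda>k. 1 - b k) = 1 - expect (pois s) b" using int by simp
  then show ?thesis
    using unif_lower[OF s, of b] unif_lower[OF s, of "\<lambda>k. 1 - b k"] b by (auto simp: abs_le_iff algebra_simps)
qed

lemma has_derivative_from_quadratic:
  fixes u :: "real \<Rightarrow> real"
  assumes "\<And>t. 0 \<le> t \<Longrightarrow> \<bar>u t - u 0 - t * G\<bar> \<le> C * t\<^sup>2"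
  shows "(u has_real_derivative G) (at 0 within {0..})"
  unfolding has_field_derivative_iff
proof (subst Lim_null, rule Lim_null_comparison)
  show "((\<lambda>t. C * t) \<longlongrightarrow> 0) (at 0 within {0..})"
    by (rule tendsto_mult_right_zero) (rule tendsto_ident_at)
  have "norm ((u t - u 0) / (t - 0) - G) \<le> C * t" if "0 < t" for t
  proof -
    have "(u t - u 0) / (t - 0) - G = (u t - u 0 - t * G) / t" using that by (simp add: field_simps)
    also have "norm \<dots> = \<bar>u t - u 0 - t * G\<bar> / t" using that by (simp add: abs_divide)
    also have "\<dots> \<le> C * t\<^sup>2 / t" using assms[of t] that by (intro divide_right_mono) auto
    also have "\<dots> = C * t" using that by (simp add: power2_eq_square)
    finally show ?thesis .
  qed
  then show "\<forall>\<^sub>F t in at 0 within {0..}. norm ((u t - u 0) / (t - 0) - G) \<le> C * t"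
    by (auto simp: eventually_at_filter)
qed

context queue_system
begin

lemma queue_rate_gen:
  assumes "x \<noteq> y"
  shows "queue_rate n l f x y = gen n l f (indicator {y}) x"
  unfolding queue_rate_def gen_def using assms by (intro sum.cong) (auto simp: indicator_def)

lemma gen_expand:
  assumes x: "x \<in> states n"
  shows "gen n l f g x = (\<Sum>y\<in>nbrs n x. g y * gen n l f (indicator {y}) x)"
proof -
  have "gen n l f g x = gen n l f (\<lambda>z. \<Sum>y\<in>nbrs n x. g y * indicator {y} z) x"
  proof (rule gen_cong_nbrs)
    fix z assume z: "z \<in> nbrs n x"
    have "(\<Sum>y\<in>nbrs n x. g y * indicator {y} z) = (\<Sum>y\<in>nbrs n x. if y = z then g y else 0)"
      by (intro sum.cong) (auto simp: indicator_def)
    then show "g z = (\<Sum>y\<in>nbrs n x. g y * indicator {y} z)" using z finite_nbrs by simp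
  qed
  also have "\<dots> = (\<Sum>y\<in>nbrs n x. g y * gen n l f (indicator {y}) x)"
    unfolding gen_sum gen_cmult ..
  finally show ?thesis .
qed

lemma self_nbrs: "x \<in> nbrs n x"
  by (simp add: nbrs_def)

lemma gen_indicator_sum:
  assumes "x \<in> states n"
  shows "(\<Sum>y\<in>nbrs n x - {x}. gen n l f (indicator {y}) x) = - gen n l f (indicator {x}) x"
proof -
  have "0 = (\<Sum>y\<in>nbrs n x. 1 * gen n l f (indicator {y}) x)"
    using gen_expand[OF assms, of "\<lambda>_. 1"] by (simp add: gen_const)
  also have "\<dots> = gen n l f (indicator {x}) x + (\<Sum>y\<in>nbrs n x - {x}. gen n l f (indicator {y}) x)"
    by (subst sum.remove[OF finite_nbrs self_nbrs]) simp
  finally show ?thesis by simp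
qed

text \<open>Rates vanish off \<open>nbrs n x\<close>, so the infinite sum is finite. The indicators
  of the points of \<open>nbrs n x\<close> add up to 1 near \<open>x\<close>, and the generator
  annihilates constants, which identifies the diagonal entry.\<close>

lemma generator_gen:
  assumes x: "x \<in> states n" and y: "y \<in> states n"
  shows "generator (states n) (queue_rate n l f) x y = gen n l f (indicator {y}) x"
proof (cases "x = y")
  case True
  have "(\<Sum>\<^sub>\<infinity>z\<in>states n - {x}. queue_rate n l f x z) = (\<Sum>\<^sub>\<infinity>z\<in>nbrs n x - {x}. gen n l f (indicator {z}) x)"
    using nbrs_states[OF x] gen_local[OF x]
    by (intro infsum_cong_neutral) (auto simp: queue_rate_gen)
  also have "\<dots> = - gen n l f (indicator {x}) x"
    using gen_indicator_sum[OF x] finite_nbrs by simp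
  finally show ?thesis using True by (simp add: generator_def)
qed (simp add: generator_def queue_rate_gen)

lemma gen_indicator_nonneg:
  assumes "x \<in> states n" "x \<noteq> y"
  shows "0 \<le> gen n l f (indicator {y}) x"
proof -
  have "gen n l f (\<lambda>z. - 1 * indicator {y} z) x \<le> 0"
    using assms by (intro gen_at_max) (auto simp: indicator_def)
  then show ?thesis unfolding gen_cmult by simp
qed

lemma gen_indicator_bound: "x \<in> states n \<Longrightarrow> \<bar>gen n l f (indicator {y}) x\<bar> \<le> 2 * R"
  using gen_bound[of x "indicator {y}" 1] by (simp add: indicator_def)

lemma transition_function_exists:
  obtains p where "transition_function (states n) (queue_rate n l f) p"
proof -
  \<comment> \<open>The \<open>+ 1\<close> keeps the clock rate positive when \<open>R = 0\<close>;
    the kernel \<open>\<kappa>\<close> below is the Euler step of length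
    \<open>1 / \<Lambda>\<close>.\<close>
  define \<Lambda> where "\<Lambda> = R + 1"
  have \<Lambda>: "0 < \<Lambda>" "0 \<le> 1 / \<Lambda>" "1 / \<Lambda> * R \<le> 1" using R_nonneg by (auto simp: \<Lambda>_def field_simps)
  have "\<forall>z\<in>states n. \<exists>p. set_pmf p \<subseteq> nbrs n z \<and> (\<forall>g. expect p g = stp n l f (1 / \<Lambda>) g z)"
    using stp_kernel[OF \<Lambda>(2,3)] by blast
  then obtain \<kappa> where \<kappa>: "\<And>z. z \<in> states n \<Longrightarrow> set_pmf (\<kappa> z) \<subseteq> nbrs n z"
      "\<And>z g. z \<in> states n \<Longrightarrow> expect (\<kappa> z) g = stp n l f (1 / \<Lambda>) g z" by metis
  have \<kappa>sub: "set_pmf (\<kappa> z) \<subseteq> states n" if "z \<in> states n" for z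
    using \<kappa>(1)[OF that] nbrs_states[OF that] by auto
  have "transition_function (states n) (queue_rate n l f) (unif \<kappa> \<Lambda>)"
    unfolding transition_function_def
  proof (intro conjI allI impI ballI)
    fix t x assume "x \<in> states n"
    then show "set_pmf (unif \<kappa> \<Lambda> t x) \<subseteq> states n"
      using set_kiter[of "states n" \<kappa> x] \<kappa>sub by (auto simp: unif_def set_bind_pmf)
  next
    fix x show "unif \<kappa> \<Lambda> 0 x = return_pmf x" by (simp add: unif_def pois_def bind_return_pmf)
  next
    fix s t x assume "0 \<le> (s::real)" "0 \<le> (t::real)"
    then show "unif \<kappa> \<Lambda> (s + t) x = bind_pmf (unif \<kappa> \<Lambda> s x) (unif \<kappa> \<Lambda> t)"
      using \<Lambda> by (intro unif_add) auto
  next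
    fix x y assume x: "x \<in> states n" and y: "y \<in> states n"
    let ?G = "gen n l f (indicator {y}) x"
    define b where "b k = pmf (kiter \<kappa> k x) y" for k
    have b0: "b 0 = indicator {y} x" by (simp add: b_def indicator_def)
    have "kiter \<kappa> 0 = return_pmf" by (rule ext) simp
    then have "b 1 = expect (\<kappa> x) (indicator {y})"
      by (simp add: b_def bind_return_pmf' measure_pmf_single)
    also have "\<dots> = b 0 + ?G / \<Lambda>" unfolding \<kappa>(2)[OF x] by (simp add: stp_def b0)
    finally have b1: "b 1 - b 0 = ?G / \<Lambda>" by simp
    have p: "pmf (unif \<kappa> \<Lambda> t x) y = expect (pois (\<Lambda> * t)) b" for t
      by (simp add: unif_def pmf_bind b_def[abs_def])
    show "((\<lambda>t. pmf (unif \<kappa> \<Lambda> t x) y) has_real_derivative generator (states n) (queue_rate n l f) x y)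
        (at 0 within {0..})"
      unfolding generator_gen[OF x y]
    proof (rule has_derivative_from_quadratic[where C = "\<Lambda>\<^sup>2"])
      fix t :: real assume t: "0 \<le> t"
      have "\<bar>expect (pois (\<Lambda> * t)) b - (b 0 + \<Lambda> * t * (b 1 - b 0))\<bar> \<le> (\<Lambda> * t)\<^sup>2"
        using t \<Lambda> by (intro unif_bounds) (auto simp: b_def pmf_le_1)
      moreover have z: "pmf (unif \<kappa> \<Lambda> 0 x) y = b 0"
        by (simp add: unif_def pois_def bind_return_pmf b_def)
      moreover have e: "\<Lambda> * t * (b 1 - b 0) = t * ?G" unfolding b1 using \<Lambda> by simp
      ultimately show "\<bar>pmf (unif \<kappa> \<Lambda> t x) y - pmf (unif \<kappa> \<Lambda> 0 x) y - t * ?G\<bar> \<le> \<Lambda>\<^sup>2 * t\<^sup>2"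
        unfolding z p[of t] e power_mult_distrib diff_diff_eq by blast
    qed
  qed
  then show ?thesis by (rule that)
qed

end

section \<open>Transition functions with bounded rates\<close>

text \<open>An arbitrary transition function with the given rates, not just the one built by
  uniformization. Its derivative is known at time 0 only, and separately for each pair of states;
  the aim is the bound \<open>p_approx\<close>, uniform in the state.\<close>

locale queue_transition = queue_system +
  fixes p :: "real \<Rightarrow> (nat \<Rightarrow> nat) \<Rightarrow> (nat \<Rightarrow> nat) pmf"
  assumes trans: "transition_function (states n) (queue_rate n l f) p"
begin

lemma p_sub: "0 \<le> t \<Longrightarrow> x \<in> states n \<Longrightarrow> set_pmf (p t x) \<subseteq> states n"
  using trans by (simp add: transition_function_def)

lemma p_zero: "x \<in> states n \<Longrightarrow> p 0 x = return_pmf x"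
  using trans by (simp add: transition_function_def)

lemma p_add: "0 \<le> s \<Longrightarrow> 0 \<le> t \<Longrightarrow> x \<in> states n \<Longrightarrow> p (s + t) x = bind_pmf (p s x) (p t)"
  using trans by (simp add: transition_function_def)

lemma p_difference_quotient:
  assumes x: "x \<in> states n" and y: "y \<in> states n" and h: "0 < h"
  shows "(\<lambda>m. real (Suc m) * (pmf (p (h / real (Suc m)) x) y - indicator {y} x)) \<longlonglongrightarrow>
    h * gen n l f (indicator {y}) x"
proof -
  let ?G = "gen n l f (indicator {y}) x"
  have "((\<lambda>t. pmf (p t x) y) has_real_derivative ?G) (at 0 within {0..})"
    using trans x y unfolding transition_function_def generator_gen[OF x y, symmetric] by blast
  then have lim: "((\<lambda>t. (pmf (p t x) y - pmf (p 0 x) y) / (t - 0)) \<longlongrightarrow> ?G) (at 0 within {0..})"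
    unfolding has_field_derivative_iff .
  have "filterlim (\<lambda>m. h / real (Suc m)) (at 0 within {0..}) sequentially"
  proof (rule filterlim_at[THEN iffD2], intro conjI)
    show "\<forall>\<^sub>F m in sequentially. h / real (Suc m) \<in> {0..} \<and> h / real (Suc m) \<noteq> 0"
      using h by (intro always_eventually) auto
    show "(\<lambda>m. h / real (Suc m)) \<longlonglongrightarrow> 0"
      unfolding divide_inverse by (rule tendsto_mult_right_zero[OF LIMSEQ_inverse_real_of_nat])
  qed
  from filterlim_compose[OF lim this]
  have "(\<lambda>m. h * ((pmf (p (h / real (Suc m)) x) y - pmf (p 0 x) y) / (h / real (Suc m)))) \<longlonglongrightarrow> h * ?G"
    by (intro tendsto_mult_left) simp
  moreover have "pmf (p 0 x) y = indicator {y} x" using p_zero[OF x] by (simp add: indicator_def)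
  moreover have "h * (a / (h / real (Suc m))) = real (Suc m) * a" for a m using h by simp
  ultimately show ?thesis by (simp only:)
qed

lemma p_add_ge:
  assumes "0 \<le> s" "0 \<le> t" "x \<in> states n" "finite F"
  shows "(\<Sum>z\<in>F. pmf (p s x) z * pmf (p t z) y) \<le> pmf (p (s + t) x) y"
  unfolding p_add[OF assms(1-3)] pmf_bind
  by (rule expect_ge_finite[where c = 1]) (auto simp: pmf_le_1 assms)

text \<open>Being at \<open>x\<close> at all \<open>m\<close> grid points is one way of being there
  at the end, so \<open>pmf (p s x) x ^ m\<close> is a lower bound. Bernoulli's inequality makes it
  linear, and refining the grid brings in the derivative at 0.\<close>

lemma p_stay:
  assumes x: "x \<in> states n" and h: "0 \<le> h"
  shows "1 + h * gen n l f (indicator {x}) x \<le> pmf (p h x) x"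
proof (cases "h = 0")
  case True then show ?thesis using p_zero[OF x] by simp
next
  case False
  then have h: "0 < h" using h by simp
  have pow: "pmf (p s x) x ^ m \<le> pmf (p (real m * s) x) x" if "0 \<le> s" for s m
  proof (induction m)
    case (Suc m)
    have "pmf (p s x) x ^ Suc m \<le> (\<Sum>z\<in>{x}. pmf (p s x) z * pmf (p (real m * s) z) x)"
      using Suc by (simp add: mult_left_mono)
    also have "\<dots> \<le> pmf (p (s + real m * s) x) x" using that x by (intro p_add_ge) auto
    finally show ?case by (simp add: algebra_simps)
  qed (simp add: p_zero[OF x])
  have "1 + real (Suc m) * (pmf (p (h / real (Suc m)) x) x - indicator {x} x) \<le> pmf (p h x) x" for m
  proof -
    have "1 + real (Suc m) * (pmf (p (h / real (Suc m)) x) x - 1) \<le> (1 + (pmf (p (h / real (Suc m)) x) x - 1)) ^ Suc m"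
      by (rule Bernoulli_inequality) simp
    also have "\<dots> \<le> pmf (p (real (Suc m) * (h / real (Suc m))) x) x"
      using pow[of "h / real (Suc m)" "Suc m"] h by simp
    finally show ?thesis by simp
  qed
  then show ?thesis
    by (intro LIMSEQ_le_const2[OF tendsto_add[OF tendsto_const p_difference_quotient[OF x x h]]]) auto
qed

lemma p_stay': "x \<in> states n \<Longrightarrow> 0 \<le> h \<Longrightarrow> 1 - 2 * R * h \<le> pmf (p h x) x"
proof -
  assume x: "x \<in> states n" and h: "0 \<le> h"
  have "h * (- (2 * R)) \<le> h * gen n l f (indicator {x}) x"
    using gen_indicator_bound[OF x, of x] h by (intro mult_left_mono) auto
  then show ?thesis using p_stay[OF x h] by (simp add: algebra_simps)
qed

text \<open>On a grid of \<open>m\<close> slots the jump may occur in any slot, with a stay at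
  \<open>x\<close> before and at \<open>y\<close> after, both bounded by \<open>p_stay'\<close>. The
  induction splits off the first slot; refinement again yields the derivative.\<close>

lemma p_jump:
  assumes x: "x \<in> states n" and y: "y \<in> states n" and xy: "x \<noteq> y" and h: "0 \<le> h"
  shows "h * gen n l f (indicator {y}) x * (1 - 2 * R * h) \<le> pmf (p h x) y"
proof (cases "h = 0")
  case False
  then have h: "0 < h" using h by simp
  have lin: "real m * pmf (p s x) y * (1 - 2 * R * (real m * s)) \<le> pmf (p (real m * s) x) y" if s: "0 \<le> s" for s m
  proof (induction m)
    case (Suc m)
    let ?v = "pmf (p s x) y"
    show ?case
    proof (cases "2 * R * (real (Suc m) * s) \<le> 1")
      case True
      have Rs: "0 \<le> R * s" using R_nonneg s by simp
      have *: "2 * R * (real m * s) + 2 * R * s \<le> 1" using True by (simp add: algebra_simps)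
      have Rms: "0 \<le> 2 * R * (real m * s)" using R_nonneg s by simp
      have "real m * (1 - 2 * R * (real (Suc m) * s)) \<le> real m * ((1 - 2 * R * s) * (1 - 2 * R * (real m * s)))"
      proof (rule mult_left_mono)
        have "0 \<le> 2 * R * s" using R_nonneg s by simp
        then have "0 \<le> (2 * R * s) * (2 * R * (real m * s))" using Rms by (rule mult_nonneg_nonneg)
        then show "1 - 2 * R * (real (Suc m) * s) \<le> (1 - 2 * R * s) * (1 - 2 * R * (real m * s))"
          by (simp add: algebra_simps)
      qed simp
      moreover have "1 - 2 * R * (real (Suc m) * s) \<le> 1 - 2 * R * (real m * s)" using Rs by (simp add: algebra_simps)
      ultimately have "real (Suc m) * (1 - 2 * R * (real (Suc m) * s)) \<le>
          real m * ((1 - 2 * R * s) * (1 - 2 * R * (real m * s))) + (1 - 2 * R * (real m * s))"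
        unfolding of_nat_Suc[of m] distrib_right mult_1 by linarith
      from mult_left_mono[OF this, of ?v]
      have "real (Suc m) * ?v * (1 - 2 * R * (real (Suc m) * s)) \<le>
          (1 - 2 * R * s) * (real m * ?v * (1 - 2 * R * (real m * s))) + ?v * (1 - 2 * R * (real m * s))"
        by (simp add: algebra_simps)
      also have "\<dots> \<le> pmf (p s x) x * pmf (p (real m * s) x) y + ?v * pmf (p (real m * s) y) y"
      proof -
        have nn: "0 \<le> 1 - 2 * R * (real m * s)" using * Rs by linarith
        show ?thesis
        proof (intro add_mono mult_mono mult_left_mono Suc)
          show "1 - 2 * R * s \<le> pmf (p s x) x" by (rule p_stay'[OF x s])
          show "1 - 2 * R * (real m * s) \<le> pmf (p (real m * s) y) y" using s by (intro p_stay' y) simp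
          show "0 \<le> real m * ?v * (1 - 2 * R * (real m * s))" using nn by (intro mult_nonneg_nonneg) auto
        qed (use nn in auto)
      qed
      also have "\<dots> = (\<Sum>z\<in>{x, y}. pmf (p s x) z * pmf (p (real m * s) z) y)" using xy by simp
      also have "\<dots> \<le> pmf (p (s + real m * s) x) y" using s x by (intro p_add_ge) auto
      finally show ?thesis by (simp add: algebra_simps)
    next
      case False
      then have "real (Suc m) * ?v * (1 - 2 * R * (real (Suc m) * s)) \<le> 0"
        by (intro mult_nonneg_nonpos) auto
      then show ?thesis by (rule order_trans) simp
    qed
  qed simp
  have "real (Suc m) * (pmf (p (h / real (Suc m)) x) y - indicator {y} x) * (1 - 2 * R * h) \<le> pmf (p h x) y" for m
    using lin[of "h / real (Suc m)" "Suc m"] h xy by (simp add: mult.commute[of _ h] del: of_nat_Suc)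
  then show ?thesis
    by (intro LIMSEQ_le_const2[OF tendsto_mult[OF p_difference_quotient[OF x y h] tendsto_const]]) auto
qed simp

text \<open>For nonnegative \<open>g\<close> it suffices to count the neighbours of
  \<open>x\<close>, by \<open>p_stay\<close> and \<open>p_jump\<close>. The factor
  \<open>1 - 2 * R * h\<close> in the latter costs a term quadratic in \<open>h\<close>. In
  \<open>p_approx\<close> the bound is used for both \<open>c + g\<close> and
  \<open>c - g\<close>.\<close>

lemma p_lower:
  assumes x: "x \<in> states n" and h: "0 \<le> h" and g: "\<And>y. y \<in> states n \<Longrightarrow> 0 \<le> g y" "\<And>y. y \<in> states n \<Longrightarrow> g y \<le> c"
  shows "g x + h * gen n l f g x - (2 * R * h)\<^sup>2 * c \<le> expect (p h x) g"
proof -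
  let ?G = "\<lambda>y. gen n l f (indicator {y}) x" and ?F = "nbrs n x - {x}"
  have Fst: "y \<in> states n" "x \<noteq> y" if "y \<in> ?F" for y using that nbrs_states[OF x] by auto
  have c0: "0 \<le> c" using g x by force
  have "(\<Sum>y\<in>?F. ?G y * g y) \<le> (\<Sum>y\<in>?F. ?G y * c)"
    using Fst gen_indicator_nonneg[OF x] g by (intro sum_mono mult_left_mono) auto
  also have "\<dots> = (- ?G x) * c" by (simp add: sum_distrib_right[symmetric] gen_indicator_sum[OF x])
  also have "\<dots> \<le> (2 * R) * c" using gen_indicator_bound[OF x, of x] c0 by (intro mult_right_mono) auto
  finally have sum_le: "(\<Sum>y\<in>?F. ?G y * g y) \<le> 2 * R * c" .
  have "gen n l f g x = g x * ?G x + (\<Sum>y\<in>?F. g y * ?G y)"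
    unfolding gen_expand[OF x, of g] by (rule sum.remove[OF finite_nbrs self_nbrs])
  then have gen_eq: "gen n l f g x = ?G x * g x + (\<Sum>y\<in>?F. ?G y * g y)" by (simp add: mult.commute)
  have "h * (2 * R * h) * (\<Sum>y\<in>?F. ?G y * g y) \<le> h * (2 * R * h) * (2 * R * c)"
    using sum_le h R_nonneg by (intro mult_left_mono) auto
  then have "g x + h * gen n l f g x - (2 * R * h)\<^sup>2 * c
      \<le> g x + h * gen n l f g x - h * (2 * R * h) * (\<Sum>y\<in>?F. ?G y * g y)"
    by (simp add: power2_eq_square algebra_simps)
  also have "\<dots> = (1 + h * ?G x) * g x + h * (1 - 2 * R * h) * (\<Sum>y\<in>?F. ?G y * g y)"
    unfolding gen_eq by (simp add: algebra_simps)
  also have "\<dots> = (1 + h * ?G x) * g x + (\<Sum>y\<in>?F. (h * ?G y * (1 - 2 * R * h)) * g y)"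
    by (simp add: sum_distrib_left algebra_simps)
  also have "\<dots> \<le> pmf (p h x) x * g x + (\<Sum>y\<in>?F. pmf (p h x) y * g y)"
    using p_stay[OF x h] p_jump[OF x _ _ h] g x Fst
    by (intro add_mono sum_mono mult_right_mono) auto
  also have "\<dots> = (\<Sum>y\<in>nbrs n x. pmf (p h x) y * g y)"
    by (rule sum.remove[OF finite_nbrs self_nbrs, symmetric])
  also have "\<dots> \<le> expect (p h x) g"
    using p_sub[OF h x] g by (intro expect_ge_finite[where c = c] finite_nbrs) auto
  finally show ?thesis .
qed

lemma p_approx:
  assumes x: "x \<in> states n" and h: "0 \<le> h" and g: "\<And>y. y \<in> states n \<Longrightarrow> \<bar>g y\<bar> \<le> c"
  shows "\<bar>expect (p h x) g - (g x + h * gen n l f g x)\<bar> \<le> 2 * (2 * R * h)\<^sup>2 * c"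
proof -
  have int: "integrable (p h x) g" using p_sub[OF h x] g by (intro integrable_bdd[where c = c]) auto
  have g': "- c \<le> g y" "g y \<le> c" if "y \<in> states n" for y using g[OF that] by auto
  have 1: "(g x + c) + h * gen n l f (\<lambda>y. g y + c) x - (2 * R * h)\<^sup>2 * (2 * c) \<le> expect (p h x) (\<lambda>y. g y + c)"
    using g' by (intro p_lower x h) force+
  have 2: "(- 1 * g x + c) + h * gen n l f (\<lambda>y. - 1 * g y + c) x - (2 * R * h)\<^sup>2 * (2 * c) \<le> expect (p h x) (\<lambda>y. - 1 * g y + c)"
    using g' by (intro p_lower x h) force+
  show ?thesis using 1 2 int unfolding gen_add gen_const gen_cmult by (simp add: abs_le_iff algebra_simps)
qed

lemma p_bound:
  assumes x: "x \<in> states n" and t: "0 \<le> t" and g: "\<And>y. y \<in> states n \<Longrightarrow> \<bar>g y\<bar> \<le> c"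
  shows "\<bar>expect (p t x) g\<bar> \<le> c"
  using p_sub[OF t x] g by (intro expect_abs_le) auto

lemma p_semigroup:
  assumes x: "x \<in> states n" and st: "0 \<le> s" "0 \<le> t" and g: "\<And>y. y \<in> states n \<Longrightarrow> \<bar>g y\<bar> \<le> c"
  shows "expect (p (s + t) x) g = expect (p s x) (\<lambda>z. expect (p t z) g)"
  unfolding p_add[OF st x] using p_sub[of "s + t" x] st x g unfolding p_add[OF st x, symmetric]
  by (subst p_add[OF st x], intro expect_bind[where c = c]) (auto simp: p_add)

lemma bind_expect:
  assumes \<nu>: "set_pmf \<nu> \<subseteq> states n" and t: "0 \<le> t" and g: "\<And>y. y \<in> states n \<Longrightarrow> \<bar>g y\<bar> \<le> c"
  shows "expect (bind_pmf \<nu> (p t)) g = expect \<nu> (\<lambda>z. expect (p t z) g)"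
  using \<nu> p_sub[OF t] g by (intro expect_bind[where c = c]) (auto simp: set_bind_pmf)

lemma bind_sub: "set_pmf \<nu> \<subseteq> states n \<Longrightarrow> 0 \<le> t \<Longrightarrow> set_pmf (bind_pmf \<nu> (p t)) \<subseteq> states n"
  using p_sub by (auto simp: set_bind_pmf)

lemma bind_increment:
  assumes \<nu>: "set_pmf \<nu> \<subseteq> states n" and h: "0 \<le> h" and g: "\<And>y. y \<in> states n \<Longrightarrow> \<bar>g y\<bar> \<le> c"
  shows "\<bar>expect (bind_pmf \<nu> (p h)) g - (expect \<nu> g + h * expect \<nu> (gen n l f g))\<bar> \<le> 2 * (2 * R * h)\<^sup>2 * c"
proof -
  have i: "integrable \<nu> g" "integrable \<nu> (gen n l f g)" "integrable \<nu> (\<lambda>z. expect (p h z) g)"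
    using \<nu> g gen_bound[where g = g, OF _ g] p_bound[where g = g, OF _ h g]
    by (auto intro!: integrable_bdd[where c = c] integrable_bdd[where c = "2 * c * R" and g = "gen n l f g"])
  have "expect (bind_pmf \<nu> (p h)) g - (expect \<nu> g + h * expect \<nu> (gen n l f g))
      = expect \<nu> (\<lambda>z. expect (p h z) g - (g z + h * gen n l f g z))"
    using i by (simp add: bind_expect[OF \<nu> h g])
  also have "\<bar>\<dots>\<bar> \<le> 2 * (2 * R * h)\<^sup>2 * c"
    using \<nu> p_approx[where g = g, OF _ h g] by (intro expect_abs_le) auto
  finally show ?thesis .
qed

lemma stationary_imp_invariant:
  assumes \<pi>: "set_pmf \<pi> \<subseteq> states n" and st: "\<And>t. 0 \<le> t \<Longrightarrow> bind_pmf \<pi> (p t) = \<pi>"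
  shows "invariant n l f \<pi>"
  unfolding invariant_def
proof (intro conjI \<pi> allI impI)
  fix g :: "(nat \<Rightarrow> nat) \<Rightarrow> real" assume g: "\<forall>x. \<bar>g x\<bar> \<le> 1"
  let ?e = "\<bar>expect \<pi> (gen n l f g)\<bar>"
  have b: "?e \<le> (8 * R\<^sup>2) * h" if h: "0 < h" for h
  proof -
    have "\<bar>h * expect \<pi> (gen n l f g)\<bar> \<le> 2 * (2 * R * h)\<^sup>2 * 1"
      using bind_increment[OF \<pi>, of h g 1] st[of h] h g by simp
    then have "h * ?e \<le> h * ((8 * R\<^sup>2) * h)" using h by (simp add: abs_mult power2_eq_square algebra_simps)
    then show ?thesis using h by simp
  qed
  have "?e \<le> 0 + \<epsilon>" if "0 < \<epsilon>" for \<epsilon>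
  proof -
    have "(8 * R\<^sup>2) * (\<epsilon> / (8 * R\<^sup>2 + 1)) \<le> \<epsilon>"
      using that by (simp add: divide_simps add_nonneg_pos)
    then show ?thesis using b[of "\<epsilon> / (8 * R\<^sup>2 + 1)"] that
      by (simp add: add_nonneg_pos)
  qed
  then have "?e \<le> 0" by (rule field_le_epsilon)
  then show "expect \<pi> (gen n l f g) = 0" by simp
qed

lemma quadratic_small: "(\<lambda>m. real (Suc m) * (C * (t / real (Suc m))\<^sup>2)) \<longlonglongrightarrow> 0"
proof -
  have "real (Suc m) * (C * (t / real (Suc m))\<^sup>2) = (C * t\<^sup>2) * inverse (real (Suc m))" for m
    unfolding power2_eq_square by (simp add: field_simps del: of_nat_Suc)
  then show ?thesis by (simp only:) (intro tendsto_mult_right_zero LIMSEQ_inverse_real_of_nat)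
qed

text \<open>Cut \<open>t\<close> into equal steps: by invariance each step changes an expectation
  only by a quadratic error, and the sum of these errors vanishes as the steps shrink.\<close>

lemma invariant_imp_stationary:
  assumes inv: "invariant n l f \<pi>" and t: "0 \<le> t"
  shows "bind_pmf \<pi> (p t) = \<pi>"
proof (rule pmf_eqI_expect)
  fix g :: "(nat \<Rightarrow> nat) \<Rightarrow> real" assume g: "\<And>x. \<bar>g x\<bar> \<le> 1"
  have \<pi>: "set_pmf \<pi> \<subseteq> states n" using inv by (simp add: invariant_def)
  have step: "\<bar>expect (bind_pmf \<pi> (p (real m * s))) g - expect \<pi> g\<bar> \<le> real m * (8 * R\<^sup>2 * s\<^sup>2)" if s: "0 \<le> s" for m s
  proof (induction m)
    case 0
    have "bind_pmf \<pi> (p 0) = bind_pmf \<pi> return_pmf" using \<pi> p_zero by (intro bind_pmf_cong) auto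
    then show ?case by (simp add: bind_return_pmf')
  next
    case (Suc m)
    let ?g = "\<lambda>z. expect (p (real m * s) z) g"
    have gb: "\<bar>?g y\<bar> \<le> 1" if "y \<in> states n" for y using p_bound[OF that, of "real m * s" g 1] s g by simp
    have "expect (bind_pmf \<pi> (p (real (Suc m) * s))) g = expect \<pi> (\<lambda>z. expect (p (s + real m * s) z) g)"
      using bind_expect[OF \<pi>, of "real (Suc m) * s" g 1] s g by (simp add: algebra_simps)
    also have "\<dots> = expect \<pi> (\<lambda>z. expect (p s z) ?g)"
      using \<pi> s g by (intro expect_cong p_semigroup[where c = 1]) auto
    also have "\<dots> = expect (bind_pmf \<pi> (p s)) ?g" using bind_expect[OF \<pi> s gb] by simp
    finally have 1: "expect (bind_pmf \<pi> (p (real (Suc m) * s))) g = expect (bind_pmf \<pi> (p s)) ?g" .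
    have 2: "expect \<pi> ?g = expect (bind_pmf \<pi> (p (real m * s))) g"
      using bind_expect[OF \<pi>, of "real m * s" g 1] s g by simp
    have "\<bar>expect (bind_pmf \<pi> (p s)) ?g - expect \<pi> ?g\<bar> \<le> 8 * R\<^sup>2 * s\<^sup>2"
      using bind_increment[OF \<pi> s gb] invariant_gen[OF inv gb] by (simp add: power2_eq_square algebra_simps)
    then show ?case using Suc unfolding 1 2 by (simp add: distrib_right)
  qed
  have "\<bar>expect (bind_pmf \<pi> (p t)) g - expect \<pi> g\<bar> \<le> real (Suc m) * (8 * R\<^sup>2 * (t / real (Suc m))\<^sup>2)" for m
    using step[of "t / real (Suc m)" "Suc m"] t by simp
  then have "\<bar>expect (bind_pmf \<pi> (p t)) g - expect \<pi> g\<bar> \<le> 0"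
    by (intro LIMSEQ_le_const[OF quadratic_small]) blast
  then show "expect (bind_pmf \<pi> (p t)) g = expect \<pi> g" by simp
qed

end

text \<open>Stationarity is an existence statement over transition functions: one direction works
  for any of them, the other takes the one from uniformization.\<close>

lemma (in queue_system) stationary_iff_invariant:
  "stationary_distribution (states n) (queue_rate n l f) \<pi> \<longleftrightarrow> invariant n l f \<pi>"
proof
  assume "stationary_distribution (states n) (queue_rate n l f) \<pi>"
  then obtain p where tr: "transition_function (states n) (queue_rate n l f) p" and
    st: "set_pmf \<pi> \<subseteq> states n" "\<And>t. 0 \<le> t \<Longrightarrow> bind_pmf \<pi> (p t) = \<pi>"
    by (auto simp: stationary_distribution_def)
  interpret queue_transition n l f B p using tr by unfold_locales
  show "invariant n l f \<pi>" by (rule stationary_imp_invariant[OF st])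
next
  assume inv: "invariant n l f \<pi>"
  obtain p where "transition_function (states n) (queue_rate n l f) p" by (rule transition_function_exists)
  then interpret queue_transition n l f B p by unfold_locales
  show "stationary_distribution (states n) (queue_rate n l f) \<pi>"
    unfolding stationary_distribution_def using inv trans invariant_imp_stationary[OF inv]
    by (auto simp: invariant_def)
qed

section \<open>Stability of the Markov process\<close>

text \<open>A countable range makes the distribution discrete: almost surely the value avoids the
  countably many points of measure 0, which is what \<open>Abs_pmf\<close> requires.\<close>

lemma random_variable_pmf:
  assumes "prob_space M" and Y: "Y \<in> M \<rightarrow>\<^sub>M count_space S" and S: "countable S"
  obtains \<nu> where "set_pmf \<nu> \<subseteq> S" "\<And>A. measure_pmf.prob \<nu> A = \<P>(\<omega> in M. Y \<omega> \<in> A)"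
proof -
  interpret prob_space M by fact
  define D where "D = distr M (count_space UNIV) Y"
  have Y': "Y \<in> M \<rightarrow>\<^sub>M count_space UNIV"
    by (rule measurable_compose[OF Y]) simp
  have D: "measure D A = \<P>(\<omega> in M. Y \<omega> \<in> A)" for A
    unfolding D_def by (subst measure_distr[OF Y']) (auto intro!: arg_cong[where f = prob])
  have ev: "{\<omega> \<in> space M. Y \<omega> \<in> A} \<in> events" for A
    using measurable_sets[OF Y', of A] by (simp add: vimage_def Int_def conj_commute)
  have "AE \<omega> in M. \<forall>x\<in>{x \<in> S. measure D {x} = 0}. Y \<omega> \<noteq> x"
  proof (subst AE_ball_countable)
    show "countable {x \<in> S. measure D {x} = 0}" using S by (rule countable_subset[rotated]) auto
    show "\<forall>x\<in>{x \<in> S. measure D {x} = 0}. AE \<omega> in M. Y \<omega> \<noteq> x"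
    proof
      fix x assume "x \<in> {x \<in> S. measure D {x} = 0}"
      then have "prob {\<omega> \<in> space M. Y \<omega> \<in> {x}} = 0" using D by simp
      then have "AE \<omega> in M. \<omega> \<notin> {\<omega> \<in> space M. Y \<omega> \<in> {x}}" using prob_eq_0[OF ev[of "{x}"]] by (simp only:)
      then show "AE \<omega> in M. Y \<omega> \<noteq> x" by (rule AE_mp) (rule AE_I2, auto)
    qed
  qed
  moreover have "AE \<omega> in M. Y \<omega> \<in> S" using measurable_space[OF Y] by (intro AE_I2) auto
  ultimately have "AE \<omega> in M. measure D {Y \<omega>} \<noteq> 0" by eventually_elim auto
  then have "AE x in D. measure D {x} \<noteq> 0" unfolding D_def by (subst AE_distr_iff[OF Y']) auto
  moreover have "prob_space D" unfolding D_def by (rule prob_space_distr[OF Y'])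
  moreover have "sets D = UNIV" by (simp add: D_def)
  ultimately have "measure_pmf (Abs_pmf D) = D" by (intro Abs_pmf_inverse) simp
  then have pr: "measure_pmf.prob (Abs_pmf D) A = \<P>(\<omega> in M. Y \<omega> \<in> A)" for A using D by simp
  have "set_pmf (Abs_pmf D) \<subseteq> S"
  proof
    fix x assume "x \<in> set_pmf (Abs_pmf D)"
    then have "\<P>(\<omega> in M. Y \<omega> \<in> {x}) \<noteq> 0" by (simp add: set_pmf_iff pr flip: measure_pmf_single)
    then have "{\<omega> \<in> space M. Y \<omega> \<in> {x}} \<noteq> {}" by (metis measure_empty)
    then show "x \<in> S" using measurable_space[OF Y] by auto
  qed
  then show ?thesis using pr by (rule that)
qed

text \<open>The joint law of \<open>(X 0, X t)\<close> is identified point by point. Conditional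
  probabilities give it where \<open>pmf \<nu> x\<close> is positive; elsewhere both sides vanish.
  Its second marginal is the law of \<open>X t\<close>.\<close>

lemma markov_process_law:
  assumes mp: "markov_process M S q X" and S: "countable S"
  obtains p \<nu> where "transition_function S q p" "set_pmf \<nu> \<subseteq> S"
    "\<And>t A. 0 \<le> t \<Longrightarrow> measure_pmf.prob (bind_pmf \<nu> (p t)) A = \<P>(\<omega> in M. X t \<omega> \<in> A)"
proof -
  from mp have M: "prob_space M" and X: "\<And>t. 0 \<le> t \<Longrightarrow> X t \<in> M \<rightarrow>\<^sub>M count_space S"
    unfolding markov_process_def by auto
  interpret prob_space M by (rule M)
  from mp obtain p where p: "transition_function S q p"
    and cond: "\<forall>s\<ge>0. \<forall>t\<ge>0. \<forall>x\<in>S. \<forall>y\<in>S. \<forall>J z. finite J \<longrightarrow> J \<subseteq> {0..<s} \<longrightarrow>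
          0 < \<P>(\<omega> in M. X s \<omega> = x \<and> (\<forall>r\<in>J. X r \<omega> = z r)) \<longrightarrow>
          \<P>(\<omega> in M. X (s + t) \<omega> = y \<bar> X s \<omega> = x \<and> (\<forall>r\<in>J. X r \<omega> = z r)) = pmf (p t x) y"
    unfolding markov_process_def by blast
  obtain \<nu> where \<nu>: "set_pmf \<nu> \<subseteq> S" "\<And>A. measure_pmf.prob \<nu> A = \<P>(\<omega> in M. X 0 \<omega> \<in> A)"
    by (rule random_variable_pmf[OF M X S, of 0]) auto
  show ?thesis
  proof (rule that[OF p \<nu>(1)])
    fix t :: real and A assume t: "0 \<le> t"
    have "(\<lambda>\<omega>. (X 0 \<omega>, X t \<omega>)) \<in> M \<rightarrow>\<^sub>M count_space (S \<times> S)"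
      unfolding pair_measure_countable[OF S S, symmetric] using t by (intro measurable_Pair X) auto
    from random_variable_pmf[OF M this countable_SIGMA[OF S S]]
    obtain J where J: "set_pmf J \<subseteq> S \<times> S"
      "\<And>A. measure_pmf.prob J A = \<P>(\<omega> in M. (X 0 \<omega>, X t \<omega>) \<in> A)" by blast
    have pS: "set_pmf (p t x) \<subseteq> S" if "x \<in> S" for x
      using p t that by (simp add: transition_function_def)
    have "J = bind_pmf \<nu> (\<lambda>x. map_pmf (Pair x) (p t x))"
    proof (rule pmf_eqI)
      fix xy :: "'b \<times> 'b"
      obtain x y where xy: "xy = (x, y)" by (cases xy)
      have inner: "pmf (map_pmf (Pair z) (p t z)) (x, y) = (if z = x then pmf (p t x) y else 0)" for z
      proof (cases "z = x")
        case True
        have "pmf (map_pmf (Pair x) (p t x)) (Pair x y) = pmf (p t x) y"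
          by (rule pmf_map_inj') (simp add: inj_def)
        then show ?thesis using True by simp
      next
        case False
        then have "(x, y) \<notin> set_pmf (map_pmf (Pair z) (p t z))" by auto
        then have "pmf (map_pmf (Pair z) (p t z)) (x, y) = 0" by (simp only: set_pmf_iff not_not)
        then show ?thesis using False by simp
      qed
      have rhs: "pmf (bind_pmf \<nu> (\<lambda>x. map_pmf (Pair x) (p t x))) (x, y) = pmf (p t x) y * pmf \<nu> x"
        unfolding pmf_bind inner
        by (subst integral_measure_pmf_real[of "{x}"]) (auto split: if_splits)
      have lhs: "pmf J (x, y) = \<P>(\<omega> in M. X 0 \<omega> = x \<and> X t \<omega> = y)"
        using J(2)[of "{(x, y)}"] by (simp add: measure_pmf_single)
      have \<nu>x: "pmf \<nu> x = \<P>(\<omega> in M. X 0 \<omega> = x)" using \<nu>(2)[of "{x}"] by (simp add: measure_pmf_single)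
      have "pmf J (x, y) = pmf (p t x) y * pmf \<nu> x"
      proof (cases "pmf \<nu> x = 0")
        case True
        have "pmf J (x, y) \<le> measure_pmf.prob J (fst -` {x})"
          unfolding measure_pmf_single[symmetric] by (rule measure_pmf.finite_measure_mono) auto
        also have "\<dots> = pmf \<nu> x" unfolding J(2) \<nu>x by (auto intro!: arg_cong[where f = prob])
        finally show ?thesis using True pmf_nonneg[of J "(x, y)"] by simp
      next
        case False
        then have x: "x \<in> S" using \<nu>(1) by (auto simp: set_pmf_iff)
        show ?thesis
        proof (cases "y \<in> S")
          case y: True
          have "0 < \<P>(\<omega> in M. X 0 \<omega> = x)" using False unfolding \<nu>x[symmetric] by (simp add: pmf_pos)
          then have "\<P>(\<omega> in M. X (0 + t) \<omega> = y \<bar> X 0 \<omega> = x \<and> (\<forall>r\<in>{}. X r \<omega> = undefined r)) = pmf (p t x) y"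
            using t x y by (intro cond[rule_format]) auto
          then have "\<P>(\<omega> in M. X t \<omega> = y \<and> X 0 \<omega> = x) / \<P>(\<omega> in M. X 0 \<omega> = x) = pmf (p t x) y"
            by (simp add: cond_prob_def)
          then show ?thesis using False unfolding lhs \<nu>x by (simp add: field_simps conj_commute)
        next
          case False
          then have "(x, y) \<notin> set_pmf J" "y \<notin> set_pmf (p t x)" using J(1) pS[OF x] by auto
          then show ?thesis by (simp add: set_pmf_iff)
        qed
      qed
      then show "pmf J xy = pmf (bind_pmf \<nu> (\<lambda>x. map_pmf (Pair x) (p t x))) xy" unfolding xy rhs .
    qed
    then have "map_pmf snd J = bind_pmf \<nu> (p t)"
      by (simp add: map_bind_pmf map_pmf_comp)
    then have "measure_pmf.prob (bind_pmf \<nu> (p t)) A = measure_pmf.prob J (snd -` A)"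
      using measure_map_pmf[of snd J A] by simp
    then show "measure_pmf.prob (bind_pmf \<nu> (p t)) A = \<P>(\<omega> in M. X t \<omega> \<in> A)"
      unfolding J(2) by simp
  qed
qed

context queue_transition
begin

text \<open>Krylov-Bogoliubov argument: time averages of a tight family have a limit point, and it
  is invariant. Finite sums over a time grid replace integrals over time.\<close>

lemma invariant_of_tight:
  assumes \<nu>: "set_pmf \<nu> \<subseteq> states n"
    and tight: "\<And>\<epsilon>. 0 < \<epsilon> \<Longrightarrow> \<exists>K. finite K \<and> (\<forall>t\<ge>0. measure_pmf.prob (bind_pmf \<nu> (p t)) (- K) \<le> \<epsilon>)"
  obtains \<mu> where "invariant n l f \<mu>"
proof -
  define D where "D t = bind_pmf \<nu> (p t)" for t
  have Dsub: "set_pmf (D t) \<subseteq> states n" if "0 \<le> t" for t unfolding D_def by (rule bind_sub[OF \<nu> that])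
  \<comment> \<open>Mesh \<open>1 / (k + 1)\<close> and horizon \<open>k + 1\<close>: the
    accumulated discretization error stays below \<open>8 * R\<^sup>2\<close>, and dividing by the
    growing horizon removes it.\<close>
  define A where "A k = bind_pmf (pmf_of_set {..<(Suc k)\<^sup>2}) (\<lambda>j. D (real j / real (Suc k)))" for k
  have ne: "{..<(Suc k)\<^sup>2} \<noteq> {}" for k by (simp add: lessThan_empty_iff)
  have Asub: "set_pmf (A k) \<subseteq> states n" for k
  proof -
    have "set_pmf (D (real j / real (Suc k))) \<subseteq> states n" for j by (rule Dsub) simp
    then show ?thesis unfolding A_def set_bind_pmf by blast
  qed
  have A: "expect (A k) g = (\<Sum>j<(Suc k)\<^sup>2. expect (D (real j / real (Suc k))) g) / real ((Suc k)\<^sup>2)"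
    if g: "\<And>x. x \<in> states n \<Longrightarrow> \<bar>g x\<bar> \<le> c" for g c k
  proof -
    have "expect (A k) g = expect (pmf_of_set {..<(Suc k)\<^sup>2}) (\<lambda>j. expect (D (real j / real (Suc k))) g)"
      unfolding A_def using Asub[of k] g by (intro expect_bind[where c = c]) (auto simp: A_def)
    then show ?thesis by (simp only: integral_pmf_of_set[OF ne finite_lessThan] card_lessThan)
  qed
  have "\<exists>F. finite F \<and> (\<forall>k. measure_pmf.prob (A k) (- F) \<le> \<epsilon>)" if e: "0 < \<epsilon>" for \<epsilon>
  proof -
    obtain K where K: "finite K" "\<And>t. 0 \<le> t \<Longrightarrow> measure_pmf.prob (D t) (- K) \<le> \<epsilon>"
      using tight[OF e] by (auto simp: D_def)
    have "measure_pmf.prob (A k) (- K) \<le> \<epsilon>" for k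
    proof -
      have "measure_pmf.prob (A k) (- K) = expect (A k) (indicator (- K))" by simp
      also have "\<dots> = (\<Sum>j<(Suc k)\<^sup>2. expect (D (real j / real (Suc k))) (indicator (- K))) / real ((Suc k)\<^sup>2)"
        by (rule A[where c = 1]) (auto simp: indicator_def)
      also have "\<dots> \<le> (\<Sum>j<(Suc k)\<^sup>2. \<epsilon>) / real ((Suc k)\<^sup>2)"
        using K(2) by (intro divide_right_mono sum_mono) auto
      also have "\<dots> = \<epsilon>" by (simp del: of_nat_Suc)
      finally show ?thesis .
    qed
    then show ?thesis using K(1) by blast
  qed
  from tight_pmf_subsequence[OF countable_states Asub this]
  obtain r \<mu> where r: "strict_mono r" "set_pmf \<mu> \<subseteq> states n"
    and conv: "\<And>g c. (\<And>x. x \<in> states n \<Longrightarrow> \<bar>g x\<bar> \<le> c) \<Longrightarrow> (\<lambda>k. expect (A (r k)) g) \<longlonglongrightarrow> expect \<mu> g"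
    by blast
  have "invariant n l f \<mu>"
  proof (rule limit_invariant[OF r(2) conv])
    fix g :: "(nat \<Rightarrow> nat) \<Rightarrow> real" assume g: "\<And>x. \<bar>g x\<bar> \<le> 1"
    have est: "\<bar>expect (A k) (gen n l f g)\<bar> \<le> (2 + 8 * R\<^sup>2) * inverse (real (Suc k))" for k
    proof -
      let ?m = "real (Suc k)" and ?J = "(Suc k)\<^sup>2"
      define s where "s = inverse ?m"
      have s0: "0 \<le> s" by (simp add: s_def)
      define G where "G j = expect (D (real j * s)) (gen n l f g)" for j
      define E where "E j = expect (D (real j * s)) g" for j
      have inc: "\<bar>E (Suc j) - (E j + s * G j)\<bar> \<le> 8 * R\<^sup>2 * s\<^sup>2" for j
      proof -
        have "D (real (Suc j) * s) = bind_pmf \<nu> (\<lambda>x. bind_pmf (p (real j * s) x) (p s))"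
          unfolding D_def using \<nu> s0 by (intro bind_pmf_cong refl) (auto simp: p_add[symmetric] algebra_simps)
        then have "D (real (Suc j) * s) = bind_pmf (D (real j * s)) (p s)" by (simp add: D_def bind_assoc_pmf)
        then show ?thesis
          using bind_increment[OF Dsub s0, of "real j * s" g 1] g s0
          by (simp add: E_def G_def power2_eq_square algebra_simps)
      qed
      have "\<bar>E J - E 0 - s * (\<Sum>j<J. G j)\<bar> \<le> real J * (8 * R\<^sup>2 * s\<^sup>2)" for J
      proof (induction J)
        case (Suc J)
        have "E (Suc J) - E 0 - s * (\<Sum>j<Suc J. G j) =
          (E (Suc J) - (E J + s * G J)) + (E J - E 0 - s * (\<Sum>j<J. G j))" by (simp add: algebra_simps)
        then have "\<bar>E (Suc J) - E 0 - s * (\<Sum>j<Suc J. G j)\<bar> \<le> 8 * R\<^sup>2 * s\<^sup>2 + real J * (8 * R\<^sup>2 * s\<^sup>2)"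
          using inc[of J] Suc by linarith
        then show ?case by (simp add: algebra_simps)
      qed simp
      moreover have "real ?J * (8 * R\<^sup>2 * s\<^sup>2) = 8 * R\<^sup>2"
      proof -
        have "real ?J * s\<^sup>2 = 1" by (simp add: s_def power_inverse del: of_nat_Suc)
        then show ?thesis by (simp add: mult.left_commute[of "real ?J"] del: of_nat_power)
      qed
      ultimately have "\<bar>E ?J - E 0 - s * (\<Sum>j<?J. G j)\<bar> \<le> 8 * R\<^sup>2" by metis
      moreover have "\<bar>E ?J\<bar> \<le> 1" "\<bar>E 0\<bar> \<le> 1" unfolding E_def by (rule expect_abs_le, rule g)+
      ultimately have "\<bar>s * (\<Sum>j<?J. G j)\<bar> \<le> 2 + 8 * R\<^sup>2" by linarith
      moreover have "expect (A k) (gen n l f g) = (s * (\<Sum>j<?J. G j)) * s"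
      proof -
        have "expect (A k) (gen n l f g) =
            (\<Sum>j<?J. expect (D (real j / real (Suc k))) (gen n l f g)) / real ?J"
          by (rule A[where c = "2 * 1 * R"]) (rule gen_bound[OF _ g])
        also have "\<dots> = (\<Sum>j<?J. G j) * inverse (real ?J)"
          unfolding G_def s_def divide_inverse ..
        also have "inverse (real ?J) = s * s"
          unfolding s_def power2_eq_square by (simp only: of_nat_mult inverse_mult_distrib)
        finally show ?thesis by (simp only: ac_simps)
      qed
      ultimately show ?thesis using s0 by (simp add: abs_mult mult_right_mono s_def del: of_nat_Suc)
    qed
    have "(\<lambda>k. expect (A k) (gen n l f g)) \<longlonglongrightarrow> 0"
    proof (rule Lim_null_comparison)
      show "\<forall>\<^sub>F k in sequentially. norm (expect (A k) (gen n l f g)) \<le> (2 + 8 * R\<^sup>2) * inverse (real (Suc k))"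
        using est by (simp del: of_nat_Suc)
      show "(\<lambda>k. (2 + 8 * R\<^sup>2) * inverse (real (Suc k))) \<longlonglongrightarrow> 0"
        by (intro tendsto_mult_right_zero LIMSEQ_inverse_real_of_nat)
    qed
    from LIMSEQ_subseq_LIMSEQ[OF this r(1)] show "(\<lambda>k. expect (A (r k)) (gen n l f g)) \<longlonglongrightarrow> 0"
      by (simp add: o_def)
  qed
  then show ?thesis by (rule that)
qed

text \<open>Local errors are quadratic in \<open>s\<close> and simply add up, since
  \<open>stp\<close> is monotone and fixes constants.\<close>

lemma p_iterate_approx:
  assumes s: "0 \<le> s" "s * R \<le> 1" and g: "\<And>y. y \<in> states n \<Longrightarrow> \<bar>g y\<bar> \<le> 1" and x: "x \<in> states n"
  shows "\<bar>expect (p (real m * s) x) g - (stp n l f s ^^ m) g x\<bar> \<le> real m * (8 * R\<^sup>2 * s\<^sup>2)"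
  using x
proof (induction m arbitrary: x)
  case 0 then show ?case by (simp add: p_zero)
next
  case (Suc m)
  let ?u = "\<lambda>z. expect (p (real m * s) z) g" and ?v = "(stp n l f s ^^ m) g" and ?e = "real m * (8 * R\<^sup>2 * s\<^sup>2)"
  have ub: "\<bar>?u y\<bar> \<le> 1" if "y \<in> states n" for y by (rule p_bound[OF that _ g]) (use s in auto)
  have "expect (p (real (Suc m) * s) x) g = expect (p (s + real m * s) x) g" by (simp add: algebra_simps)
  also have "\<dots> = expect (p s x) ?u" by (rule p_semigroup[where c = 1]) (use Suc.prems s g in auto)
  finally have 1: "expect (p (real (Suc m) * s) x) g = expect (p s x) ?u" .
  have 2: "\<bar>expect (p s x) ?u - stp n l f s ?u x\<bar> \<le> 8 * R\<^sup>2 * s\<^sup>2"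
    using p_approx[where g = ?u, OF Suc.prems s(1) ub] by (simp add: stp_def power2_eq_square algebra_simps)
  have "stp n l f s ?u x \<le> stp n l f s (\<lambda>y. ?v y + ?e) x"
    using Suc.IH by (intro stp_mono s Suc.prems) (force simp: abs_le_iff)
  then have 3: "stp n l f s ?u x \<le> stp n l f s ?v x + ?e" unfolding stp_add stp_const .
  have "stp n l f s ?v x \<le> stp n l f s (\<lambda>y. ?u y + ?e) x"
    using Suc.IH by (intro stp_mono s Suc.prems) (force simp: abs_le_iff)
  then have 4: "stp n l f s ?v x \<le> stp n l f s ?u x + ?e" unfolding stp_add stp_const .
  have "real (Suc m) * (8 * R\<^sup>2 * s\<^sup>2) = ?e + 8 * R\<^sup>2 * s\<^sup>2" by (simp add: algebra_simps)
  then show ?case unfolding 1 stp_iter_Suc using 2 3 4 by linarith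
qed

end

locale monotone_transition = monotone_system + queue_transition
begin

text \<open>Monotonicity of the Euler iterates survives the limit of vanishing steps.\<close>

lemma p_state_mono:
  assumes g: "state_mono n g" "\<And>y. y \<in> states n \<Longrightarrow> \<bar>g y\<bar> \<le> 1" and t: "0 \<le> t"
  shows "state_mono n (\<lambda>x. expect (p t x) g)"
  unfolding state_mono_def
proof (intro ballI impI)
  fix x y assume x: "x \<in> states n" and y: "y \<in> states n" and xy: "\<forall>j\<in>{1..n}. x j \<le> y j"
  let ?err = "\<lambda>m. real (Suc m) * (8 * R\<^sup>2 * (t / real (Suc m))\<^sup>2)"
  have lim: "(\<lambda>m. expect (p t y) g + 2 * ?err m) \<longlonglongrightarrow> expect (p t y) g + 2 * 0"
    by (intro tendsto_intros quadratic_small)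
  have "(\<lambda>m. (t * R) * inverse (real (Suc m))) \<longlonglongrightarrow> 0"
    by (intro tendsto_mult_right_zero LIMSEQ_inverse_real_of_nat)
  then have "\<forall>\<^sub>F m in sequentially. (t * R) * inverse (real (Suc m)) < 1"
    by (rule order_tendstoD) simp
  then have "\<forall>\<^sub>F m in sequentially. expect (p t x) g \<le> expect (p t y) g + 2 * ?err m"
  proof eventually_elim
    fix m assume *: "(t * R) * inverse (real (Suc m)) < 1"
    let ?s = "t / real (Suc m)"
    have s: "0 \<le> ?s" "?s * R \<le> 1" using * t by (auto simp: field_simps)
    have eq: "real (Suc m) * ?s = t" by (simp del: of_nat_Suc)
    have "state_mono n ((stp n l f ?s ^^ Suc m) g)" by (rule stp_iter_state_mono[OF s g(1)])
    then have "(stp n l f ?s ^^ Suc m) g x \<le> (stp n l f ?s ^^ Suc m) g y"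
      using x y xy by (simp only: state_mono_def)
    then show "expect (p t x) g \<le> expect (p t y) g + 2 * ?err m"
      using p_iterate_approx[where g = g and m = "Suc m", OF s g(2) x] p_iterate_approx[where g = g and m = "Suc m", OF s g(2) y]
      unfolding eq by linarith
  qed
  then have "expect (p t x) g \<le> expect (p t y) g + 2 * 0"
    by (intro tendsto_lowerbound[OF lim]) auto
  then show "expect (p t x) g \<le> expect (p t y) g" by simp
qed

text \<open>Some state \<open>z\<close> above a box that carries most of \<open>\<nu>\<close> has
  positive mass under \<open>\<mu>\<close>. Monotonicity bounds the escape probability from inside
  the box by that from \<open>z\<close>, and the latter is at most the stationary one divided by
  \<open>pmf \<mu> z\<close>. This covers any initial law.\<close>

lemma tight_of_invariant:
  assumes inv: "invariant n l f \<mu>" and \<nu>: "set_pmf \<nu> \<subseteq> states n" and e: "0 < \<epsilon>"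
  obtains K where "finite K" "K \<subseteq> states n" "\<And>t. 0 \<le> t \<Longrightarrow> measure_pmf.prob (bind_pmf \<nu> (p t)) (- K) \<le> \<epsilon>"
proof -
  let ?box = "\<lambda>b. {x \<in> states n. \<forall>i\<in>{1..n}. x i \<le> b}"
  have \<mu>: "set_pmf \<mu> \<subseteq> states n" using inv by (simp add: invariant_def)
  obtain b where b: "measure_pmf.prob \<nu> (- ?box b) \<le> \<epsilon> / 2"
    by (rule pmf_box_tight[OF \<nu>, of "\<epsilon> / 2"]) (use e in auto)
  obtain x0 where x0: "x0 \<in> set_pmf \<mu>" using set_pmf_not_empty[of \<mu>] by blast
  define z where "z = (\<lambda>i\<in>{1..n}. max (x0 i) b)"
  have z: "z \<in> states n" by (auto simp: z_def states_def)
  have "z \<in> set_pmf \<mu>" by (rule invariant_support_up[OF inv x0 z]) (simp add: z_def)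
  then have \<mu>z: "0 < pmf \<mu> z" by (simp add: pmf_positive)
  obtain r where r: "measure_pmf.prob \<mu> (- ?box r) \<le> \<epsilon> / 2 * pmf \<mu> z"
    by (rule pmf_box_tight[OF \<mu>, of "\<epsilon> / 2 * pmf \<mu> z"]) (use e \<mu>z in auto)
  define g :: "_ \<Rightarrow> real" where "g = indicator (- ?box r)"
  have g: "state_mono n g" by (auto simp: g_def state_mono_def indicator_def dest: order_trans)
  have g1: "\<bar>g y\<bar> \<le> 1" for y by (simp add: g_def indicator_def)
  have "measure_pmf.prob (bind_pmf \<nu> (p t)) (- ?box r) \<le> \<epsilon>" if t: "0 \<le> t" for t
  proof -
    let ?u = "\<lambda>x. expect (p t x) g"
    have u0: "0 \<le> ?u x" for x by (simp add: g_def)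
    have u1: "?u x \<le> 1" for x by (simp add: g_def)
    have mono: "state_mono n ?u" by (rule p_state_mono[OF g g1 t])
    have "pmf \<mu> z * ?u z \<le> expect \<mu> ?u"
      using expect_ge_finite[of "{z}" \<mu> ?u 1] u0 u1 by (auto simp: abs_le_iff)
    also have "\<dots> = expect (bind_pmf \<mu> (p t)) g" by (rule bind_expect[OF \<mu> t g1, symmetric])
    also have "\<dots> = measure_pmf.prob \<mu> (- ?box r)"
      unfolding invariant_imp_stationary[OF inv t] by (simp add: g_def)
    also have "\<dots> \<le> pmf \<mu> z * (\<epsilon> / 2)" using r by (simp add: mult.commute)
    finally have uz: "?u z \<le> \<epsilon> / 2" by (simp only: mult_le_cancel_left_pos[OF \<mu>z])
    have "measure_pmf.prob (bind_pmf \<nu> (p t)) (- ?box r) = expect (bind_pmf \<nu> (p t)) g" by (simp add: g_def)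
    also have "\<dots> = expect \<nu> ?u" by (rule bind_expect[OF \<nu> t g1])
    also have "\<dots> \<le> expect \<nu> (\<lambda>x. \<epsilon> / 2 + indicator (- ?box b) x)"
    proof (rule expect_mono[where c = 1 and d = "\<epsilon> / 2 + 1"])
      fix x assume "x \<in> set_pmf \<nu>"
      then have x: "x \<in> states n" using \<nu> by auto
      show "\<bar>?u x\<bar> \<le> 1" using u0[of x] u1[of x] by simp
      show "\<bar>\<epsilon> / 2 + indicator (- ?box b) x\<bar> \<le> \<epsilon> / 2 + 1" using e by (simp add: indicator_def)
      show "?u x \<le> \<epsilon> / 2 + indicator (- ?box b) x"
      proof (cases "x \<in> ?box b")
        case True
        then have "\<forall>j\<in>{1..n}. x j \<le> z j" by (auto simp: z_def le_max_iff_disj)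
        then have "?u x \<le> ?u z" using mono x z by (simp only: state_mono_def)
        then show ?thesis using uz True by simp
      next
        case False
        then show ?thesis using u1[of x] e by simp
      qed
    qed
    also have "\<dots> = \<epsilon> / 2 + measure_pmf.prob \<nu> (- ?box b)"
    proof -
      have "integrable \<nu> (\<lambda>x. indicator (- ?box b) x :: real)"
        by (rule integrable_bdd[where c = 1]) (simp add: indicator_def)
      then show ?thesis by simp
    qed
    also have "\<dots> \<le> \<epsilon>" using b by simp
    finally show ?thesis .
  qed
  then show ?thesis by (intro that[of "?box r"] finite_box) auto
qed

end

lemma (in monotone_system) stable_iff_invariant:
  assumes mp: "markov_process M (states n) (queue_rate n l f) X"
  shows "stable_process M (states n) X \<longleftrightarrow> (\<exists>\<mu>. invariant n l f \<mu>)"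
proof -
  obtain p \<nu> where p: "transition_function (states n) (queue_rate n l f) p" and \<nu>: "set_pmf \<nu> \<subseteq> states n"
    and law: "\<And>t A. 0 \<le> t \<Longrightarrow> measure_pmf.prob (bind_pmf \<nu> (p t)) A = \<P>(\<omega> in M. X t \<omega> \<in> A)"
    by (rule markov_process_law[OF mp countable_states]) blast
  interpret monotone_transition n l f B p using p by unfold_locales
  have out: "\<P>(\<omega> in M. X t \<omega> \<notin> K) = measure_pmf.prob (bind_pmf \<nu> (p t)) (- K)" if "0 \<le> t" for t K
    using law[OF that, of "- K"] by simp
  show ?thesis
  proof
    assume st: "stable_process M (states n) X"
    have "\<exists>K. finite K \<and> (\<forall>t\<ge>0. measure_pmf.prob (bind_pmf \<nu> (p t)) (- K) \<le> \<epsilon>)" if "0 < \<epsilon>" for \<epsilon>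
    proof -
      from st that obtain K where "finite K" "\<And>t. 0 \<le> t \<Longrightarrow> \<P>(\<omega> in M. X t \<omega> \<notin> K) \<le> \<epsilon>"
        unfolding stable_process_def by blast
      then show ?thesis using out by (intro exI[of _ K]) auto
    qed
    from invariant_of_tight[OF \<nu> this] show "\<exists>\<mu>. invariant n l f \<mu>" by blast
  next
    assume "\<exists>\<mu>. invariant n l f \<mu>"
    then obtain \<mu> where inv: "invariant n l f \<mu>" by blast
    show "stable_process M (states n) X"
      unfolding stable_process_def
    proof (intro allI impI)
      fix \<epsilon> :: real assume e: "0 < \<epsilon>"
      from tight_of_invariant[OF inv \<nu> e] obtain K where "finite K" "K \<subseteq> states n"
        "\<And>t. 0 \<le> t \<Longrightarrow> measure_pmf.prob (bind_pmf \<nu> (p t)) (- K) \<le> \<epsilon>" by blast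
      then show "\<exists>K. finite K \<and> K \<subseteq> states n \<and> (\<forall>t\<ge>0. \<P>(\<omega> in M. X t \<omega> \<notin> K) \<le> \<epsilon>)"
        using out by (intro exI[of _ K]) auto
    qed
  qed
qed

section \<open>The stability region\<close>

text \<open>The conditions of \<open>ordered_region\<close> without the default value: as arrival
  rates are positive, a \<open>limit_rate\<close> of 0 fails them, so they amount to existence of a
  suitable \<open>\<mu>\<close>, which is then unique.\<close>

definition in_region :: "(nat \<Rightarrow> nat \<Rightarrow> (nat \<Rightarrow> nat) \<Rightarrow> real) \<Rightarrow> nat \<Rightarrow> (nat \<Rightarrow> real) \<Rightarrow> bool" where
  "in_region \<psi> n l \<longleftrightarrow> (\<forall>k<n. 0 < l (Suc k) \<and>
     (\<exists>\<mu>. invariant k l (\<psi> k) \<mu> \<and> l (Suc k) < expect \<mu> (\<psi> k (Suc k))))"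

lemma in_region_Suc:
  "in_region \<psi> (Suc n) l \<longleftrightarrow> in_region \<psi> n l \<and> 0 < l (Suc n) \<and>
     (\<exists>\<mu>. invariant n l (\<psi> n) \<mu> \<and> l (Suc n) < expect \<mu> (\<psi> n (Suc n)))"
  by (auto simp: in_region_def less_Suc_eq)

lemma in_region_pos: "in_region \<psi> n l \<Longrightarrow> i \<in> {1..n} \<Longrightarrow> 0 < l i"
  by (cases i) (auto simp: in_region_def)

lemma states_0: "states 0 = {\<lambda>_. undefined}"
  by (simp add: states_def)

lemma invariant_0: "invariant 0 l f (return_pmf (\<lambda>_. undefined))"
  by (simp add: invariant_def states_0 gen_def)

lemma gen_rates_cong:
  assumes "\<And>i. i \<in> {1..n} \<Longrightarrow> l i = l' i" "\<And>i. i \<in> {1..n} \<Longrightarrow> f i x = f' i x"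
  shows "gen n l f g x = gen n l' f' g x"
  unfolding gen_def using assms by (intro sum.cong) auto

lemma invariant_cong:
  assumes "invariant n l f \<mu>" "\<And>i. i \<in> {1..n} \<Longrightarrow> l i = l' i"
    "\<And>i x. i \<in> {1..n} \<Longrightarrow> x \<in> states n \<Longrightarrow> f i x = f' i x"
  shows "invariant n l' f' \<mu>"
proof -
  have "expect \<mu> (gen n l' f' g) = expect \<mu> (gen n l f g)" for g
    using assms by (intro expect_cong gen_rates_cong[symmetric]) (auto simp: invariant_def)
  then show ?thesis using assms(1) by (simp add: invariant_def)
qed

lemma in_region_cong:
  assumes "in_region \<psi> n l" "\<And>i. i \<in> {1..n} \<Longrightarrow> l i = l' i"
    "\<And>k i x. k < n \<Longrightarrow> i \<in> {1..Suc k} \<Longrightarrow> x \<in> states k \<Longrightarrow> \<psi> k i x = \<psi>' k i x"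
  shows "in_region \<psi>' n l'"
  unfolding in_region_def
proof (intro allI impI)
  fix k assume k: "k < n"
  with assms(1) obtain \<mu> where \<mu>: "0 < l (Suc k)" "invariant k l (\<psi> k) \<mu>" "l (Suc k) < expect \<mu> (\<psi> k (Suc k))"
    by (auto simp: in_region_def)
  have "invariant k l' (\<psi>' k) \<mu>" using k assms(2,3) by (intro invariant_cong[OF \<mu>(2)]) auto
  moreover have "expect \<mu> (\<psi> k (Suc k)) = expect \<mu> (\<psi>' k (Suc k))"
    using \<mu>(2) k assms(3) by (intro expect_cong) (auto simp: invariant_def)
  moreover have "l (Suc k) = l' (Suc k)" using k by (intro assms(2)) auto
  ultimately show "0 < l' (Suc k) \<and> (\<exists>\<mu>. invariant k l' (\<psi>' k) \<mu> \<and> l' (Suc k) < expect \<mu> (\<psi>' k (Suc k)))"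
    using \<mu> by auto
qed

context coupled_queues
begin

lemma in_region_invariant:
  assumes "n \<le> N" "in_region \<psi> n l"
  shows "\<exists>\<mu>. invariant n l (\<psi> n) \<mu>"
proof (cases n)
  case 0 then show ?thesis using invariant_0 by auto
next
  case (Suc k)
  then obtain \<mu> where "invariant k l (\<psi> k) \<mu>" "l (Suc k) < expect \<mu> (\<psi> k (Suc k))"
    using assms by (auto simp: in_region_Suc)
  then show ?thesis using Suc assms in_region_pos[OF assms(2)] invariant_exists_Suc[of k l \<mu>] by auto
qed

text \<open>Queue \<open>i\<close> is not among the first \<open>n\<close>, so
  \<open>\<psi> n i\<close> decreases in all of them; higher arrival rates lengthen these queues and
  lower the mean service rate.\<close>

lemma invariant_psi_antimono:
  assumes "n \<le> N" "i \<in> {1..N}" "i \<notin> {1..n}"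
    and l: "\<And>j. j \<in> {1..n} \<Longrightarrow> 0 < l' j" "\<And>j. j \<in> {1..n} \<Longrightarrow> l' j \<le> l j"
    and inv: "invariant n l (\<psi> n) \<mu>" "invariant n l' (\<psi> n) \<mu>'"
  shows "expect \<mu> (\<psi> n i) \<le> expect \<mu>' (\<psi> n i)"
proof -
  have l0: "0 < l j" if "j \<in> {1..n}" for j using l[OF that] by linarith
  have sub: "set_pmf \<mu>' \<subseteq> states n" using inv(2) by (simp add: invariant_def)
  have "expect \<mu>' (\<lambda>x. - \<psi> n i (restrict x {1..n})) \<le> expect \<mu> (\<lambda>x. - \<psi> n i x)"
  proof (rule invariant_mono[OF monotone_psi[OF assms(1) l0] monotone_psi[OF assms(1) l(1)] order_refl _ _ l(2) _ inv])
    show "state_mono n (\<lambda>x. - \<psi> n i x)"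
      unfolding state_mono_def
    proof (intro ballI impI)
      fix y z assume "y \<in> states n" "z \<in> states n" "\<forall>j\<in>{1..n}. y j \<le> z j"
      then have "\<psi> n i z \<le> \<psi> n i y" using assms(1,2,3) by (intro psi_anti) auto
      then show "- \<psi> n i y \<le> - \<psi> n i z" by simp
    qed
    show "\<bar>- \<psi> n i x\<bar> \<le> B" if "x \<in> states n" for x
      using psi_nonneg[OF assms(1,2) that] psi_le[OF assms(1,2) that] by simp
    show "\<psi> n j (restrict x {1..n}) \<le> \<psi> n j x" if "x \<in> states n" for j x
      unfolding restrict_state_self[OF that] by simp
  qed
  also have "expect \<mu>' (\<lambda>x. - \<psi> n i (restrict x {1..n})) = expect \<mu>' (\<lambda>x. - \<psi> n i x)"
  proof (rule expect_cong)
    fix x assume "x \<in> set_pmf \<mu>'"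
    then have "x \<in> states n" using sub by blast
    then show "- \<psi> n i (restrict x {1..n}) = - \<psi> n i x" by (simp only: restrict_state_self)
  qed
  finally show ?thesis by simp
qed

text \<open>Lower arrival rates shorten the queues ahead, which leaves at least as much mean service
  to the next one.\<close>

lemma in_region_down:
  assumes "n \<le> N" "in_region \<psi> n l" "\<And>i. i \<in> {1..n} \<Longrightarrow> 0 < l' i" "\<And>i. i \<in> {1..n} \<Longrightarrow> l' i \<le> l i"
  shows "in_region \<psi> n l'"
  unfolding in_region_def
proof (intro allI impI conjI)
  fix k assume k: "k < n"
  with assms(2) obtain \<mu> where \<mu>: "invariant k l (\<psi> k) \<mu>" "l (Suc k) < expect \<mu> (\<psi> k (Suc k))"
    by (auto simp: in_region_def)
  show "0 < l' (Suc k)" using k by (intro assms(3)) auto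
  have l0: "0 < l j" if "j \<in> {1..n}" for j using assms(3,4)[OF that] by linarith
  interpret a: monotone_system k l "\<psi> k" B using k assms(1) l0 by (intro monotone_psi) auto
  interpret b: monotone_system k l' "\<psi> k" B using k assms(1,3) by (intro monotone_psi) auto
  obtain \<mu>' where \<mu>': "invariant k l' (\<psi> k) \<mu>'"
    by (rule invariant_exists_dominated[OF a.monotone_system_axioms b.queue_system_axioms _ _ \<mu>(1)])
      (use k assms(4) in auto)
  have "l' (Suc k) \<le> l (Suc k)" using k by (intro assms(4)) auto
  also have "\<dots> < expect \<mu> (\<psi> k (Suc k))" by (rule \<mu>(2))
  also have "\<dots> \<le> expect \<mu>' (\<psi> k (Suc k))"
    using k assms by (intro invariant_psi_antimono[OF _ _ _ _ _ \<mu>(1) \<mu>']) auto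
  finally show "\<exists>\<mu>. invariant k l' (\<psi> k) \<mu> \<and> l' (Suc k) < expect \<mu> (\<psi> k (Suc k))"
    using \<mu>' by blast
qed

text \<open>The induction hypothesis supplies a distribution for the rates
  \<open>l i + \<delta>0\<close> that dominates those for all smaller increments. This gives
  tightness; the limit is invariant for \<open>l\<close>, hence is \<open>\<mu>\<close>, and the
  strict inequality survives for a small increment.\<close>

lemma in_region_up:
  assumes "n \<le> N" "in_region \<psi> n l"
  shows "\<exists>\<delta>>0. in_region \<psi> n (\<lambda>i. l i + \<delta>)"
  using assms
proof (induction n)
  case 0 then show ?case by (intro exI[of _ 1]) (simp add: in_region_def)
next
  case (Suc n)
  have n: "n \<le> N" "n < N" using Suc.prems(1) by auto
  have reg: "in_region \<psi> n l" using Suc.prems(2) by (simp add: in_region_Suc)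
  from Suc.IH[OF n(1) reg] obtain \<delta>0 where \<delta>0: "0 < \<delta>0" "in_region \<psi> n (\<lambda>i. l i + \<delta>0)" by blast
  obtain \<mu> where \<mu>: "invariant n l (\<psi> n) \<mu>" "l (Suc n) < expect \<mu> (\<psi> n (Suc n))"
    using Suc.prems(2) by (auto simp: in_region_Suc)
  have l0: "0 < l i" if "i \<in> {1..Suc n}" for i using in_region_pos[OF Suc.prems(2) that] .
  define d where "d k = \<delta>0 * inverse (real (Suc k))" for k
  have d: "0 < d k" "d k \<le> \<delta>0" for k
  proof -
    show "0 < d k" using \<delta>0 by (simp add: d_def)
    have "inverse (real (Suc k)) \<le> 1" by (simp add: inverse_le_1_iff)
    then show "d k \<le> \<delta>0" unfolding d_def using \<delta>0 by (intro mult_left_le) auto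
  qed
  have dlim: "d \<longlonglongrightarrow> 0" unfolding d_def by (intro tendsto_mult_right_zero LIMSEQ_inverse_real_of_nat)
  have regk: "in_region \<psi> n (\<lambda>i. l i + d k)" for k
    by (rule in_region_down[OF n(1) \<delta>0(2)]) (use d[of k] l0 in \<open>auto simp: add_pos_pos\<close>)
  then have "\<forall>k. \<exists>\<mu>. invariant n (\<lambda>i. l i + d k) (\<psi> n) \<mu>" using in_region_invariant[OF n(1)] by blast
  then obtain m where m: "\<And>k. invariant n (\<lambda>i. l i + d k) (\<psi> n) (m k)" by metis
  obtain \<mu>0 where \<mu>0: "invariant n (\<lambda>i. l i + \<delta>0) (\<psi> n) \<mu>0" using in_region_invariant[OF n(1) \<delta>0(2)] by blast
  have msub: "set_pmf (m k) \<subseteq> states n" for k using m by (simp add: invariant_def)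
  interpret s: monotone_system n l "\<psi> n" B using n l0 by (intro monotone_psi) auto
  have sys: "monotone_system n (\<lambda>i. l i + e) (\<psi> n) B" if "0 < e" for e
    using n l0 that by (intro monotone_psi) (auto simp: add_pos_pos)
  have tight: "\<exists>F. finite F \<and> (\<forall>k. measure_pmf.prob (m k) (- F) \<le> \<epsilon>)" if "0 < \<epsilon>" for \<epsilon>
  proof (rule tight_of_dominated[OF _ _ that])
    show "set_pmf \<mu>0 \<subseteq> states n" using \<mu>0 by (simp add: invariant_def)
    fix k and g :: "(nat \<Rightarrow> nat) \<Rightarrow> real" assume g: "state_mono n g" "\<And>x. \<bar>g x\<bar> \<le> 1"
    have "expect (m k) (\<lambda>x. g (restrict x {1..n})) \<le> expect \<mu>0 g"
      by (rule invariant_mono[OF sys[OF \<delta>0(1)] sys[OF d(1)[of k]] order_refl g(1) g(2) _ _ \<mu>0 m])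
        (use d(2)[of k] in \<open>simp_all add: restrict_state_self[simplified]\<close>)
    also have "expect (m k) (\<lambda>x. g (restrict x {1..n})) = expect (m k) g"
    proof (rule expect_cong)
      fix x assume "x \<in> set_pmf (m k)"
      then have "x \<in> states n" using msub by blast
      then show "g (restrict x {1..n}) = g x" by (simp only: restrict_state_self)
    qed
    finally show "expect (m k) g \<le> expect \<mu>0 g" .
  qed
  from tight_pmf_subsequence[OF countable_states msub tight]
  obtain r \<nu> where r: "strict_mono r" "set_pmf \<nu> \<subseteq> states n"
    and conv: "\<And>g c. (\<And>x. x \<in> states n \<Longrightarrow> \<bar>g x\<bar> \<le> c) \<Longrightarrow> (\<lambda>k. expect (m (r k)) g) \<longlonglongrightarrow> expect \<nu> g"
    by blast
  have dr: "(\<lambda>k. d (r k)) \<longlonglongrightarrow> 0" using LIMSEQ_subseq_LIMSEQ[OF dlim r(1)] by (simp add: o_def)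
  have "invariant n l (\<psi> n) \<nu>"
  proof (rule s.limit_invariant[OF r(2) conv])
    fix g :: "(nat \<Rightarrow> nat) \<Rightarrow> real" assume g: "\<And>x. \<bar>g x\<bar> \<le> 1"
    have est: "\<bar>expect (m k) (gen n l (\<psi> n) g)\<bar> \<le> 2 * real n * d k" for k
    proof -
      interpret t: monotone_system n "\<lambda>i. l i + d k" "\<psi> n" B by (rule sys[OF d(1)])
      \<comment> \<open>The generators for \<open>l\<close> and for the raised rates differ in the
        arrival terms only, by an amount proportional to \<open>d k\<close>.\<close>
      let ?u = "\<lambda>x. \<Sum>i\<in>{1..n}. d k * (g (x(i := x i + 1)) - g x)"
      have eq: "gen n l (\<psi> n) g x = gen n (\<lambda>i. l i + d k) (\<psi> n) g x - ?u x" for x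
        unfolding gen_def sum_subtractf[symmetric] by (intro sum.cong) (auto simp: algebra_simps)
      have u: "\<bar>?u x\<bar> \<le> 2 * real n * d k" for x
      proof -
        have "\<bar>?u x\<bar> \<le> (\<Sum>i\<in>{1..n}. d k * 2)"
        proof (rule order_trans[OF sum_abs], rule sum_mono)
          fix i
          have "\<bar>g (x(i := x i + 1)) - g x\<bar> \<le> 2" using g[of "x(i := x i + 1)"] g[of x] by linarith
          then show "\<bar>d k * (g (x(i := x i + 1)) - g x)\<bar> \<le> d k * 2"
            unfolding abs_mult using d(1)[of k] by (intro mult_mono) auto
        qed
        then show ?thesis by simp
      qed
      have "integrable (m k) (gen n (\<lambda>i. l i + d k) (\<psi> n) g)"
        using msub[of k] t.gen_bound[where g = g, OF _ g] by (intro integrable_bdd[where c = "2 * 1 * t.R"]) auto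
      moreover have "integrable (m k) ?u" using u by (intro integrable_bdd[where c = "2 * real n * d k"])
      ultimately have "expect (m k) (gen n l (\<psi> n) g) = - expect (m k) ?u"
        unfolding eq using t.invariant_gen[OF m g] by simp
      then show ?thesis using expect_abs_le[of "m k" ?u, OF u] by simp
    qed
    show "(\<lambda>k. expect (m (r k)) (gen n l (\<psi> n) g)) \<longlonglongrightarrow> 0"
    proof (rule Lim_null_comparison)
      show "\<forall>\<^sub>F k in sequentially. norm (expect (m (r k)) (gen n l (\<psi> n) g)) \<le> 2 * real n * d (r k)"
        using est by simp
      show "(\<lambda>k. 2 * real n * d (r k)) \<longlonglongrightarrow> 0" by (rule tendsto_mult_right_zero[OF dr])
    qed
  qed
  then have "\<nu> = \<mu>" using \<mu>(1) by (rule s.invariant_unique)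
  have "(\<lambda>k. expect (m (r k)) (\<psi> n (Suc n))) \<longlonglongrightarrow> expect \<nu> (\<psi> n (Suc n))"
  proof (rule conv)
    show "\<bar>\<psi> n (Suc n) x\<bar> \<le> B" if "x \<in> states n" for x
      using psi_nonneg[of n "Suc n" x] psi_le[of n "Suc n" x] n that by simp
  qed
  then have "(\<lambda>k. expect (m (r k)) (\<psi> n (Suc n)) - d (r k)) \<longlonglongrightarrow> expect \<mu> (\<psi> n (Suc n)) - 0"
    unfolding \<open>\<nu> = \<mu>\<close> by (intro tendsto_diff dr)
  then have "\<forall>\<^sub>F k in sequentially. l (Suc n) < expect (m (r k)) (\<psi> n (Suc n)) - d (r k)"
    by (rule order_tendstoD) (use \<mu>(2) in simp)
  from eventually_happens'[OF sequentially_bot this]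
  obtain k where "l (Suc n) < expect (m (r k)) (\<psi> n (Suc n)) - d (r k)" by blast
  then have k: "l (Suc n) + d (r k) < expect (m (r k)) (\<psi> n (Suc n))" by linarith
  have "in_region \<psi> (Suc n) (\<lambda>i. l i + d (r k))"
    unfolding in_region_Suc using regk m k l0[of "Suc n"] d(1)[of "r k"] by (auto simp: add_pos_pos)
  then show ?case using d(1) by blast
qed

end

lemma expect_infsum:
  assumes sub: "set_pmf p \<subseteq> S" and g: "\<And>x. x \<in> S \<Longrightarrow> \<bar>g x\<bar> \<le> c"
  shows "(\<Sum>\<^sub>\<infinity>x\<in>S. g x * pmf p x) = expect p g"
proof -
  have i: "integrable (count_space UNIV) (\<lambda>x. pmf p x * g x)"
    using sub g by (intro integrable_count_space integrable_bdd[where c = c]) auto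
  then have "Infinite_Set_Sum.abs_summable_on (\<lambda>x. pmf p x * g x) UNIV"
    by (simp add: Infinite_Set_Sum.abs_summable_on_def)
  from infsetsum_infsum[OF this] have "(\<Sum>\<^sub>\<infinity>x. pmf p x * g x) = expect p g"
    unfolding expect_count_space infsetsum_def by simp
  moreover have "(\<Sum>\<^sub>\<infinity>x\<in>S. g x * pmf p x) = (\<Sum>\<^sub>\<infinity>x. pmf p x * g x)"
    using sub by (intro infsum_cong_neutral) (auto simp: set_pmf_iff mult.commute)
  ultimately show ?thesis by simp
qed

text \<open>Uniqueness of invariant distributions resolves the definite description, and boundedness
  turns the infinite sum into an expectation. The case \<open>k = 0\<close> is separate because
  \<open>limit_rate\<close> treats it by its own clause.\<close>

lemma ordered_region_iff:
  assumes cq: "coupled_queues N \<phi> B (\<lambda>n. lower_partial_limit N n \<phi>)" and l: "l \<in> pos_vectors N"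
  shows "l \<in> ordered_region N \<phi> \<longleftrightarrow> in_region (\<lambda>n. lower_partial_limit N n \<phi>) N l"
proof -
  interpret coupled_queues N \<phi> B "\<lambda>n. lower_partial_limit N n \<phi>" by (rule cq)
  let ?\<psi> = "\<lambda>n. lower_partial_limit N n \<phi>"
  have lpos: "0 < l i" if "i \<in> {1..N}" for i using l that by (auto simp: pos_vectors_def)
  have key: "l (Suc k) < limit_rate N k l \<phi> (Suc k) \<longleftrightarrow>
      (\<exists>\<mu>. invariant k l (?\<psi> k) \<mu> \<and> l (Suc k) < expect \<mu> (?\<psi> k (Suc k)))" if k: "k < N" for k
  proof -
    interpret s: monotone_system k l "?\<psi> k" B using k lpos by (intro monotone_psi) auto
    show ?thesis
    proof (cases "k = 0")
      case True
      let ?r = "return_pmf (\<lambda>_. undefined) :: (nat \<Rightarrow> nat) pmf"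
      have u: "\<mu> = ?r" if "invariant 0 l (?\<psi> 0) \<mu>" for \<mu>
        using that unfolding invariant_def states_0 set_pmf_subset_singleton by blast
      have L: "limit_rate N 0 l \<phi> (Suc 0) = expect ?r (?\<psi> 0 (Suc 0))"
        by (simp add: limit_rate_def integral_return)
      show ?thesis unfolding True L
      proof
        assume "l (Suc 0) < expect ?r (?\<psi> 0 (Suc 0))"
        then show "\<exists>\<mu>. invariant 0 l (?\<psi> 0) \<mu> \<and> l (Suc 0) < expect \<mu> (?\<psi> 0 (Suc 0))"
          using invariant_0 by blast
      next
        assume "\<exists>\<mu>. invariant 0 l (?\<psi> 0) \<mu> \<and> l (Suc 0) < expect \<mu> (?\<psi> 0 (Suc 0))"
        then obtain \<mu> where \<mu>: "invariant 0 l (?\<psi> 0) \<mu>" "l (Suc 0) < expect \<mu> (?\<psi> 0 (Suc 0))" by blast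
        show "l (Suc 0) < expect ?r (?\<psi> 0 (Suc 0))" using \<mu>(2) unfolding u[OF \<mu>(1)] .
      qed
    next
      case False
      have st: "stationary_distribution (states k) (queue_rate k l (?\<psi> k)) = invariant k l (?\<psi> k)"
        by (rule ext) (rule s.stationary_iff_invariant)
      show ?thesis
      proof (cases "\<exists>\<mu>. invariant k l (?\<psi> k) \<mu>")
        case True
        then obtain \<mu> where \<mu>: "invariant k l (?\<psi> k) \<mu>" by blast
        have u: "\<mu>' = \<mu>" if "invariant k l (?\<psi> k) \<mu>'" for \<mu>' using s.invariant_unique[OF that \<mu>] .
        have ex1: "\<exists>!\<mu>. invariant k l (?\<psi> k) \<mu>" using \<mu> u by blast
        have the: "(THE \<mu>. invariant k l (?\<psi> k) \<mu>) = \<mu>" using \<mu> u by blast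
        have "limit_rate N k l \<phi> (Suc k) = (\<Sum>\<^sub>\<infinity>x\<in>states k. ?\<psi> k (Suc k) x * pmf \<mu> x)"
          using False ex1 the by (simp add: limit_rate_def st)
        also have "\<dots> = expect \<mu> (?\<psi> k (Suc k))"
        proof (rule expect_infsum)
          show "set_pmf \<mu> \<subseteq> states k" using \<mu> by (simp add: invariant_def)
          show "\<bar>?\<psi> k (Suc k) x\<bar> \<le> B" if "x \<in> states k" for x
            using psi_nonneg[of k "Suc k" x] psi_le[of k "Suc k" x] k that by simp
        qed
        finally have L: "limit_rate N k l \<phi> (Suc k) = expect \<mu> (?\<psi> k (Suc k))" .
        show ?thesis unfolding L
        proof
          assume "\<exists>\<mu>. invariant k l (?\<psi> k) \<mu> \<and> l (Suc k) < expect \<mu> (?\<psi> k (Suc k))"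
          then obtain \<mu>' where \<mu>': "invariant k l (?\<psi> k) \<mu>'" "l (Suc k) < expect \<mu>' (?\<psi> k (Suc k))" by blast
          show "l (Suc k) < expect \<mu> (?\<psi> k (Suc k))" using \<mu>'(2) unfolding u[OF \<mu>'(1)] .
        qed (use \<mu> in blast)
      next
        case F: False
        \<comment> \<open>The default 0 is below the positive arrival rate, so both sides of the
          equivalence fail.\<close>
        then have "limit_rate N k l \<phi> (Suc k) = 0" using False by (auto simp: limit_rate_def st Let_def Ex1_def)
        then show ?thesis using F lpos[of "Suc k"] k by auto
      qed
    qed
  qed
  have "l \<in> ordered_region N \<phi> \<longleftrightarrow> (\<forall>k<N. l (Suc k) < limit_rate N k l \<phi> (Suc k))"
  proof -
    have eq: "{1..N} = Suc ` {..<N}" by (simp add: image_Suc_lessThan)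
    show ?thesis using l unfolding ordered_region_def eq by auto
  qed
  also have "\<dots> \<longleftrightarrow> in_region ?\<psi> N l" unfolding in_region_def using key lpos by auto
  finally show ?thesis .
qed

section \<open>Relabelling the queues\<close>

lemma permute_state: "permute_vector N \<sigma> x \<in> states N"
  by (auto simp: permute_vector_def states_def)

lemma permute_inv_permute:
  assumes "\<sigma> permutes {1..N}" "x \<in> states N"
  shows "permute_vector N (inv \<sigma>) (permute_vector N \<sigma> x) = x"
proof (rule states_eqI[OF permute_state assms(2)])
  fix i assume i: "i \<in> {1..N}"
  then have "inv \<sigma> i \<in> {1..N}" using permutes_in_image[OF permutes_inv[OF assms(1)]] by simp
  then show "permute_vector N (inv \<sigma>) (permute_vector N \<sigma> x) i = x i"
    using i permutes_inverses(1)[OF assms(1)] by (simp add: permute_vector_def)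
qed

lemma permute_permute_inv:
  assumes "\<sigma> permutes {1..N}" "x \<in> states N"
  shows "permute_vector N \<sigma> (permute_vector N (inv \<sigma>) x) = x"
  using permute_inv_permute[OF permutes_inv[OF assms(1)] assms(2)] permutes_inv_inv[OF assms(1)] by simp

lemma permute_upd:
  assumes \<sigma>: "\<sigma> permutes {1..N}" and i: "i \<in> {1..N}"
  shows "(permute_vector N \<sigma> x)(i := v) = permute_vector N \<sigma> (x(\<sigma> i := v))"
proof
  fix j
  have "\<sigma> j = \<sigma> i \<longleftrightarrow> j = i" using permutes_inj[OF \<sigma>] by (auto simp: inj_def)
  then show "((permute_vector N \<sigma> x)(i := v)) j = permute_vector N \<sigma> (x(\<sigma> i := v)) j"
    using i by (auto simp: permute_vector_def)
qed

text \<open>Relabelling conjugates the generators: the inverse permutation in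
  \<open>permute_allocation\<close> undoes the one applied to the state, and what remains is a
  reindexing of the sum.\<close>

lemma gen_permute:
  assumes \<sigma>: "\<sigma> permutes {1..N}" and x: "x \<in> states N"
  shows "gen N (permute_vector N \<sigma> l) (permute_allocation N \<sigma> \<phi>) g (permute_vector N \<sigma> x) =
    gen N l \<phi> (\<lambda>y. g (permute_vector N \<sigma> y)) x"
proof -
  let ?F = "\<lambda>i. l i * (g (permute_vector N \<sigma> (x(i := x i + 1))) - g (permute_vector N \<sigma> x)) +
      (if 0 < x i then \<phi> i x * (g (permute_vector N \<sigma> (x(i := x i - 1))) - g (permute_vector N \<sigma> x)) else 0)"
  have "gen N (permute_vector N \<sigma> l) (permute_allocation N \<sigma> \<phi>) g (permute_vector N \<sigma> x) = (\<Sum>i\<in>{1..N}. ?F (\<sigma> i))"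
    unfolding gen_def
  proof (rule sum.cong)
    fix i assume i: "i \<in> {1..N}"
    have "permute_vector N \<sigma> l i = l (\<sigma> i)" "permute_vector N \<sigma> x i = x (\<sigma> i)"
      using i by (auto simp: permute_vector_def)
    then show "permute_vector N \<sigma> l i * (g ((permute_vector N \<sigma> x)(i := permute_vector N \<sigma> x i + 1)) - g (permute_vector N \<sigma> x)) +
       (if 0 < permute_vector N \<sigma> x i then permute_allocation N \<sigma> \<phi> i (permute_vector N \<sigma> x) *
         (g ((permute_vector N \<sigma> x)(i := permute_vector N \<sigma> x i - 1)) - g (permute_vector N \<sigma> x)) else 0) = ?F (\<sigma> i)"
      by (simp only: permute_upd[OF \<sigma> i] permute_allocation_def permute_inv_permute[OF \<sigma> x])
  qed simp
  also have "\<dots> = (\<Sum>i\<in>{1..N}. ?F i)"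
    by (rule sum.reindex_bij_betw) (rule permutes_imp_bij[OF \<sigma>])
  finally show ?thesis by (simp only: gen_def)
qed

lemma invariant_permute:
  assumes \<sigma>: "\<sigma> permutes {1..N}" and inv: "invariant N l \<phi> \<mu>"
  shows "invariant N (permute_vector N \<sigma> l) (permute_allocation N \<sigma> \<phi>) (map_pmf (permute_vector N \<sigma>) \<mu>)"
  unfolding invariant_def
proof (intro conjI allI impI)
  show "set_pmf (map_pmf (permute_vector N \<sigma>) \<mu>) \<subseteq> states N" using permute_state by auto
  fix g :: "(nat \<Rightarrow> nat) \<Rightarrow> real" assume g: "\<forall>x. \<bar>g x\<bar> \<le> 1"
  have "expect (map_pmf (permute_vector N \<sigma>) \<mu>) (gen N (permute_vector N \<sigma> l) (permute_allocation N \<sigma> \<phi>) g) =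
    expect \<mu> (gen N l \<phi> (\<lambda>y. g (permute_vector N \<sigma> y)))"
    unfolding integral_map_pmf using inv by (intro expect_cong gen_permute[OF \<sigma>]) (auto simp: invariant_def)
  also have "\<dots> = 0" using inv g by (simp add: invariant_def)
  finally show "expect (map_pmf (permute_vector N \<sigma>) \<mu>)
      (gen N (permute_vector N \<sigma> l) (permute_allocation N \<sigma> \<phi>) g) = 0" .
qed

lemma invariant_unpermute:
  assumes \<sigma>: "\<sigma> permutes {1..N}"
    and inv: "invariant N (permute_vector N \<sigma> l) (permute_allocation N \<sigma> \<phi>) \<mu>"
  shows "invariant N l \<phi> (map_pmf (permute_vector N (inv \<sigma>)) \<mu>)"
  unfolding invariant_def
proof (intro conjI allI impI)
  let ?p = "permute_vector N (inv \<sigma>)"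
  show "set_pmf (map_pmf ?p \<mu>) \<subseteq> states N" using permute_state by auto
  fix g :: "(nat \<Rightarrow> nat) \<Rightarrow> real" assume g: "\<forall>x. \<bar>g x\<bar> \<le> 1"
  have "expect (map_pmf ?p \<mu>) (gen N l \<phi> g) =
    expect \<mu> (gen N (permute_vector N \<sigma> l) (permute_allocation N \<sigma> \<phi>) (\<lambda>y. g (?p y)))"
    unfolding integral_map_pmf
  proof (rule expect_cong)
    fix x assume "x \<in> set_pmf \<mu>"
    then have x: "x \<in> states N" using inv by (auto simp: invariant_def)
    have "gen N l \<phi> g (?p x) = gen N l \<phi> (\<lambda>y. g (?p (permute_vector N \<sigma> y))) (?p x)"
      by (rule gen_cong[OF permute_state]) (simp add: permute_inv_permute[OF \<sigma>])
    also have "\<dots> = gen N (permute_vector N \<sigma> l) (permute_allocation N \<sigma> \<phi>) (\<lambda>y. g (?p y)) (permute_vector N \<sigma> (?p x))"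
      by (rule gen_permute[OF \<sigma> permute_state, symmetric])
    finally show "gen N l \<phi> g (?p x) =
        gen N (permute_vector N \<sigma> l) (permute_allocation N \<sigma> \<phi>) (\<lambda>y. g (?p y)) x"
      by (simp only: permute_permute_inv[OF \<sigma> x])
  qed
  also have "\<dots> = 0" using inv g by (simp add: invariant_def)
  finally show "expect (map_pmf ?p \<mu>) (gen N l \<phi> g) = 0" .
qed

lemma SUP_ereal_tendsto_0D:
  assumes "(\<lambda>r::nat. SUP x\<in>S r. ereal \<bar>F x\<bar>) \<longlonglongrightarrow> 0" "0 < \<delta>"
  obtains r where "\<And>x. x \<in> S r \<Longrightarrow> \<bar>F x\<bar> \<le> \<delta>"
proof -
  have "\<forall>\<^sub>F r in sequentially. (SUP x\<in>S r. ereal \<bar>F x\<bar>) < ereal \<delta>"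
    using assms by (intro order_tendstoD(2)[OF assms(1)]) auto
  from eventually_happens'[OF sequentially_bot this]
  obtain r where r: "(SUP x\<in>S r. ereal \<bar>F x\<bar>) < ereal \<delta>" by blast
  have "\<bar>F x\<bar> \<le> \<delta>" if "x \<in> S r" for x
  proof -
    have "ereal \<bar>F x\<bar> \<le> (SUP x\<in>S r. ereal \<bar>F x\<bar>)" using that by (rule SUP_upper)
    with r have "ereal \<bar>F x\<bar> < ereal \<delta>" by (rule order.strict_trans1[rotated])
    then show ?thesis by simp
  qed
  then show ?thesis by (rule that)
qed

text \<open>For large \<open>k\<close> all values in the infimum lie within \<open>e / 2\<close> of
  \<open>G x\<close>, so a uniform limit, where it exists, is the lower partial limit.\<close>

lemma lower_partial_limit_eq:
  assumes n: "n \<le> N" and x: "x \<in> states n"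
    and close: "\<And>\<delta>. 0 < \<delta> \<Longrightarrow> \<exists>r. \<forall>y\<in>states N. (\<forall>j\<in>{n+1..N}. r < y j) \<longrightarrow> \<bar>\<phi> i y - G (restrict y {1..n})\<bar> \<le> \<delta>"
  shows "lower_partial_limit N n \<phi> i x = G x"
  unfolding lower_partial_limit_def
proof (rule limI, rule LIMSEQ_I)
  fix e :: real assume e: "0 < e"
  obtain r where r: "\<And>y. y \<in> states N \<Longrightarrow> (\<forall>j\<in>{n+1..N}. r < y j) \<Longrightarrow> \<bar>\<phi> i y - G (restrict y {1..n})\<bar> \<le> e / 2"
    using close[of "e / 2"] e by auto
  show "\<exists>no. \<forall>k\<ge>no. norm ((INF y\<in>{y\<in>states N. restrict y {1..n} = x \<and> (\<forall>j\<in>{n+1..N}. k < y j)}. \<phi> i y) - G x) < e"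
  proof (intro exI allI impI)
    fix k :: nat assume k: "r \<le> k"
    let ?A = "{y\<in>states N. restrict y {1..n} = x \<and> (\<forall>j\<in>{n+1..N}. k < y j)}"
    have el: "G x - e / 2 \<le> \<phi> i y" "\<phi> i y \<le> G x + e / 2" if "y \<in> ?A" for y
    proof -
      have y: "y \<in> states N" "restrict y {1..n} = x" using that by simp_all
      have "\<forall>j\<in>{n+1..N}. r < y j" using that k by (auto intro: le_less_trans)
      from r[OF y(1) this] show "G x - e / 2 \<le> \<phi> i y" "\<phi> i y \<le> G x + e / 2"
        unfolding y(2) by linarith+
    qed
    \<comment> \<open>Witness that the infimum is over a nonempty set; otherwise its value would be
      unspecified. \<open>Suc k\<close> meets the strict bound.\<close>
    let ?y = "extend_state N n (Suc k) x"
    have y: "?y \<in> ?A"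
      using restrict_extend_state[OF n x] extend_state_in by (auto simp: extend_state_def)
    have "G x - e / 2 \<le> (INF y\<in>?A. \<phi> i y)" using y by (intro cINF_greatest el) auto
    moreover have "(INF y\<in>?A. \<phi> i y) \<le> G x + e / 2"
      by (rule cINF_lower2[OF _ y]) (use y el in \<open>auto intro!: bdd_belowI2[where m = "G x - e / 2"]\<close>)
    ultimately show "norm ((INF y\<in>?A. \<phi> i y) - G x) < e" using e unfolding real_norm_def by linarith
  qed
qed

text \<open>The clause of \<open>uniform_limits_at_infinity\<close> on permutations, used for
  \<open>\<sigma>\<close> itself, is what the relabelled system needs. The clause with a constant
  covers \<open>n = 0\<close>, and for \<open>n = N\<close> there is no limit to take.\<close>

lemma permuted_uniform_limit:
  assumes N: "1 \<le> N" and ul: "\<forall>i\<in>{1..N}. uniform_limits_at_infinity N (\<phi> i)"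
    and \<sigma>: "\<sigma> permutes {1..N}" and n: "n \<le> N" and i: "i \<in> {1..N}"
  obtains G where "\<And>\<delta>. 0 < \<delta> \<Longrightarrow> \<exists>r. \<forall>y\<in>states N. (\<forall>j\<in>{n+1..N}. r < y j) \<longrightarrow>
    \<bar>permute_allocation N \<sigma> \<phi> i y - G (restrict y {1..n})\<bar> \<le> \<delta>"
proof -
  let ?p = "permute_vector N (inv \<sigma>)"
  have \<sigma>i: "\<sigma> i \<in> {1..N}" using permutes_in_image[OF \<sigma>] i by simp
  have ul_i: "uniform_limits_at_infinity N (\<phi> (\<sigma> i))" using ul \<sigma>i by blast
  have p\<sigma>: "?p y (\<sigma> j) = y j" if "j \<in> {1..N}" for y :: "nat \<Rightarrow> nat" and j
    using that permutes_in_image[OF \<sigma>, of j] permutes_inverses(2)[OF \<sigma>] by (simp add: permute_vector_def)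
  consider "n = N" | "n = 0" | "1 \<le> n" "n < N" using n by linarith
  then show ?thesis
  proof cases
    case 1
    have "permute_allocation N \<sigma> \<phi> i y - permute_allocation N \<sigma> \<phi> i (restrict y {1..n}) = 0" if "y \<in> states N" for y
      unfolding 1 restrict_state_self[OF that] by simp
    then show ?thesis by (intro that[of "permute_allocation N \<sigma> \<phi> i"]) auto
  next
    case 2
    obtain c where c: "(\<lambda>r::nat. SUP x\<in>{x\<in>states N. \<forall>j\<in>{1..N}. r < x j}. ereal \<bar>\<phi> (\<sigma> i) x - c\<bar>) \<longlonglongrightarrow> 0"
      using ul_i by (auto simp: uniform_limits_at_infinity_def)
    show ?thesis
    proof (rule that[of "\<lambda>_. c"])
      fix \<delta> :: real assume "0 < \<delta>"
      then obtain r where r: "\<And>x. x \<in> {x\<in>states N. \<forall>j\<in>{1..N}. r < x j} \<Longrightarrow> \<bar>\<phi> (\<sigma> i) x - c\<bar> \<le> \<delta>"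
        by (rule SUP_ereal_tendsto_0D[OF c]) blast
      show "\<exists>r. \<forall>y\<in>states N. (\<forall>j\<in>{n+1..N}. r < y j) \<longrightarrow> \<bar>permute_allocation N \<sigma> \<phi> i y - c\<bar> \<le> \<delta>"
      proof (intro exI ballI impI)
        fix y assume y: "y \<in> states N" "\<forall>j\<in>{n+1..N}. r < y j"
        have "r < ?p y j" if "j \<in> {1..N}" for j
          using that y(2) 2 permutes_in_image[OF permutes_inv[OF \<sigma>], of j] by (simp add: permute_vector_def)
        then show "\<bar>permute_allocation N \<sigma> \<phi> i y - c\<bar> \<le> \<delta>"
          unfolding permute_allocation_def by (intro r) (auto intro: permute_state)
      qed
    qed
  next
    case 3
    obtain g where g: "(\<lambda>r::nat. SUP x\<in>{x\<in>states N. \<forall>j\<in>{n+1..N}. r < x (\<sigma> j)}.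
                ereal \<bar>\<phi> (\<sigma> i) x - g (\<lambda>j\<in>{1..n}. x (\<sigma> j))\<bar>) \<longlonglongrightarrow> 0"
      using ul_i 3 \<sigma> unfolding uniform_limits_at_infinity_def by blast
    show ?thesis
    proof (rule that[of g])
      fix \<delta> :: real assume "0 < \<delta>"
      then obtain r where r: "\<And>x. x \<in> {x\<in>states N. \<forall>j\<in>{n+1..N}. r < x (\<sigma> j)} \<Longrightarrow>
          \<bar>\<phi> (\<sigma> i) x - g (\<lambda>j\<in>{1..n}. x (\<sigma> j))\<bar> \<le> \<delta>"
        by (rule SUP_ereal_tendsto_0D[OF g]) blast
      show "\<exists>r. \<forall>y\<in>states N. (\<forall>j\<in>{n+1..N}. r < y j) \<longrightarrow> \<bar>permute_allocation N \<sigma> \<phi> i y - g (restrict y {1..n})\<bar> \<le> \<delta>"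
      proof (intro exI ballI impI)
        fix y assume y: "y \<in> states N" "\<forall>j\<in>{n+1..N}. r < y j"
        have "\<bar>\<phi> (\<sigma> i) (?p y) - g (\<lambda>j\<in>{1..n}. ?p y (\<sigma> j))\<bar> \<le> \<delta>"
        proof (rule r, intro CollectI conjI ballI permute_state)
          fix j assume j: "j \<in> {n+1..N}"
          then have "j \<in> {1..N}" by auto
          then show "r < ?p y (\<sigma> j)" using y(2) j by (simp only: p\<sigma>)
        qed
        moreover have "(\<lambda>j\<in>{1..n}. ?p y (\<sigma> j)) = restrict y {1..n}"
          using n by (intro restrict_ext p\<sigma>) auto
        ultimately show "\<bar>permute_allocation N \<sigma> \<phi> i y - g (restrict y {1..n})\<bar> \<le> \<delta>"
          unfolding permute_allocation_def by simp
      qed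
    qed
  qed
qed

lemma permuted_coupled_queues:
  assumes N: "1 \<le> N" and bd: "bounded_allocation N \<phi>" and pd: "partially_decreasing N \<phi>"
    and ul: "\<forall>i\<in>{1..N}. uniform_limits_at_infinity N (\<phi> i)"
  obtains B where "\<And>\<sigma>. \<sigma> permutes {1..N} \<Longrightarrow> coupled_queues N (permute_allocation N \<sigma> \<phi>) B
    (\<lambda>n. lower_partial_limit N n (permute_allocation N \<sigma> \<phi>))"
proof -
  obtain B0 where B0: "\<And>i x. i \<in> {1..N} \<Longrightarrow> x \<in> states N \<Longrightarrow> \<phi> i x \<le> B0"
    using bd unfolding bounded_allocation_def by blast
  have nn: "\<And>i x. i \<in> {1..N} \<Longrightarrow> x \<in> states N \<Longrightarrow> 0 \<le> \<phi> i x"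
    using bd unfolding bounded_allocation_def by blast
  show ?thesis
  proof (rule that[of "\<bar>B0\<bar>"])
    fix \<sigma> assume \<sigma>: "\<sigma> permutes {1..N}"
    let ?f = "permute_allocation N \<sigma> \<phi>" and ?p = "permute_vector N (inv \<sigma>)"
    have \<sigma>i: "\<sigma> i \<in> {1..N}" if "i \<in> {1..N}" for i using permutes_in_image[OF \<sigma>] that by simp
    show "coupled_queues N ?f \<bar>B0\<bar> (\<lambda>n. lower_partial_limit N n ?f)"
    proof
      show "0 \<le> ?f i x" if "i \<in> {1..N}" for i x
        unfolding permute_allocation_def by (rule nn[OF \<sigma>i[OF that] permute_state])
      show "?f i x \<le> \<bar>B0\<bar>" if "i \<in> {1..N}" for i x
        using B0[OF \<sigma>i[OF that] permute_state, of "inv \<sigma>" x] unfolding permute_allocation_def by linarith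
      show "0 \<le> \<bar>B0\<bar>" by simp
      show "partially_decreasing N ?f"
        unfolding partially_decreasing_def
      proof (intro ballI impI)
        fix i and x y :: "nat \<Rightarrow> nat" assume i: "i \<in> {1..N}" and xy: "(\<forall>j\<in>{1..N}. x j \<le> y j) \<and> x i = y i"
        have "\<forall>j\<in>{1..N}. ?p x j \<le> ?p y j"
          using xy permutes_in_image[OF permutes_inv[OF \<sigma>]] by (simp add: permute_vector_def)
        moreover have "?p x (\<sigma> i) = ?p y (\<sigma> i)"
          using xy \<sigma>i[OF i] permutes_inverses(2)[OF \<sigma>] by (simp add: permute_vector_def)
        ultimately show "?f i y \<le> ?f i x"
          using pd \<sigma>i[OF i] permute_state unfolding partially_decreasing_def permute_allocation_def by blast
      qed
      fix n i and \<delta> :: real assume n: "n \<le> N" and i: "i \<in> {1..N}" and \<delta>: "0 < \<delta>"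
      obtain G where G: "\<And>\<delta>. 0 < \<delta> \<Longrightarrow> \<exists>r. \<forall>y\<in>states N. (\<forall>j\<in>{n+1..N}. r < y j) \<longrightarrow> \<bar>?f i y - G (restrict y {1..n})\<bar> \<le> \<delta>"
        by (rule permuted_uniform_limit[OF N ul \<sigma> n i]) blast
      have "lower_partial_limit N n ?f i x = G x" if "x \<in> states n" for x
        by (rule lower_partial_limit_eq[where \<phi> = ?f and i = i and G = G, OF n that G])
      then show "\<exists>r. \<forall>x\<in>states N. (\<forall>j\<in>{n+1..N}. r < x j) \<longrightarrow>
          \<bar>?f i x - lower_partial_limit N n ?f i (restrict x {1..n})\<bar> \<le> \<delta>"
        using G[OF \<delta>] restrict_states[OF n] by metis
    qed
  qed
qed

text \<open>Swapping two queues that are both sent to infinity only renames queue \<open>i\<close>,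
  since both coordinates of an extended state equal \<open>m\<close>. It allows any later queue to
  be moved to position \<open>Suc n\<close> without disturbing the first \<open>n\<close>.\<close>

lemma lower_partial_limit_swap:
  assumes cq: "\<And>\<sigma>. \<sigma> permutes {1..N} \<Longrightarrow> coupled_queues N (permute_allocation N \<sigma> \<phi>) B
      (\<lambda>n. lower_partial_limit N n (permute_allocation N \<sigma> \<phi>))"
    and \<sigma>: "\<sigma> permutes {1..N}" and k: "k \<le> n" and a: "a \<in> {n+1..N}" and b: "b \<in> {n+1..N}"
    and i: "i \<in> {1..N}" and y: "y \<in> states k"
  defines "\<sigma>' \<equiv> \<sigma> \<circ> Transposition.transpose a b"
  shows "lower_partial_limit N k (permute_allocation N \<sigma>' \<phi>) i y =
    lower_partial_limit N k (permute_allocation N \<sigma> \<phi>) (Transposition.transpose a b i) y"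
proof -
  let ?t = "Transposition.transpose a b"
  have t: "?t permutes {1..N}" using a b by (intro permutes_swap_id) auto
  have \<sigma>': "\<sigma>' permutes {1..N}" unfolding \<sigma>'_def by (rule permutes_compose[OF t \<sigma>])
  interpret c: coupled_queues N "permute_allocation N \<sigma> \<phi>" B "\<lambda>n. lower_partial_limit N n (permute_allocation N \<sigma> \<phi>)"
    by (rule cq[OF \<sigma>])
  interpret c': coupled_queues N "permute_allocation N \<sigma>' \<phi>" B "\<lambda>n. lower_partial_limit N n (permute_allocation N \<sigma>' \<phi>)"
    by (rule cq[OF \<sigma>'])
  have kN: "k \<le> N" using k a by auto
  have ti: "?t i \<in> {1..N}" using permutes_in_image[OF t] i by simp
  have inv\<sigma>': "inv \<sigma>' = ?t \<circ> inv \<sigma>"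
    unfolding \<sigma>'_def using permutes_bij[OF \<sigma>] permutes_bij[OF t] by (simp add: o_inv_distrib)
  have "permute_vector N (inv \<sigma>') (extend_state N k m y) = permute_vector N (inv \<sigma>) (extend_state N k m y)" for m
  proof (rule states_eqI[OF permute_state permute_state])
    fix j assume j: "j \<in> {1..N}"
    then have "inv \<sigma> j \<in> {1..N}" using permutes_in_image[OF permutes_inv[OF \<sigma>]] by simp
    then show "permute_vector N (inv \<sigma>') (extend_state N k m y) j = permute_vector N (inv \<sigma>) (extend_state N k m y) j"
      using j a b k unfolding inv\<sigma>' by (auto simp: permute_vector_def extend_state_def Transposition.transpose_def)
  qed
  then have "permute_allocation N \<sigma>' \<phi> i (extend_state N k m y) = permute_allocation N \<sigma> \<phi> (?t i) (extend_state N k m y)" for m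
    by (simp add: permute_allocation_def \<sigma>'_def)
  then show ?thesis
    using c'.psi_lim[OF kN i y] c.psi_lim[OF kN ti y] LIMSEQ_unique by simp
qed

theorem theorem4:
  fixes N :: nat and \<phi> :: "nat \<Rightarrow> (nat \<Rightarrow> nat) \<Rightarrow> real"
  assumes "1 \<le> N"
    and "bounded_allocation N \<phi>"
    and "partially_decreasing N \<phi>"
    and "\<forall>i\<in>{1..N}. uniform_limits_at_infinity N (\<phi> i)"
  shows "openin (powertop_real {1..N}) (stability_region N \<phi>) \<and>
    (\<forall>l \<in> pos_vectors N. \<forall>(M :: 'w measure) X.
       markov_process M (states N) (queue_rate N l \<phi>) X \<longrightarrow>
         (l \<in> stability_region N \<phi> \<longrightarrow> stable_process M (states N) X) \<and>
         (l \<notin> powertop_real {1..N} closure_of stability_region N \<phi> \<longrightarrow> \<not> stable_process M (states N) X))"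
proof -
  define f where "f \<sigma> = permute_allocation N \<sigma> \<phi>" for \<sigma>
  define \<psi> where "\<psi> \<sigma> n = lower_partial_limit N n (f \<sigma>)" for \<sigma> n
  let ?p = "permute_vector N"
  obtain B where cq0: "\<And>\<sigma>. \<sigma> permutes {1..N} \<Longrightarrow> coupled_queues N (permute_allocation N \<sigma> \<phi>) B
    (\<lambda>n. lower_partial_limit N n (permute_allocation N \<sigma> \<phi>))"
    by (rule permuted_coupled_queues[OF assms]) blast
  have cq: "coupled_queues N (f \<sigma>) B (\<psi> \<sigma>)" if "\<sigma> permutes {1..N}" for \<sigma>
    using cq0[OF that] unfolding f_def \<psi>_def[abs_def] .
  have \<sigma>i: "\<sigma> i \<in> {1..N}" if "\<sigma> permutes {1..N}" "i \<in> {1..N}" for \<sigma> i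
    using permutes_in_image[OF that(1)] that(2) by simp
  have perm_pos: "?p \<sigma> l \<in> pos_vectors N" if "\<sigma> permutes {1..N}" "l \<in> pos_vectors N" for \<sigma> and l :: "nat \<Rightarrow> real"
    using that \<sigma>i[OF that(1)] by (auto simp: permute_vector_def pos_vectors_def PiE_iff)
  have perm_l: "?p \<sigma> l i = l (\<sigma> i)" if "i \<in> {1..N}" for \<sigma> and l :: "nat \<Rightarrow> real" and i
    using that by (simp add: permute_vector_def)
  have region: "l \<in> stability_region N \<phi> \<longleftrightarrow> l \<in> pos_vectors N \<and> (\<exists>\<sigma>. \<sigma> permutes {1..N} \<and> in_region (\<psi> \<sigma>) N (?p \<sigma> l))" for l
  proof -
    have "?p \<sigma> l \<in> ordered_region N (f \<sigma>) \<longleftrightarrow> in_region (\<psi> \<sigma>) N (?p \<sigma> l)"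
      if "\<sigma> permutes {1..N}" "l \<in> pos_vectors N" for \<sigma>
      using ordered_region_iff[OF cq[unfolded \<psi>_def[abs_def], OF that(1)] perm_pos[OF that]]
      unfolding \<psi>_def[abs_def] .
    then show ?thesis unfolding stability_region_def f_def by blast
  qed
  have phi_sys: "monotone_system N l (f \<sigma>) B" if "\<sigma> permutes {1..N}" "\<And>i. i \<in> {1..N} \<Longrightarrow> 0 < l i" for \<sigma> l
  proof -
    interpret coupled_queues N "f \<sigma>" B "\<psi> \<sigma>" by (rule cq[OF that(1)])
    show ?thesis using that(2) phi_nonneg phi_le B_ge0 phi_antiD by unfold_locales auto
  qed
  have f_id: "f id i x = \<phi> i x" if "i \<in> {1..N}" "x \<in> states N" for i x
    using permute_inv_permute[OF permutes_id that(2)] that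
    by (simp add: f_def permute_allocation_def permute_vector_def restrict_state_self[simplified])
  have open_region: "openin (powertop_real {1..N}) (stability_region N \<phi>)"
  proof (subst openin_subopen, intro ballI)
    fix l assume "l \<in> stability_region N \<phi>"
    then obtain \<sigma> where l: "l \<in> pos_vectors N" and \<sigma>: "\<sigma> permutes {1..N}" and reg: "in_region (\<psi> \<sigma>) N (?p \<sigma> l)"
      using region by blast
    interpret coupled_queues N "f \<sigma>" B "\<psi> \<sigma>" by (rule cq[OF \<sigma>])
    obtain \<delta> where \<delta>: "0 < \<delta>" "in_region (\<psi> \<sigma>) N (\<lambda>i. ?p \<sigma> l i + \<delta>)"
      using in_region_up[OF order_refl reg] by blast
    \<comment> \<open>A neighbour of \<open>l\<close> may be larger in some coordinates and smaller
      in others, but all of \<open>?U\<close> lies below \<open>l + \<delta>\<close>, so closure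
      under decrease covers it.\<close>
    let ?U = "PiE {1..N} (\<lambda>i. {0<..<l i + \<delta>})"
    have "openin (powertop_real {1..N}) ?U" by (subst openin_PiE) auto
    moreover have "l \<in> ?U" using l \<delta>(1) by (auto simp: pos_vectors_def PiE_iff)
    moreover have "?U \<subseteq> stability_region N \<phi>"
    proof
      fix l' assume l': "l' \<in> ?U"
      then have "l' \<in> pos_vectors N" by (auto simp: pos_vectors_def PiE_iff)
      moreover have "in_region (\<psi> \<sigma>) N (?p \<sigma> l')"
      proof (rule in_region_down[OF order_refl \<delta>(2)])
        fix i assume i: "i \<in> {1..N}"
        have "0 < l' (\<sigma> i) \<and> l' (\<sigma> i) < l (\<sigma> i) + \<delta>" using l' \<sigma>i[OF \<sigma> i] by (auto simp: PiE_iff)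
        then show "0 < ?p \<sigma> l' i" "?p \<sigma> l' i \<le> ?p \<sigma> l i + \<delta>" using perm_l[OF i] by auto
      qed
      ultimately show "l' \<in> stability_region N \<phi>" using region \<sigma> by blast
    qed
    ultimately show "\<exists>T. openin (powertop_real {1..N}) T \<and> l \<in> T \<and> T \<subseteq> stability_region N \<phi>" by blast
  qed
  have closure: "l \<in> powertop_real {1..N} closure_of stability_region N \<phi>"
    if l: "l \<in> pos_vectors N" and inv: "invariant N l \<phi> \<mu>" for l \<mu>
  proof -
    have lpos: "0 < l i" if "i \<in> {1..N}" for i using l that by (auto simp: pos_vectors_def)
    have below: "l' \<in> stability_region N \<phi>"
      if l': "l' \<in> pos_vectors N" and less: "\<And>i. i \<in> {1..N} \<Longrightarrow> l' i < l i" for l'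
    proof (rule ccontr)
      assume notin: "l' \<notin> stability_region N \<phi>"
      have l'pos: "0 < l' i" if "i \<in> {1..N}" for i using l' that by (auto simp: pos_vectors_def)
      \<comment> \<open>\<open>P n\<close> says that some \<open>n\<close> queues can be ordered so
        that the conditions hold for \<open>l'\<close>. It holds at 0 and fails at \<open>N\<close>,
        so somewhere it holds at \<open>n\<close> and fails at \<open>Suc n\<close>.\<close>
      define P where "P n \<longleftrightarrow> (\<exists>\<sigma>. \<sigma> permutes {1..N} \<and> in_region (\<psi> \<sigma>) n (?p \<sigma> l'))" for n
      have P0: "P 0" unfolding P_def in_region_def using permutes_id by blast
      have PN: "\<not> P N" using notin l' region unfolding P_def by blast
      have "\<exists>n<N. P n \<and> \<not> P (Suc n)"
      proof (rule ccontr)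
        assume *: "\<not> ?thesis"
        have "P k" if "k \<le> N" for k
          using that
        proof (induction k)
          case (Suc k) then show ?case using * by (meson Suc_leD Suc_le_lessD)
        qed (rule P0)
        then show False using PN by blast
      qed
      then obtain n \<sigma> where n: "n < N" and \<sigma>: "\<sigma> permutes {1..N}" and reg: "in_region (\<psi> \<sigma>) n (?p \<sigma> l')"
        and notP: "\<not> P (Suc n)" unfolding P_def by blast
      interpret coupled_queues N "f \<sigma>" B "\<psi> \<sigma>" by (rule cq[OF \<sigma>])
      obtain \<nu> where \<nu>: "invariant n (?p \<sigma> l') (\<psi> \<sigma> n) \<nu>"
        using in_region_invariant[OF _ reg] n by auto
      \<comment> \<open>Otherwise queue \<open>j\<close> could be transposed to position
        \<open>Suc n\<close>, which would make \<open>P (Suc n)\<close> true; the limits concerning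
        the first \<open>n\<close> positions are unaffected by the swap.\<close>
      have blocked: "expect \<nu> (\<psi> \<sigma> n j) \<le> l' (\<sigma> j)" if j: "j \<in> {n+1..N}" for j
      proof (rule ccontr)
        assume "\<not> ?thesis"
        then have lt: "l' (\<sigma> j) < expect \<nu> (\<psi> \<sigma> n j)" by simp
        define \<sigma>' where "\<sigma>' = \<sigma> \<circ> Transposition.transpose (Suc n) j"
        have Sn: "Suc n \<in> {n+1..N}" using n by simp
        have \<sigma>': "\<sigma>' permutes {1..N}" unfolding \<sigma>'_def
          using Sn j by (intro permutes_compose[OF _ \<sigma>] permutes_swap_id) auto
        have swap: "\<psi> \<sigma>' k i y = \<psi> \<sigma> k (Transposition.transpose (Suc n) j i) y"
          if "k \<le> n" "i \<in> {1..N}" "y \<in> states k" for k i y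
          unfolding \<psi>_def f_def \<sigma>'_def
          by (rule lower_partial_limit_swap[OF cq0 \<sigma> that(1) Sn j that(2,3)])
        have tr: "Transposition.transpose (Suc n) j i = i" if "i \<in> {1..n}" for i
          using that j by (auto simp: Transposition.transpose_def)
        have l'\<sigma>': "?p \<sigma> l' i = ?p \<sigma>' l' i" if "i \<in> {1..n}" for i
          using that n tr[OF that] by (simp add: perm_l \<sigma>'_def)
        have "in_region (\<psi> \<sigma>') n (?p \<sigma>' l')"
        proof (rule in_region_cong[OF reg l'\<sigma>'])
          fix k i and x :: "nat \<Rightarrow> nat" assume "k < n" "i \<in> {1..Suc k}" "x \<in> states k"
          then show "\<psi> \<sigma> k i x = \<psi> \<sigma>' k i x" using n tr[of i] by (subst swap) auto
        qed
        moreover have "invariant n (?p \<sigma>' l') (\<psi> \<sigma>' n) \<nu>"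
        proof (rule invariant_cong[OF \<nu> l'\<sigma>'])
          fix i and x :: "nat \<Rightarrow> nat" assume "i \<in> {1..n}" "x \<in> states n"
          then show "\<psi> \<sigma> n i x = \<psi> \<sigma>' n i x" using n tr[of i] by (subst swap) auto
        qed
        moreover have "?p \<sigma>' l' (Suc n) = l' (\<sigma> j)" using n by (simp add: perm_l \<sigma>'_def)
        moreover have "expect \<nu> (\<psi> \<sigma>' n (Suc n)) = expect \<nu> (\<psi> \<sigma> n j)"
        proof (rule expect_cong)
          fix x assume "x \<in> set_pmf \<nu>"
          then have "x \<in> states n" using \<nu> by (auto simp: invariant_def)
          then show "\<psi> \<sigma>' n (Suc n) x = \<psi> \<sigma> n j x" using n by (subst swap) auto
        qed
        moreover have "0 < l' (\<sigma> j)" using j by (intro l'pos \<sigma>i[OF \<sigma>]) auto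
        ultimately have "in_region (\<psi> \<sigma>') (Suc n) (?p \<sigma>' l')"
          unfolding in_region_Suc using lt by auto
        then show False using notP \<sigma>' unfolding P_def by blast
      qed
      \<comment> \<open>The rates \<open>l'\<close> on the first \<open>n\<close> queues preserve
        \<open>\<nu>\<close>; the larger rates \<open>l\<close> on the others turn the weak
        inequality \<open>blocked\<close> into strict drift. Being at most the permuted
        \<open>l\<close>, these rates are dominated by a system with an invariant
        distribution.\<close>
      define l2 where "l2 i = (if i \<le> n then l' (\<sigma> i) else l (\<sigma> i))" for i
      have l2pos: "0 < l2 i" if "i \<in> {1..N}" for i
        using that l'pos lpos \<sigma>i[OF \<sigma> that] by (auto simp: l2_def)
      have inv2: "invariant n l2 (\<psi> \<sigma> n) \<nu>"
        by (rule invariant_cong[OF \<nu>]) (use n in \<open>auto simp: l2_def perm_l\<close>)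
      have drift: "expect \<nu> (\<psi> \<sigma> n i) < l2 i" if "i \<in> {n+1..N}" for i
        using blocked[OF that] less[OF \<sigma>i[OF \<sigma>], of i] that by (auto simp: l2_def)
      have no: "\<not> invariant N l2 (f \<sigma>) \<mu>'" for \<mu>'
        by (rule no_invariant[where l = l2, OF n l2pos inv2 drift])
      have inv\<sigma>: "invariant N (?p \<sigma> l) (f \<sigma>) (map_pmf (?p \<sigma>) \<mu>)"
        unfolding f_def by (rule invariant_permute[OF \<sigma> inv])
      interpret a: monotone_system N "?p \<sigma> l" "f \<sigma>" B
        by (rule phi_sys[OF \<sigma>]) (use lpos \<sigma>i[OF \<sigma>] perm_l in auto)
      interpret b: monotone_system N l2 "f \<sigma>" B by (rule phi_sys[OF \<sigma> l2pos])
      obtain \<mu>' where "invariant N l2 (f \<sigma>) \<mu>'"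
      proof (rule invariant_exists_dominated[OF a.monotone_system_axioms b.queue_system_axioms _ order_refl inv\<sigma>])
        show "l2 i \<le> ?p \<sigma> l i" if "i \<in> {1..N}" for i
          using less[OF \<sigma>i[OF \<sigma> that]] perm_l[OF that] by (simp add: l2_def)
      qed
      then show False using no by blast
    qed
    show ?thesis
      unfolding in_closure_of
    proof (intro conjI allI impI)
      show "l \<in> topspace (powertop_real {1..N})" using l by (auto simp: pos_vectors_def PiE_iff)
      fix T assume T: "l \<in> T \<and> openin (powertop_real {1..N}) T"
      \<comment> \<open>The ray through \<open>l\<close>: for \<open>0 < t < 1\<close> its points
        are positive and strictly below \<open>l\<close> in every coordinate, and they come
        arbitrarily close to \<open>l\<close>.\<close>
      define \<gamma> where "\<gamma> t = (\<lambda>i\<in>{1..N}. t * l i)" for t :: real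
      have "continuous_map euclideanreal (powertop_real {1..N}) \<gamma>"
        unfolding continuous_map_componentwise
        by (auto simp: \<gamma>_def extensional_def intro!: continuous_intros)
      then have "openin euclideanreal {t \<in> topspace euclideanreal. \<gamma> t \<in> T}"
        using T unfolding continuous_map_def by blast
      then have op: "open {t. \<gamma> t \<in> T}" by simp
      have "\<gamma> 1 = l" using l by (auto simp: \<gamma>_def pos_vectors_def PiE_iff extensional_def fun_eq_iff)
      then have "1 \<in> {t. \<gamma> t \<in> T}" using T by simp
      with op obtain e where e: "0 < e" "\<And>t. dist t 1 < e \<Longrightarrow> \<gamma> t \<in> T"
        unfolding open_dist by blast
      \<comment> \<open>The maximum with \<open>1 / 2\<close> keeps \<open>t\<close> positive when
        \<open>e\<close> is large.\<close>
      define t where "t = max (1 / 2) (1 - e / 2)"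
      have t: "0 < t" "t < 1" "dist t 1 < e" using e(1) by (auto simp: t_def dist_real_def max_def)
      have "\<gamma> t \<in> stability_region N \<phi>"
      proof (rule below)
        show "\<gamma> t \<in> pos_vectors N" using t lpos by (auto simp: \<gamma>_def pos_vectors_def)
        show "\<gamma> t i < l i" if "i \<in> {1..N}" for i
          using t(2) lpos[OF that] that by (simp add: \<gamma>_def)
      qed
      then show "\<exists>y. y \<in> stability_region N \<phi> \<and> y \<in> T" using e(2)[OF t(3)] by blast
    qed
  qed
  have stab: "stable_process M (states N) X \<longleftrightarrow> (\<exists>\<mu>. invariant N l \<phi> \<mu>)"
    if l: "l \<in> pos_vectors N" and mp: "markov_process M (states N) (queue_rate N l \<phi>) X"
    for l X and M :: "'w measure"
  proof -
    have lpos: "0 < l i" if "i \<in> {1..N}" for i using l that by (auto simp: pos_vectors_def)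
    \<comment> \<open>\<open>f id\<close> is known to agree with \<open>\<phi>\<close> on
      \<open>states N\<close> only, so the bounds are transferred pointwise.\<close>
    interpret a: monotone_system N l "f id" B by (rule phi_sys[OF permutes_id lpos])
    interpret b: monotone_system N l \<phi> B
    proof
      fix i x assume ix: "i \<in> {1..N}" "x \<in> states N"
      show "0 \<le> \<phi> i x" "\<phi> i x \<le> B" using a.f_nonneg[OF ix] a.f_le[OF ix] f_id[OF ix] by simp_all
    next
      fix i x y assume "i \<in> {1..N}" "x \<in> states N" "y \<in> states N" "\<And>j. j \<in> {1..N} \<Longrightarrow> x j \<le> y j" "x i = y i"
      then show "\<phi> i y \<le> \<phi> i x" using assms(3) unfolding partially_decreasing_def by blast
    qed (auto simp: lpos a.B_nonneg)
    show ?thesis by (rule b.stable_iff_invariant[OF mp])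
  qed
  have region_invariant: "\<exists>\<mu>. invariant N l \<phi> \<mu>" if "l \<in> stability_region N \<phi>" for l
  proof -
    from that obtain \<sigma> where \<sigma>: "\<sigma> permutes {1..N}" and reg: "in_region (\<psi> \<sigma>) N (?p \<sigma> l)"
      using region by blast
    interpret coupled_queues N "f \<sigma>" B "\<psi> \<sigma>" by (rule cq[OF \<sigma>])
    obtain \<mu> where "invariant N (?p \<sigma> l) (\<psi> \<sigma> N) \<mu>" using in_region_invariant[OF order_refl reg] by blast
    then have "invariant N (?p \<sigma> l) (f \<sigma>) \<mu>" by (rule invariant_cong) (simp_all add: psi_N)
    then show ?thesis using invariant_unpermute[OF \<sigma>, of l \<phi> \<mu>] unfolding f_def by blast
  qed
  show ?thesis using open_region stab region_invariant closure by blast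
qed

end
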